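(* Let $t\ge1$ be an integer. For all sufficiently large integers $p\ge3$ the following holds: if $\mu$ is a $p$-adic missing digits measure on $\mathbb{R}$ with $t$ missing digits and $s=\dim_{\mathrm{H}}\mu$, then $\mu$ is spectral and $\dim_{l^1}\mu\cdot\dim_{\mathrm{H}}\mu>1/2$; furthermore, there is $c=c_{t,p}>0$ such that for $\psi(q)=q^{-1-c'}$ with $c'\in(0,c]$, \[ \dim_{\mathrm{H}}\big(W(\psi,0)\cap\mathrm{supp}(\mu)\big)=s-\frac{c'}{2+c'}. \]
   Context: A $p$-adic missing digits measure with $t$ missing digits is the law of $\sum_{j\ge1}a_jp^{-j}$ with $a_j$ i.i.d. uniform on a set $D\subset\{0,\dots,p-1\}$ with $\#D=p-t\ge2$. $\hat\mu(\xi)=\int e^{-2\pi ix\xi}d\mu(x)$ ($\xi\in\mathbb{Z}$); $\dim_{l^1}\mu=\sup\{s>0:\sum_{|\xi|\le R}|\hat\mu(\xi)|\ll R^{1-s}\}$. $\mu$ is spectral if there exist $\Delta>1/2$ and $\lambda>0$ with $\#\{\xi\in\mathbb{Z}\cap[0,N]:|\hat\mu(\xi)|\ge|\xi|^{-\Delta}\}\ll N^{1-\lambda}$. $\|x\|$ is the distance from $x$ to $\mathbb{Z}$ and $W(\psi,0)=\{x\in\mathbb{R}:\|qx\|\le\psi(q)\text{ for infinitely many }q\in\mathbb{N}\}$. *)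

theory Defs
  imports "HOL-Probability.Probability" "HOL-Library.Landau_Symbols"
begin

section \<open>Hausdorff dimension\<close>

text \<open>
  Hausdorff measure is used for exponents \<open>d > 0\<close> only, so the convention \<open>0 powr d = 0\<close> gives
  the right weight to empty sets and singletons.  Covers consist of bounded sets because
  \<^const>\<open>diameter\<close> is a junk value on unbounded sets; finite covers are included by padding with
  the empty set.
\<close>

definition hausdorff_premeasure :: "real \<Rightarrow> real \<Rightarrow> 'a::metric_space set \<Rightarrow> ennreal" where
  "hausdorff_premeasure d \<delta> A =
     (INF U \<in> {U :: nat \<Rightarrow> 'a set. A \<subseteq> (\<Union>i. U i) \<and> (\<forall>i. bounded (U i) \<and> diameter (U i) \<le> \<delta>)}.
        \<Sum>i. ennreal (diameter (U i) powr d))"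

definition hausdorff_measure :: "real \<Rightarrow> 'a::metric_space set \<Rightarrow> ennreal" where
  "hausdorff_measure d A = (SUP \<delta> \<in> {0<..}. hausdorff_premeasure d \<delta> A)"

definition hausdorff_dim :: "'a::metric_space set \<Rightarrow> ereal" where
  "hausdorff_dim A = Inf (ereal ` {d. d > 0 \<and> hausdorff_measure d A = 0})"

text \<open>The (lower) Hausdorff dimension of a Borel measure.\<close>

definition measure_hausdorff_dim :: "'a::metric_space measure \<Rightarrow> ereal" where
  "measure_hausdorff_dim \<mu> = (INF A \<in> {A \<in> sets borel. emeasure \<mu> A > 0}. hausdorff_dim A)"

definition measure_support :: "'a::topological_space measure \<Rightarrow> 'a set" where
  "measure_support \<mu> = {x. \<forall>U. open U \<longrightarrow> x \<in> U \<longrightarrow> emeasure \<mu> U > 0}"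


section \<open>Missing digits measures\<close>

text \<open>
  The coordinate \<open>a j\<close> of the product space is the digit \<open>a\<^bsub>j+1\<^esub>\<close>, since coordinates start
  at index 0.
\<close>

definition missing_digits_law :: "nat \<Rightarrow> nat set \<Rightarrow> real measure" where
  "missing_digits_law p D =
     distr (PiM UNIV (\<lambda>_::nat. measure_pmf (pmf_of_set D))) borel
       (\<lambda>a. \<Sum>j. real (a j) / real p ^ Suc j)"

definition missing_digits_measure :: "nat \<Rightarrow> nat \<Rightarrow> real measure \<Rightarrow> bool" where
  "missing_digits_measure p t \<mu> \<longleftrightarrow>
     (\<exists>D \<subseteq> {0..<p}. card D + t = p \<and> card D \<ge> 2 \<and> \<mu> = missing_digits_law p D)"


section \<open>Fourier coefficients\<close>

definition fourier_coeff :: "real measure \<Rightarrow> int \<Rightarrow> complex" where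
  "fourier_coeff \<mu> \<xi> = (CLINT x|\<mu>. exp (- 2 * complex_of_real pi * \<i> * complex_of_real x * of_int \<xi>))"

definition l1_dim :: "real measure \<Rightarrow> ereal" where
  "l1_dim \<mu> = Sup (ereal ` {s. s > 0 \<and>
     (\<lambda>R::nat. \<Sum>\<xi> \<in> {- int R..int R}. norm (fourier_coeff \<mu> \<xi>)) \<in> O(\<lambda>R. real R powr (1 - s))})"

text \<open>
  For \<open>\<xi> = 0\<close> the threshold should be \<open>\<infinity>\<close>, whereas \<open>0 powr (- \<Delta>) = 0\<close>.  Hence \<open>\<xi> = 0\<close> is always
  counted, which is harmless: the count changes by at most one and \<open>\<kappa>\<close> may be taken to be at most 1.
  (The exponent usually called lambda is \<open>\<kappa>\<close> here.)
\<close>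

definition spectral_measure :: "real measure \<Rightarrow> bool" where
  "spectral_measure \<mu> \<longleftrightarrow> (\<exists>\<Delta> > 1/2. \<exists>\<kappa> > 0.
     (\<lambda>N::nat. real (card {\<xi> \<in> {0..int N}. norm (fourier_coeff \<mu> \<xi>) \<ge> \<bar>real_of_int \<xi>\<bar> powr (- \<Delta>)}))
       \<in> O(\<lambda>N. real N powr (1 - \<kappa>)))"


section \<open>Well-approximable numbers\<close>

definition dist_nearest_int :: "real \<Rightarrow> real" where
  "dist_nearest_int x = infdist x \<int>"

text \<open>This is the homogeneous set \<open>W(\<psi>, 0)\<close>.\<close>

definition well_approximable :: "(nat \<Rightarrow> real) \<Rightarrow> real set" where
  "well_approximable \<psi> = {x. \<exists>\<^sub>\<infinity>q. dist_nearest_int (real q * x) \<le> \<psi> q}"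

end

theory Submission
  imports Defs "HOL-Real_Asymp.Real_Asymp"
begin

text \<open>
  Let \<open>b = card D\<close> and \<open>s = log p b\<close>. The Fourier transform of \<open>\<mu>\<close> is an infinite product, so its sum
  over the residues modulo \<open>p ^ n\<close> is at most the \<open>n\<close>-th power of a sum over the residues modulo \<open>p\<close>,
  which for few missing digits is dominated by the Dirichlet kernel and is \<open>O(ln p)\<close>. Hence the
  sum of \<open>|\<mu>^(\<xi>)|\<close> over \<open>|\<xi>| \<le> X\<close> is at most \<open>X powr (1 / 20)\<close> up to a constant, while \<open>s \<ge> 9 / 10\<close>,
  for large \<open>p\<close>; the spectral property is immediate from this.

  With trigonometric majorants and minorants and the divisor bound, the same estimate counts the
  cylinders of level \<open>n\<close> that are within about \<open>p ^ (- n)\<close> of a rational with denominator about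
  \<open>R = p powr (n / (2 + c'))\<close>: there are about \<open>b ^ n * R\<^sup>2 / p ^ n\<close> of them. As an upper bound this gives an
  efficient cover of the limsup set. For the lower bound one needs that they are well spread. Inside
  cylinders of level at most \<open>n / 5\<close> this is again the Fourier estimate; at finer scales it
  suffices that distinct rationals are separated by \<open>1 / R\<^sup>2\<close>, because \<open>1 - s < 1 / 5\<close>.
  Iterating over a rapidly increasing sequence of levels yields a Cantor subset of dimension
  \<open>s - c' / (2 + c')\<close>.
\<close>

section \<open>Words and exponential sums\<close>

text \<open>The obstacle is that Fourier bounds count pairs (denominator, word), not words: a word
  near a fraction with small reduced denominator \<open>r\<close> may be found by as many as
  \<open>R / r\<close> denominators. Hence the upper count carries the weight \<open>1 / r\<close>,
  and it is used a second time, to show that such words take only a small share of the pairs. The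
  exponents leave room. A fixed prefix of length \<open>m\<close> is not averaged over and costs a
  factor \<open>p ^ m\<close>; with \<open>n / 20\<close> from the residue sums and
  \<open>n / 20\<close> from the divisor bound, the error has exponent \<open>n / 10 + m\<close>.
  For \<open>c' \<le> 1 / 10\<close> the exponent \<open>1 / (2 + c')\<close> of \<open>R\<close> is
  at least \<open>10 / 21\<close>, which exceeds the \<open>4 / 10\<close> needed when
  \<open>m \<le> n / 5\<close> and a further \<open>n / 10\<close> absorbs constants. At a finer
  level \<open>l > n / 5\<close>, with \<gamma> = \<open>c' / (2 + c')\<close>, the separation bound
  loses \<open>n * \<gamma> * (1 - s)\<close>, at most \<open>n * \<gamma> / 10\<close>, in the
  exponent, while aiming at a dimension \<open>d < s - \<gamma>\<close> gains
  \<open>l * (s - d)\<close>, more than \<open>n * \<gamma> / 5\<close>.\<close>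

definition ec :: "real \<Rightarrow> complex" where
  "ec x = cis (2 * pi * x)"

lemma norm_ec [simp]: "norm (ec x) = 1"
  by (simp add: ec_def)

lemma ec_0 [simp]: "ec 0 = 1"
  by (simp add: ec_def)

lemma ec_add: "ec (x + y) = ec x * ec y"
  by (simp add: ec_def cis_mult ring_distribs)

lemma ec_minus: "ec (- x) = cnj (ec x)"
  by (simp add: ec_def cis_cnj)

lemma ec_of_int [simp]: "ec (of_int k) = 1"
  by (simp add: ec_def cis_multiple_2pi)

lemma ec_add_of_int [simp]: "ec (x + of_int k) = ec x"
  by (simp add: ec_add)

lemma Re_ec: "Re (ec x) = cos (2 * pi * x)"
  by (simp add: ec_def)

lemma norm_sum_ec_minus: "norm (\<Sum>i\<in>I. ec (- f i)) = norm (\<Sum>i\<in>I. ec (f i))"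
proof -
  have "(\<Sum>i\<in>I. ec (- f i)) = cnj (\<Sum>i\<in>I. ec (f i))"
    by (simp add: ec_minus)
  then show ?thesis by (simp only: complex_mod_cnj)
qed

locale digits =
  fixes p :: nat and D :: "nat set"
  assumes p_ge: "p \<ge> 2" and D_sub: "D \<subseteq> {0..<p}" and card_D: "card D \<ge> 2"
begin

definition b :: nat where "b = card D"

lemma finite_D [simp]: "finite D"
  using D_sub finite_subset by blast

lemma p_pos [simp]: "p > 0" using p_ge by simp

lemma p_nonzero [simp]: "p \<noteq> 0" using p_ge by simp

lemma b_ge: "b \<ge> 2" using card_D by (simp add: b_def)

lemma b_pos [simp]: "b > 0" using b_ge by simp

lemma D_less: "d \<in> D \<Longrightarrow> d < p" using D_sub by auto

text \<open>A word of length \<open>n\<close> in the digits \<open>D\<close> is encoded by the number with that base-\<open>p\<close>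
  expansion; \<open>desc w k\<close> are the words extending \<open>w\<close> by \<open>k\<close> digits, so that \<open>desc 0 n\<close> are all
  words of length \<open>n\<close>.\<close>

primrec desc :: "nat \<Rightarrow> nat \<Rightarrow> nat set" where
  "desc w 0 = {w}"
| "desc w (Suc k) = (\<lambda>(a, d). p * a + d) ` (desc w k \<times> D)"

lemma inj_digit: "inj_on (\<lambda>(a, d). p * a + d) (A \<times> D)"
proof (rule inj_onI, clarify)
  fix a d a' d' assume "d \<in> D" "d' \<in> D" and eq: "p * a + d = p * a' + d'"
  then have less: "d < p" "d' < p" using D_less by auto
  have "a = (p * a + d) div p" "a' = (p * a' + d') div p" using less by auto
  moreover have "d = (p * a + d) mod p" "d' = (p * a' + d') mod p" using less by auto
  ultimately show "a = a' \<and> d = d'" using eq by simp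
qed

lemma finite_desc [simp]: "finite (desc w k)"
  by (induction k) auto

lemma card_desc: "card (desc w k) = b ^ k"
  by (induction k) (auto simp: card_image[OF inj_digit] card_cartesian_product b_def)

lemma desc_div: "u \<in> desc w k \<Longrightarrow> u div p ^ k = w"
proof (induction k arbitrary: u)
  case (Suc k)
  then obtain a d where "a \<in> desc w k" "d \<in> D" "u = p * a + d" by auto
  moreover from this have "u div p = a" using D_less by simp
  ultimately show ?case using Suc.IH by (simp add: div_mult2_eq)
qed auto

lemma desc_bounds:
  assumes "u \<in> desc w k"
  shows "w * p ^ k \<le> u" "u < (w + 1) * p ^ k"
proof -
  have "w * p ^ k + u mod p ^ k = u" using desc_div[OF assms] div_mult_mod_eq[of u "p ^ k"] by simp
  moreover have "u mod p ^ k < p ^ k" by simp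
  ultimately show "w * p ^ k \<le> u" "u < (w + 1) * p ^ k" unfolding ring_distribs by linarith+
qed

lemma desc_add: "desc w (j + k) = (\<Union>u\<in>desc w j. desc u k)"
  by (induction k) auto

lemma desc_trans: "u \<in> desc w j \<Longrightarrow> v \<in> desc u k \<Longrightarrow> v \<in> desc w (j + k)"
  by (auto simp: desc_add)

section \<open>Normalised exponential sums over digits and over words\<close>

definition F :: "real \<Rightarrow> real" where
  "F x = norm (\<Sum>d\<in>D. ec (real d * x)) / real b"

text \<open>Modulus of the Fourier transform of the uniform law on words of length \<open>k\<close>:
  the digit in position \<open>j\<close> from the bottom has weight \<open>p ^ j\<close>. Cylinders
  of level \<open>n\<close> sit at \<open>u / p ^ n\<close>, so the typical argument is \<xi>
  divided by \<open>p ^ n\<close>.\<close>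

definition G :: "nat \<Rightarrow> real \<Rightarrow> real" where
  "G k x = (\<Prod>j<k. F (real p ^ j * x))"

lemma F_nonneg [simp]: "F x \<ge> 0" by (simp add: F_def)

lemma F_le_1: "F x \<le> 1"
proof -
  have "norm (\<Sum>d\<in>D. ec (real d * x)) \<le> (\<Sum>d\<in>D. norm (ec (real d * x)))" by (rule norm_sum)
  also have "\<dots> = real b" by (simp add: b_def)
  finally show ?thesis using b_pos by (simp add: F_def divide_simps)
qed

lemma F_add_int [simp]: "F (x + of_int k) = F x"
proof -
  have "ec (real d * (x + of_int k)) = ec (real d * x)" for d
    using ec_add_of_int[of "real d * x" "int d * k"] by (simp add: ring_distribs)
  then show ?thesis by (simp add: F_def)
qed

lemma F_minus [simp]: "F (- x) = F x"
  using norm_sum_ec_minus[of "\<lambda>d. real d * x" D] by (simp add: F_def)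

lemma G_0 [simp]: "G 0 x = 1" by (simp add: G_def)

lemma G_Suc: "G (Suc k) x = F x * G k (real p * x)"
  unfolding G_def prod.lessThan_Suc_shift by (simp add: mult_ac)

lemma G_nonneg [simp]: "G k x \<ge> 0"
  by (auto simp: G_def intro: prod_nonneg)

lemma G_minus [simp]: "G k (- x) = G k x"
  by (simp add: G_def)

lemma G_add_int [simp]: "G k (x + of_int i) = G k x"
proof (induction k arbitrary: x i)
  case (Suc k)
  have "G k (real p * (x + of_int i)) = G k (real p * x)"
    using Suc[of "real p * x" "int p * i"] by (simp add: ring_distribs)
  then show ?case by (simp add: G_Suc)
qed auto

text \<open>The digits are chosen independently, so the sum factorises. The prefix \<open>w\<close>
  contributes only a phase, which is why every estimate below a given prefix is uniform in
  it.\<close>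

lemma norm_sum_desc: "norm (\<Sum>u\<in>desc w k. ec (x * real u)) = real b ^ k * G k x"
proof (induction k arbitrary: x)
  case (Suc k)
  have "(\<Sum>u\<in>desc w (Suc k). ec (x * real u)) = (\<Sum>(a, d)\<in>desc w k \<times> D. ec (x * real (p * a + d)))"
    by (simp only: desc.simps sum.reindex[OF inj_digit]) (simp add: case_prod_unfold)
  also have "\<dots> = (\<Sum>a\<in>desc w k. \<Sum>d\<in>D. ec ((real p * x) * real a) * ec (real d * x))"
    by (simp add: sum.cartesian_product ec_add[symmetric] ring_distribs mult_ac add.commute)
  also have "\<dots> = (\<Sum>a\<in>desc w k. ec ((real p * x) * real a)) * (\<Sum>d\<in>D. ec (real d * x))"
    by (simp add: sum_product)
  finally have "norm (\<Sum>u\<in>desc w (Suc k). ec (x * real u)) = (real b ^ k * G k (real p * x)) * (real b * F x)"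
    using Suc by (simp add: norm_mult F_def)
  then show ?case by (simp add: G_Suc)
qed auto

text \<open>The sum over the residues modulo \<open>p ^ n\<close> is carried out over the top digit first.\<close>

lemma sum_G_residues:
  assumes A: "\<And>x. 0 \<le> x \<Longrightarrow> x < 1 / real p \<Longrightarrow> (\<Sum>i<p. F (x + real i / real p)) \<le> A"
  shows "(\<Sum>\<xi><p ^ (m + k). G k (real \<xi> / real p ^ (m + k))) \<le> real p ^ m * A ^ k"
proof (induction k)
  case (Suc k)
  let ?n = "m + k"
  have "0 \<le> (\<Sum>i<p. F (0 + real i / real p))" by (intro sum_nonneg F_nonneg)
  also have "\<dots> \<le> A" by (rule A) auto
  finally have A0: "A \<ge> 0" .
  have "(\<Sum>\<xi><p ^ Suc ?n. G (Suc k) (real \<xi> / real p ^ Suc ?n))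
      = (\<Sum>(i, a)\<in>{..<p} \<times> {..<p ^ ?n}. G (Suc k) (real (a + i * p ^ ?n) / real p ^ Suc ?n))"
  proof (rule sum.reindex_bij_witness[of _ "\<lambda>(i, a). a + i * p ^ ?n" "\<lambda>\<xi>. (\<xi> div p ^ ?n, \<xi> mod p ^ ?n)"], goal_cases)
    case (1 \<xi>) then show ?case by (simp only: prod.case mod_div_mult_eq)
  next
    case (2 \<xi>) then show ?case by (auto simp: less_mult_imp_div_less)
  next
    case (3 z) then show ?case by auto
  next
    case (5 \<xi>) then show ?case by (simp only: prod.case mod_div_mult_eq)
  next
    case (4 z)
    then obtain i a where z: "z = (i, a)" "i < p" "a < p ^ ?n" by auto
    have "a + i * p ^ ?n < p ^ ?n + i * p ^ ?n" using z by simp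
    also have "\<dots> = Suc i * p ^ ?n" by simp
    also have "\<dots> \<le> p * p ^ ?n" using z by (intro mult_right_mono) auto
    finally show ?case using z by simp
  qed
  also have "\<dots> = (\<Sum>a<p ^ ?n. \<Sum>i<p. G (Suc k) (real (a + i * p ^ ?n) / real p ^ Suc ?n))"
    unfolding sum.cartesian_product[symmetric] by (rule sum.swap)
  \<comment> \<open>The top digit \<open>i\<close> enters only the first factor: in the others it is
    multiplied by a further \<open>p\<close> and disappears by periodicity. The inner sum then has a
    base point below \<open>1 / p\<close>, as the hypothesis requires.\<close>
  also have "\<dots> = (\<Sum>a<p ^ ?n. G k (real a / real p ^ ?n) * (\<Sum>i<p. F (real a / real p ^ Suc ?n + real i / real p)))"
  proof (intro sum.cong refl, unfold sum_distrib_left, intro sum.cong refl)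
    fix a i
    have "real (a + i * p ^ ?n) / real p ^ Suc ?n = real a / real p ^ Suc ?n + real i / real p"
      by (simp add: field_simps)
    moreover have "real p * (real a / real p ^ Suc ?n + real i / real p) = real a / real p ^ ?n + of_int (int i)"
      by (simp add: field_simps)
    ultimately show "G (Suc k) (real (a + i * p ^ ?n) / real p ^ Suc ?n) =
        G k (real a / real p ^ ?n) * F (real a / real p ^ Suc ?n + real i / real p)"
      by (simp only: G_Suc G_add_int mult.commute)
  qed
  also have "\<dots> \<le> (\<Sum>a<p ^ ?n. G k (real a / real p ^ ?n) * A)"
  proof (intro sum_mono mult_left_mono A)
    fix a assume "a \<in> {..<p ^ ?n}"
    then have "real a < real p ^ ?n" by (metis lessThan_iff of_nat_less_iff of_nat_power)
    then show "real a / real p ^ Suc ?n < 1 / real p" by (simp add: field_simps)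
  qed auto
  also have "\<dots> \<le> real p ^ m * A ^ k * A"
    unfolding sum_distrib_right[symmetric] using Suc A0 by (intro mult_right_mono) auto
  finally show ?case by (simp add: mult_ac)
qed auto

lemma G_add_period: "G k (real (\<xi> + p ^ n) / real p ^ n) = G k (real \<xi> / real p ^ n)"
  using G_add_int[of k "real \<xi> / real p ^ n" 1] by (simp add: add_divide_distrib)

lemma sum_G_multiple:
  "(\<Sum>\<xi><L * p ^ n. G k (real \<xi> / real p ^ n)) = real L * (\<Sum>\<xi><p ^ n. G k (real \<xi> / real p ^ n))"
proof -
  have per: "G k (real (a + i * p ^ n) / real p ^ n) = G k (real a / real p ^ n)" for i a
  proof (induction i)
    case (Suc i)
    then show ?case using G_add_period[of k "a + i * p ^ n" n] by (simp only: mult_Suc add_ac)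
  qed auto
  have "(\<Sum>\<xi><L * p ^ n. G k (real \<xi> / real p ^ n)) =
     (\<Sum>i<L. sum (\<lambda>\<xi>. G k (real \<xi> / real p ^ n)) {i * p ^ n..<i * p ^ n + p ^ n})"
    using sum.nat_group[of "\<lambda>\<xi>. G k (real \<xi> / real p ^ n)" "p ^ n" L] by simp
  also have "\<dots> = (\<Sum>i<L. \<Sum>\<xi><p ^ n. G k (real \<xi> / real p ^ n))"
  proof (rule sum.cong[OF refl])
    fix i
    have "sum (\<lambda>\<xi>. G k (real \<xi> / real p ^ n)) {0 + i * p ^ n..<p ^ n + i * p ^ n}
       = (\<Sum>\<xi>=0..<p ^ n. G k (real (\<xi> + i * p ^ n) / real p ^ n))"
      by (rule sum.shift_bounds_nat_ivl)
    then show "sum (\<lambda>\<xi>. G k (real \<xi> / real p ^ n)) {i * p ^ n..<i * p ^ n + p ^ n}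
       = (\<Sum>\<xi><p ^ n. G k (real \<xi> / real p ^ n))"
      unfolding per by (simp add: add_ac lessThan_atLeast0)
  qed
  finally show ?thesis by simp
qed

end

section \<open>The divisor bound\<close>

lemma finite_divisors: "(n::nat) > 0 \<Longrightarrow> finite {d. d dvd n}"
  by (rule finite_subset[of _ "{..n}"]) (auto dest: dvd_imp_le)

lemma card_divisors_prime_power_mult:
  fixes q :: nat
  assumes "prime q" "m > 0"
  shows "card {d. d dvd q ^ a * m} \<le> Suc a * card {d. d dvd m}"
proof -
  have "{d. d dvd q ^ a * m} \<subseteq> (\<lambda>(i, e). q ^ i * e) ` ({..a} \<times> {d. d dvd m})"
  proof
    fix d assume "d \<in> {d. d dvd q ^ a * m}"
    then obtain d1 d2 where "d = d1 * d2" "d1 dvd q ^ a" "d2 dvd m"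
      using division_decomp by blast
    then show "d \<in> (\<lambda>(i, e). q ^ i * e) ` ({..a} \<times> {d. d dvd m})"
      using divides_primepow_nat[OF assms(1), of d1 a] by auto
  qed
  then have "card {d. d dvd q ^ a * m} \<le> card ({..a} \<times> {d. d dvd m})"
    by (rule surj_card_le[rotated]) (simp add: finite_divisors assms)
  then show ?thesis by (simp add: card_cartesian_product)
qed

text \<open>Only the primes below \<open>2 powr (1 / \<epsilon>)\<close> cost a constant factor.\<close>

lemma divisor_bound:
  fixes \<epsilon> :: real
  assumes eps: "\<epsilon> > 0"
  obtains C where "C > 0" "\<And>n. n > 0 \<Longrightarrow> real (card {d. d dvd n}) \<le> C * real n powr \<epsilon>"
proof -
  define P where "P = nat \<lceil>2 powr (1 / \<epsilon>)\<rceil>"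
  define B where "B = max 1 (1 / (\<epsilon> * ln 2))"
  have B1: "B \<ge> 1" by (simp add: B_def)
  have small: "real (Suc a) \<le> B * 2 powr (\<epsilon> * real a)" for a
  proof -
    have "1 / (\<epsilon> * ln 2) * (\<epsilon> * ln 2 * a) \<le> B * (\<epsilon> * ln 2 * a)"
      using eps by (intro mult_right_mono) (auto simp: B_def)
    then have "real a \<le> B * (\<epsilon> * ln 2 * a)" using eps by simp
    then have "real (Suc a) \<le> B * (1 + \<epsilon> * ln 2 * a)" using B1 by (simp add: ring_distribs)
    also have "\<dots> \<le> B * exp (\<epsilon> * ln 2 * a)"
      using B1 by (intro mult_left_mono exp_ge_add_one_self) auto
    finally show ?thesis by (simp add: powr_def mult_ac)
  qed
  define S where "S n = {q. prime q \<and> q < P \<and> q dvd n}" for n :: nat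
  have finS: "finite (S n)" for n by (rule finite_subset[of _ "{..<P}"]) (auto simp: S_def)
  have main: "n > 0 \<Longrightarrow> real (card {d. d dvd n}) \<le> B ^ card (S n) * real n powr \<epsilon>" for n
  proof (induction n rule: less_induct)
    case (less n)
    show ?case
    proof (cases "n = 1")
      case True
      then show ?thesis using B1 by (simp add: one_le_power)
    next
      case False
      then obtain q where q: "prime q" "q dvd n" using prime_factor_nat by blast
      define a where "a = multiplicity q n"
      obtain m where n: "n = q ^ a * m" and nd: "\<not> q dvd m"
        using multiplicity_decompose'[of n q] less.prems q prime_gt_1_nat[OF q(1)] unfolding a_def by auto
      have m: "m > 0" using less.prems n by auto
      have a: "a > 0" using q n nd by (cases a) auto
      have q2: "q \<ge> 2" using q prime_ge_2_nat by blast
      have "1 < q ^ a" using q2 a by (intro one_less_power) auto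
      then have mn: "m < n" using m n by simp
      have Sm: "S m \<subseteq> S n" using n by (auto simp: S_def)
      have qa: "real q powr (\<epsilon> * a) = (real q ^ a) powr \<epsilon>"
        using q2 by (simp add: powr_realpow[symmetric] powr_powr mult.commute)
      \<comment> \<open>Splitting off the full power of \<open>q\<close> removes \<open>q\<close>
        from \<open>S\<close>, so each prime below \<open>P\<close> pays the factor \<open>B\<close>
        once. A prime \<open>q \<ge> P\<close> pays nothing:
        \<open>q powr \<epsilon> \<ge> 2\<close> and \<open>a + 1 \<le> 2 ^ a\<close>.\<close>
      have key: "real (Suc a) * B ^ card (S m) \<le> B ^ card (S n) * (real q ^ a) powr \<epsilon>"
      proof (cases "q < P")
        case True
        have "insert q (S m) \<subseteq> S n" "q \<notin> S m" using Sm q True nd by (auto simp: S_def)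
        then have "Suc (card (S m)) \<le> card (S n)"
          using finS card_mono by (metis card_insert_disjoint)
        then have "B ^ Suc (card (S m)) \<le> B ^ card (S n)" using B1 by (rule power_increasing)
        then have "B ^ Suc (card (S m)) * (real q ^ a) powr \<epsilon> \<le> B ^ card (S n) * (real q ^ a) powr \<epsilon>"
          by (rule mult_right_mono) simp
        moreover have "real (Suc a) \<le> B * (real q ^ a) powr \<epsilon>"
          unfolding qa[symmetric] using small[of a] B1 q2 eps
          by (elim order.trans) (intro mult_left_mono powr_mono2, auto)
        then have "real (Suc a) * B ^ card (S m) \<le> (B * (real q ^ a) powr \<epsilon>) * B ^ card (S m)"
          using B1 by (intro mult_right_mono) auto
        ultimately show ?thesis
          by (simp add: mult_ac)
      next
        case False
        have "2 powr (1 / \<epsilon>) \<le> q" using False unfolding P_def by linarith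
        then have "(2 powr (1 / \<epsilon>)) powr (\<epsilon> * a) \<le> real q powr (\<epsilon> * a)"
          using eps by (intro powr_mono2) auto
        then have "2 ^ a \<le> real q powr (\<epsilon> * a)" using eps by (simp add: powr_powr powr_realpow)
        moreover have "real (Suc a) \<le> 2 ^ a"
          using less_exp[of a] by (metis Suc_leI of_nat_le_iff of_nat_numeral of_nat_power)
        ultimately have "real (Suc a) \<le> (real q ^ a) powr \<epsilon>" using qa by simp
        moreover have "B ^ card (S m) \<le> B ^ card (S n)"
          using B1 Sm finS by (intro power_increasing card_mono) auto
        ultimately show ?thesis using B1 by (subst mult.commute) (intro mult_mono, auto)
      qed
      have "real (card {d. d dvd n}) \<le> real (Suc a * card {d. d dvd m})"
        unfolding n of_nat_le_iff by (rule card_divisors_prime_power_mult[OF q(1) m])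
      also have "\<dots> = real (Suc a) * real (card {d. d dvd m})" by (rule of_nat_mult)
      also have "\<dots> \<le> real (Suc a) * (B ^ card (S m) * real m powr \<epsilon>)"
        using less.IH[OF mn m] by (intro mult_left_mono) auto
      also have "\<dots> = (real (Suc a) * B ^ card (S m)) * real m powr \<epsilon>" by (simp only: mult.assoc)
      also have "\<dots> \<le> (B ^ card (S n) * (real q ^ a) powr \<epsilon>) * real m powr \<epsilon>"
        by (intro mult_right_mono key) auto
      also have "\<dots> = B ^ card (S n) * real n powr \<epsilon>"
        by (simp add: n powr_mult mult.assoc)
      finally show ?thesis .
    qed
  qed
  show ?thesis
  proof
    show "B ^ P > 0" using B1 by simp
    fix n :: nat assume n: "n > 0"
    have "card (S n) \<le> card {..<P}" by (rule card_mono) (auto simp: S_def)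
    then have "B ^ card (S n) \<le> B ^ P" using B1 by (intro power_increasing) auto
    then show "real (card {d. d dvd n}) \<le> B ^ P * real n powr \<epsilon>"
      using main[OF n] by (elim order.trans) (intro mult_right_mono, auto)
  qed
qed

text \<open>A factorisation of \<xi> as \<open>k * q\<close> is determined by the divisor
  \<open>q\<close>, so each \<xi> occurs at most as often as it has divisors. This collapses the
  double sum over denominators and frequencies to a single one.\<close>

lemma sum_products_le:
  fixes g :: "nat \<Rightarrow> real"
  assumes C: "\<And>n. n > 0 \<Longrightarrow> real (card {d. d dvd n}) \<le> C * real n powr \<epsilon>" and eps: "\<epsilon> > 0"
    and g: "\<And>n. g n \<ge> 0" and fin: "finite Q" and Q: "\<And>q. q \<in> Q \<Longrightarrow> q > 0 \<and> q * L q \<le> X"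
  shows "(\<Sum>q\<in>Q. \<Sum>k=1..L q. g (k * q)) \<le> C * real X powr \<epsilon> * (\<Sum>\<xi>=1..X. g \<xi>)"
proof -
  let ?A = "SIGMA q:Q. {1..L q}"
  have "0 \<le> real (card {d. d dvd (1::nat)})" by simp
  also have "\<dots> \<le> C" using C[of 1] by simp
  finally have C0: "C \<ge> 0" .
  have "(\<Sum>q\<in>Q. \<Sum>k=1..L q. g (k * q)) = (\<Sum>z\<in>?A. g (snd z * fst z))"
    using fin by (subst sum.Sigma) (auto simp: case_prod_unfold)
  also have "\<dots> = (\<Sum>\<xi>\<in>{1..X}. \<Sum>z\<in>{z\<in>?A. snd z * fst z = \<xi>}. g (snd z * fst z))"
  proof (rule sum.group[symmetric])
    show "(\<lambda>z. snd z * fst z) ` ?A \<subseteq> {1..X}"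
    proof (rule image_subsetI)
      fix z assume "z \<in> ?A"
      then obtain q k where z: "z = (q, k)" and *: "q \<in> Q" "1 \<le> k" "k \<le> L q" by auto
      then have "k * q \<le> L q * q" by (intro mult_right_mono) auto
      also have "\<dots> \<le> X" using Q[OF *(1)] by (simp add: mult.commute)
      finally show "snd z * fst z \<in> {1..X}" using Q[OF *(1)] * z by (simp add: Suc_le_eq)
    qed
  qed (use fin in auto)
  also have "\<dots> \<le> (\<Sum>\<xi>\<in>{1..X}. C * real X powr \<epsilon> * g \<xi>)"
  proof (rule sum_mono)
    fix \<xi> assume \<xi>: "\<xi> \<in> {1..X}"
    let ?Z = "{z\<in>?A. snd z * fst z = \<xi>}"
    have "inj_on fst ?Z" using Q by (fastforce simp: inj_on_def)
    then have "card ?Z = card (fst ` ?Z)" by (simp add: card_image)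
    also have "\<dots> \<le> card {d. d dvd \<xi>}" using \<xi> by (intro card_mono finite_divisors) auto
    finally have "real (card ?Z) \<le> C * real \<xi> powr \<epsilon>" using C[of \<xi>] \<xi> by auto
    also have "\<dots> \<le> C * real X powr \<epsilon>"
      using \<xi> eps C0 by (intro mult_left_mono powr_mono2) auto
    finally have "real (card ?Z) * g \<xi> \<le> C * real X powr \<epsilon> * g \<xi>" using g by (intro mult_right_mono)
    moreover have "(\<Sum>z\<in>?Z. g (snd z * fst z)) = real (card ?Z) * g \<xi>" by simp
    ultimately show "(\<Sum>z\<in>?Z. g (snd z * fst z)) \<le> C * real X powr \<epsilon> * g \<xi>" by simp
  qed
  finally show ?thesis by (simp add: sum_distrib_left)
qed

section \<open>Trigonometric majorants and minorants\<close>

text \<open>A trigonometric polynomial is given as a family of frequencies, so that its coefficients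
  are cardinalities. Frequency zero yields the main term; the factor 2 pairs \<open>k\<close> with
  \<open>- k\<close>, whose sums over \<open>T\<close> are conjugate.\<close>

lemma trig_sum_bound:
  fixes y :: "'v \<Rightarrow> real" and n :: "'i \<Rightarrow> int"
  assumes "finite T" "finite I" and L: "\<And>i. i \<in> I \<Longrightarrow> \<bar>n i\<bar> \<le> int L"
    and B: "\<And>k. k \<noteq> 0 \<Longrightarrow> real (card {i \<in> I. n i = k}) \<le> B"
  shows "norm ((\<Sum>v\<in>T. \<Sum>i\<in>I. ec (of_int (n i) * y v)) - of_nat (card {i \<in> I. n i = 0} * card T))
    \<le> 2 * B * (\<Sum>k=1..L. norm (\<Sum>v\<in>T. ec (real k * y v)))"
proof -
  define g where "g j = (\<Sum>v\<in>T. ec (of_int j * y v))" for j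
  define h where "h k = norm (\<Sum>v\<in>T. ec (real k * y v))" for k :: nat
  have gh: "norm (g j) = h (nat \<bar>j\<bar>)" for j
    using norm_sum_ec_minus[of "\<lambda>v. of_int j * y v" T] by (cases "j \<ge> 0") (auto simp: g_def h_def)
  let ?I0 = "{i \<in> I. n i = 0}" and ?I1 = "{i \<in> I. n i \<noteq> 0}"
  have swap: "(\<Sum>v\<in>T. \<Sum>i\<in>I. ec (of_int (n i) * y v)) = (\<Sum>i\<in>I. g (n i))"
    unfolding g_def by (rule sum.swap)
  have "(\<Sum>i\<in>I. g (n i)) = (\<Sum>i\<in>?I0. g (n i)) + (\<Sum>i\<in>?I1. g (n i))"
    using assms(2) by (subst sum.union_disjoint[symmetric]) (auto intro!: sum.cong)
  also have "(\<Sum>i\<in>?I0. g (n i)) = of_nat (card ?I0 * card T)" by (simp add: g_def)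
  finally have "norm ((\<Sum>v\<in>T. \<Sum>i\<in>I. ec (of_int (n i) * y v)) - of_nat (card ?I0 * card T))
      = norm (\<Sum>i\<in>?I1. g (n i))" unfolding swap by simp
  also have "\<dots> \<le> (\<Sum>i\<in>?I1. h (nat \<bar>n i\<bar>))" by (intro sum_norm_le) (simp add: gh)
  also have "\<dots> = (\<Sum>k\<in>{1..L}. \<Sum>i\<in>{i \<in> ?I1. nat \<bar>n i\<bar> = k}. h (nat \<bar>n i\<bar>))"
    using assms(2) L by (intro sum.group[symmetric]) (auto simp: Suc_le_eq nat_le_iff)
  also have "\<dots> \<le> (\<Sum>k\<in>{1..L}. 2 * B * h k)"
  proof (rule sum_mono)
    fix k assume k: "k \<in> {1..L}"
    have "{i \<in> ?I1. nat \<bar>n i\<bar> = k} \<subseteq> {i \<in> I. n i = int k} \<union> {i \<in> I. n i = - int k}" by auto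
    then have "card {i \<in> ?I1. nat \<bar>n i\<bar> = k} \<le> card ({i \<in> I. n i = int k} \<union> {i \<in> I. n i = - int k})"
      using assms by (intro card_mono) auto
    also have "\<dots> \<le> card {i \<in> I. n i = int k} + card {i \<in> I. n i = - int k}" by (rule card_Un_le)
    finally have "real (card {i \<in> ?I1. nat \<bar>n i\<bar> = k}) \<le> 2 * B"
      using B[of "int k"] B[of "- int k"] k by auto
    then have "real (card {i \<in> ?I1. nat \<bar>n i\<bar> = k}) * h k \<le> 2 * B * h k"
      by (intro mult_right_mono) (auto simp: h_def)
    then show "(\<Sum>i\<in>{i \<in> ?I1. nat \<bar>n i\<bar> = k}. h (nat \<bar>n i\<bar>)) \<le> 2 * B * h k" by simp
  qed
  finally show ?thesis by (simp add: h_def sum_distrib_left)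
qed

section \<open>Dirichlet and Fejer kernels\<close>

definition dirichlet_kernel :: "nat \<Rightarrow> real \<Rightarrow> complex" where
  "dirichlet_kernel M y = (\<Sum>j<M. ec (real j * y))"

text \<open>Not normalised: \<open>M\<close> times the usual Fejer kernel, with mean
  \<open>M\<close> and peak \<open>M ^ 2\<close>. In this form it is a sum of exponentials with
  coefficient 1 over pairs of indices.\<close>

definition fejer :: "nat \<Rightarrow> real \<Rightarrow> real" where
  "fejer M y = (norm (dirichlet_kernel M y))\<^sup>2"

definition near_int :: "real \<Rightarrow> real \<Rightarrow> bool" where
  "near_int y \<delta> \<longleftrightarrow> (\<exists>a::int. \<bar>y - of_int a\<bar> \<le> \<delta>)"

lemma fejer_nonneg [simp]: "fejer M y \<ge> 0" by (simp add: fejer_def)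

lemma norm_dirichlet_kernel_le: "norm (dirichlet_kernel M y) \<le> M"
  unfolding dirichlet_kernel_def by (rule order.trans[OF norm_sum]) simp

lemma fejer_le: "fejer M y \<le> (real M)\<^sup>2"
  unfolding fejer_def by (intro power_mono norm_dirichlet_kernel_le) auto

lemma dirichlet_kernel_mult: "(1 - ec y) * dirichlet_kernel M y = 1 - ec (real M * y)"
proof (induction M)
  case (Suc M)
  have "(1 - ec y) * dirichlet_kernel (Suc M) y
     = (1 - ec y) * dirichlet_kernel M y + (1 - ec y) * ec (real M * y)"
    by (simp add: dirichlet_kernel_def ring_distribs)
  also have "\<dots> = 1 - ec (real (Suc M) * y)"
    unfolding Suc by (simp add: ring_distribs ec_add)
  finally show ?case .
qed (simp add: dirichlet_kernel_def)

lemma norm_one_minus_ec: "(norm (1 - ec y))\<^sup>2 = 2 * (1 - cos (2 * pi * y))"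
proof -
  have "(norm (1 - ec y))\<^sup>2 = (1 - cos (2 * pi * y))\<^sup>2 + (sin (2 * pi * y))\<^sup>2"
    by (simp add: cmod_power2 ec_def)
  also have "\<dots> = 1 - 2 * cos (2 * pi * y) + ((cos (2 * pi * y))\<^sup>2 + (sin (2 * pi * y))\<^sup>2)"
    by (simp add: power2_eq_square algebra_simps)
  finally show ?thesis by simp
qed

lemma fejer_identity: "(1 - cos (2 * pi * y)) * fejer M y = 1 - cos (2 * pi * (real M * y))"
proof -
  have "(norm (1 - ec y))\<^sup>2 * fejer M y = (norm (1 - ec (real M * y)))\<^sup>2"
    unfolding fejer_def dirichlet_kernel_mult[symmetric] norm_mult by (simp add: power_mult_distrib)
  then show ?thesis unfolding norm_one_minus_ec mult.assoc by simp
qed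

lemma fejer_expand:
  "complex_of_real (fejer M y) = (\<Sum>(i, j)\<in>{..<M} \<times> {..<M}. ec (of_int (int i - int j) * y))"
proof -
  have "complex_of_real (fejer M y) = dirichlet_kernel M y * cnj (dirichlet_kernel M y)"
    unfolding fejer_def by (rule complex_norm_square)
  also have "\<dots> = (\<Sum>i<M. \<Sum>j<M. ec (real i * y) * ec (- (real j * y)))"
    by (simp add: dirichlet_kernel_def sum_product ec_minus)
  finally show ?thesis
    by (simp add: sum.cartesian_product ec_add[symmetric] left_diff_distrib)
qed

text \<open>At this radius every phase \<open>j * y\<close> with \<open>j < M\<close> stays within
  1/6 of an integer, where the cosine is at least 1/2, so the real part of the Dirichlet kernel is
  at least \<open>M / 2\<close>.\<close>

lemma fejer_ge_near:
  assumes "near_int y (1 / (6 * real M))" "M > 0"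
  shows "fejer M y \<ge> (real M)\<^sup>2 / 4"
proof -
  obtain a :: int where a: "\<bar>y - of_int a\<bar> \<le> 1 / (6 * real M)" using assms by (auto simp: near_int_def)
  define z where "z = y - of_int a"
  have cos: "cos (2 * pi * (real j * y)) \<ge> 1 / 2" if "j < M" for j
  proof -
    have "\<bar>real j * z\<bar> \<le> real M * (1 / (6 * real M))"
      unfolding abs_mult using a that by (intro mult_mono) (auto simp: z_def)
    then have "2 * pi * \<bar>real j * z\<bar> \<le> 2 * pi * (1 / 6)"
      using assms by (intro mult_left_mono) auto
    then have le: "\<bar>2 * pi * (real j * z)\<bar> \<le> pi / 3" by (simp add: abs_mult)
    have "cos (2 * pi * (real j * y)) = Re (ec (real j * y))" by (simp add: Re_ec)
    also have "ec (real j * y) = ec (real j * z)"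
      using ec_add_of_int[of "real j * z" "int j * a"] by (simp add: z_def algebra_simps)
    also have "Re \<dots> = cos \<bar>2 * pi * (real j * z)\<bar>" by (simp add: Re_ec)
    also have "\<dots> \<ge> cos (pi / 3)" using le by (intro cos_monotone_0_pi_le) auto
    finally show ?thesis by (simp add: cos_60)
  qed
  have "real M / 2 = (\<Sum>j<M. 1 / 2)" by simp
  also have "\<dots> \<le> (\<Sum>j<M. cos (2 * pi * (real j * y)))" by (intro sum_mono) (use cos in auto)
  also have "\<dots> = Re (dirichlet_kernel M y)" by (simp add: dirichlet_kernel_def Re_ec)
  also have "\<dots> \<le> norm (dirichlet_kernel M y)" by (rule complex_Re_le_cmod)
  finally have "(real M / 2)\<^sup>2 \<le> (norm (dirichlet_kernel M y))\<^sup>2" by (intro power_mono) auto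
  then show ?thesis by (simp add: fejer_def power_divide)
qed

lemma card_pairs_diff: "real (card {x \<in> {..<M} \<times> {..<M}. int (fst x) - int (snd x) = k}) \<le> real M"
proof -
  have "card {x \<in> {..<M} \<times> {..<M}. int (fst x) - int (snd x) = k} \<le> card {..<M}"
    by (rule card_inj_on_le[of fst]) (auto simp: inj_on_def)
  then show ?thesis by simp
qed

lemma sum_fejer_approx:
  fixes y :: "'v \<Rightarrow> real"
  assumes "finite T"
  shows "\<bar>(\<Sum>v\<in>T. fejer M (y v)) - real M * card T\<bar>
    \<le> 2 * real M * (\<Sum>k=1..M. norm (\<Sum>v\<in>T. ec (real k * y v)))"
proof -
  let ?I = "{..<M} \<times> {..<M}" and ?n = "\<lambda>x. int (fst x) - int (snd x)"
  have "card {x \<in> ?I. ?n x = 0} = card ((\<lambda>i. (i, i)) ` {..<M})"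
    by (rule arg_cong[where f = card]) auto
  then have c: "card {x \<in> ?I. ?n x = 0} = M" by (simp add: card_image inj_on_def)
  have "norm ((\<Sum>v\<in>T. \<Sum>x\<in>?I. ec (of_int (?n x) * y v)) - of_nat (card {x \<in> ?I. ?n x = 0} * card T))
     \<le> 2 * real M * (\<Sum>k=1..M. norm (\<Sum>v\<in>T. ec (real k * y v)))"
    by (rule trig_sum_bound) (use assms card_pairs_diff in auto)
  also have "(\<Sum>v\<in>T. \<Sum>x\<in>?I. ec (of_int (?n x) * y v)) = of_real (\<Sum>v\<in>T. fejer M (y v))"
    by (simp add: fejer_expand case_prod_unfold)
  also have "of_real (\<Sum>v\<in>T. fejer M (y v)) - of_nat (card {x \<in> ?I. ?n x = 0} * card T)
     = complex_of_real ((\<Sum>v\<in>T. fejer M (y v)) - real M * card T)" unfolding c by simp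
  finally show ?thesis by (simp only: norm_of_real)
qed

text \<open>The majorant is \<open>4 / M ^ 2\<close> times \<open>fejer M\<close>, whose mean
  \<open>M\<close> produces the factor \<open>4 / M\<close>.\<close>

lemma card_near_le:
  fixes y :: "'v \<Rightarrow> real"
  assumes "finite T" "M > 0"
  shows "real (card {v \<in> T. near_int (y v) (1 / (6 * real M))})
    \<le> 4 / real M * (card T + 2 * (\<Sum>k=1..M. norm (\<Sum>v\<in>T. ec (real k * y v))))"
proof -
  let ?N = "{v \<in> T. near_int (y v) (1 / (6 * real M))}"
  have "real (card ?N) * ((real M)\<^sup>2 / 4) = (\<Sum>v\<in>?N. (real M)\<^sup>2 / 4)" by simp
  also have "\<dots> \<le> (\<Sum>v\<in>?N. fejer M (y v))" by (intro sum_mono fejer_ge_near) (use assms in auto)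
  also have "\<dots> \<le> (\<Sum>v\<in>T. fejer M (y v))" using assms by (intro sum_mono2) auto
  also have "\<dots> \<le> real M * card T + 2 * real M * (\<Sum>k=1..M. norm (\<Sum>v\<in>T. ec (real k * y v)))"
    using sum_fejer_approx[OF assms(1), of M y] by linarith
  finally have "real M * (real M / 4 * real (card ?N))
      \<le> real M * (card T + 2 * (\<Sum>k=1..M. norm (\<Sum>v\<in>T. ec (real k * y v))))"
    by (simp add: ring_distribs power2_eq_square mult_ac)
  then have "real M / 4 * real (card ?N) \<le> card T + 2 * (\<Sum>k=1..M. norm (\<Sum>v\<in>T. ec (real k * y v)))"
    using assms(2) by (simp only: mult_le_cancel_left_pos of_nat_0_less_iff)
  then show ?thesis using assms(2) by (simp add: field_simps)
qed

text \<open>The product is the real part of \<open>ec (M * y) * fejer M y\<close>. The frequencies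
  of the kernel lie strictly between \<open>- M\<close> and \<open>M\<close>; shifted by
  \<open>M\<close> they are all positive, so there is no main term.\<close>

lemma sum_fejer_cos_ge:
  fixes y :: "'v \<Rightarrow> real"
  assumes "finite T"
  shows "(\<Sum>v\<in>T. cos (2 * pi * (real M * y v)) * fejer M (y v))
    \<ge> - 2 * real M * (\<Sum>k=1..2*M. norm (\<Sum>v\<in>T. ec (real k * y v)))"
proof -
  let ?I = "{..<M} \<times> {..<M}" and ?n = "\<lambda>x. int M + (int (fst x) - int (snd x))"
  have c: "{x \<in> ?I. ?n x = 0} = {}" by auto
  have B: "real (card {x \<in> ?I. ?n x = k}) \<le> real M" for k
    using card_pairs_diff[of M "k - int M"] by (simp add: algebra_simps)
  have e: "(\<Sum>x\<in>?I. ec (of_int (?n x) * y v)) = ec (real M * y v) * of_real (fejer M (y v))" for v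
    by (simp add: fejer_expand case_prod_unfold sum_distrib_left ec_add[symmetric] ring_distribs)
  have "norm ((\<Sum>v\<in>T. \<Sum>x\<in>?I. ec (of_int (?n x) * y v)) - of_nat (card {x \<in> ?I. ?n x = 0} * card T))
     \<le> 2 * real M * (\<Sum>k=1..2*M. norm (\<Sum>v\<in>T. ec (real k * y v)))"
    by (rule trig_sum_bound) (use assms B in auto)
  then have "norm (\<Sum>v\<in>T. ec (real M * y v) * of_real (fejer M (y v)))
      \<le> 2 * real M * (\<Sum>k=1..2*M. norm (\<Sum>v\<in>T. ec (real k * y v)))"
    unfolding c e by simp
  moreover have "(\<Sum>v\<in>T. cos (2 * pi * (real M * y v)) * fejer M (y v))
     = Re (\<Sum>v\<in>T. ec (real M * y v) * of_real (fejer M (y v)))"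
    by (simp add: Re_ec)
  ultimately show ?thesis using abs_Re_le_cmod[of "\<Sum>v\<in>T. ec (real M * y v) * of_real (fejer M (y v))"]
    by linarith
qed

text \<open>This is the constant coefficient of the squared Fejer kernel, i.e. the additive energy
  of \<open>{..<M}\<close>. For \<open>i\<close>, \<open>k\<close> below \<open>h\<close>, about
  \<open>M / 2\<close>, and \<open>j \<le> i\<close>, the last entry is forced to be
  \<open>i + k - j\<close> and stays below \<open>M\<close>; this gives at least
  \<open>h ^ 3 / 2\<close> solutions.\<close>

lemma card_quadruples_ge:
  fixes M :: nat
  defines "I \<equiv> ({..<M} \<times> {..<M}) \<times> ({..<M} \<times> {..<M})"
  shows "real M ^ 3 / 16 \<le> card {x \<in> I. int (fst (fst x)) - int (snd (fst x))
    + (int (fst (snd x)) - int (snd (snd x))) = 0}"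
proof -
  define h where "h = (M + 1) div 2"
  have hM: "2 * h \<le> M + 1" "M \<le> 2 * h" by (auto simp: h_def)
  let ?J = "{..<h} \<times> (SIGMA i:{..<h}. {..i})"
  let ?Z = "{x \<in> I. int (fst (fst x)) - int (snd (fst x)) + (int (fst (snd x)) - int (snd (snd x))) = 0}"
  have "2 * (\<Sum>i<h. Suc i) = h * (h + 1)" by (induction h) (auto simp: algebra_simps)
  then have "2 * card ?J = h * (h * (h + 1))" by (simp add: card_cartesian_product)
  moreover have "h ^ 3 \<le> h * (h * (h + 1))" by (simp add: power3_eq_cube)
  ultimately have "h ^ 3 \<le> 2 * card ?J" by linarith
  moreover have "card ?J \<le> card ?Z"
  proof (rule card_inj_on_le[of "\<lambda>(k, (i, j)). ((i, j), (k, i + k - j))"])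
    show "(\<lambda>(k, (i, j)). ((i, j), (k, i + k - j))) ` ?J \<subseteq> ?Z"
      using hM by (auto simp: I_def)
    have "?Z \<subseteq> I" by auto
    moreover have "finite I" by (simp add: I_def)
    ultimately show "finite ?Z" by (rule finite_subset)
  qed (auto simp: inj_on_def)
  moreover have "M ^ 3 \<le> (2 * h) ^ 3" using hM by (intro power_mono) auto
  ultimately have "M ^ 3 \<le> 16 * card ?Z" by (simp add: power_mult_distrib)
  then have "real (M ^ 3) \<le> real (16 * card ?Z)" by (simp only: of_nat_le_iff)
  then show ?thesis by simp
qed

lemma sum_fejer_square_ge:
  fixes y :: "'v \<Rightarrow> real"
  assumes "finite T"
  shows "(\<Sum>v\<in>T. (fejer M (y v))\<^sup>2)
    \<ge> real M ^ 3 / 16 * card T - 2 * real M ^ 3 * (\<Sum>k=1..2*M. norm (\<Sum>v\<in>T. ec (real k * y v)))"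
proof -
  let ?P = "{..<M} \<times> {..<M}"
  let ?I = "?P \<times> ?P" and ?m = "\<lambda>x. int (fst x) - int (snd x)"
  let ?n = "\<lambda>x. ?m (fst x) + ?m (snd x)"
  have B: "real (card {x \<in> ?I. ?n x = k}) \<le> real M ^ 3" for k
  proof -
    have "card {x \<in> ?I. ?n x = k} \<le> card (?P \<times> {..<M})"
      by (rule card_inj_on_le[of "\<lambda>x. (fst x, fst (snd x))"]) (auto simp: inj_on_def)
    then have "real (card {x \<in> ?I. ?n x = k}) \<le> real (card (?P \<times> {..<M}))" by (simp only: of_nat_le_iff)
    then show ?thesis by (simp add: card_cartesian_product power3_eq_cube)
  qed
  have e: "(\<Sum>x\<in>?I. ec (of_int (?n x) * y v)) = of_real ((fejer M (y v))\<^sup>2)" for v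
  proof -
    have "of_real ((fejer M (y v))\<^sup>2) = (\<Sum>x\<in>?P. ec (of_int (?m x) * y v)) * (\<Sum>x\<in>?P. ec (of_int (?m x) * y v))"
      by (simp add: power2_eq_square fejer_expand case_prod_unfold)
    also have "\<dots> = (\<Sum>x\<in>?I. ec (of_int (?m (fst x)) * y v) * ec (of_int (?m (snd x)) * y v))"
      unfolding sum_product sum.cartesian_product by (simp add: case_prod_unfold)
    also have "\<dots> = (\<Sum>x\<in>?I. ec (of_int (?n x) * y v))"
      unfolding ec_add[symmetric] by (simp add: ring_distribs)
    finally show ?thesis ..
  qed
  let ?c = "card {x \<in> ?I. ?n x = 0}"
  have "norm ((\<Sum>v\<in>T. \<Sum>x\<in>?I. ec (of_int (?n x) * y v)) - of_nat (?c * card T))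
     \<le> 2 * real M ^ 3 * (\<Sum>k=1..2*M. norm (\<Sum>v\<in>T. ec (real k * y v)))"
    by (rule trig_sum_bound) (use assms B in auto)
  also have "(\<Sum>v\<in>T. \<Sum>x\<in>?I. ec (of_int (?n x) * y v)) - of_nat (?c * card T)
     = of_real ((\<Sum>v\<in>T. (fejer M (y v))\<^sup>2) - real ?c * card T)"
    unfolding e by simp
  finally have "(\<Sum>v\<in>T. (fejer M (y v))\<^sup>2) \<ge> real ?c * card T
      - 2 * real M ^ 3 * (\<Sum>k=1..2*M. norm (\<Sum>v\<in>T. ec (real k * y v)))"
    unfolding norm_of_real by linarith
  moreover have "real M ^ 3 / 16 * card T \<le> real ?c * card T"
    by (intro mult_right_mono card_quadruples_ge) auto
  ultimately show ?thesis by linarith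
qed

lemma sin_ge_half:
  fixes x :: real
  assumes "0 \<le> x" "x \<le> pi / 2"
  shows "x / 2 \<le> sin x"
proof (cases "x \<le> pi / 3")
  case True
  have "(\<lambda>x. sin x - x / 2) 0 \<le> (\<lambda>x. sin x - x / 2) x"
  proof (rule DERIV_nonneg_imp_nondecreasing[OF assms(1)])
    fix z assume z: "0 \<le> z" "z \<le> x"
    have "cos (pi / 3) \<le> cos z" using z True by (intro cos_monotone_0_pi_le) auto
    then have "cos z - 1 / 2 \<ge> 0" by (simp add: cos_60)
    moreover have "((\<lambda>x. sin x - x / 2) has_real_derivative (cos z - 1 / 2)) (at z)"
      by (auto intro!: derivative_eq_intros)
    ultimately show "\<exists>y. ((\<lambda>x. sin x - x / 2) has_real_derivative y) (at z) \<and> 0 \<le> y" by blast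
  qed
  then show ?thesis by simp
next
  case False
  have "sin (pi / 3) \<le> sin x" using False assms by (intro sin_monotone_2pi_le) auto
  moreover have "sqrt 3 \<ge> (17 / 10 :: real)" by (rule real_le_rsqrt) (simp add: power2_eq_square)
  moreover have "x \<le> 16 / 10" using assms pi_less_4 pi_approx by (simp add: )
  ultimately show ?thesis by (simp add: sin_60)
qed

text \<open>The minorant of the indicator of the points within \<open>\<delta>\<close> of the integers is
  \<open>(cos (2 * pi * y) - cos (2 * pi * \<delta>)) * (fejer M y)\<^sup>2\<close>: by \<open>fejer_identity\<close> the
  frequencies of its negative part can be read off without cancellation.\<close>

lemma card_near_ge:
  fixes y :: "'v \<Rightarrow> real"
  assumes T: "finite T" and \<delta>: "0 < \<delta>" "\<delta> \<le> 1 / 2" and M: "3 / \<delta> \<le> real M" "real M \<le> 4 / \<delta>"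
  shows "320 * real M * real (card {v \<in> T. near_int (y v) \<delta>})
    \<ge> card T - 644 * (\<Sum>k=1..2*M. norm (\<Sum>v\<in>T. ec (real k * y v)))"
proof -
  define H where "H = (\<Sum>k=1..2*M. norm (\<Sum>v\<in>T. ec (real k * y v)))"
  define \<kappa> where "\<kappa> = 1 - cos (2 * pi * \<delta>)"
  have "real M > 0" using M(1) \<delta> by (smt (verit) divide_pos_pos)
  have H0: "H \<ge> 0" by (auto simp: H_def intro: sum_nonneg)
  have k: "\<kappa> = 2 * (sin (pi * \<delta>))\<^sup>2"
    using cos_double_sin[of "pi * \<delta>"] by (simp add: \<kappa>_def mult_ac)
  have pi2: "9 \<le> pi\<^sup>2" "pi\<^sup>2 \<le> 10"
    using pi_approx power_mono[of 3 pi 2] power_mono[of pi "3.15" 2] by (auto simp: power2_eq_square)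
  \<comment> \<open>This window puts \<open>\<kappa> * M ^ 2\<close> between 32 and 320. The lower
    end makes the factor \<open>\<kappa> * M ^ 2 / 16 - 1\<close> of the main term at least 1; the
    upper end bounds the peak of the minorant and turns the error factor
    \<open>2 * \<kappa> * M ^ 2 + 4\<close> into 644.\<close>
  have Md: "3 \<le> real M * \<delta>" "real M * \<delta> \<le> 4" using M \<delta> by (auto simp: field_simps)
  have "pi * \<delta> / 2 \<le> sin (pi * \<delta>)" using \<delta> by (intro sin_ge_half) auto
  then have "(pi * \<delta> / 2)\<^sup>2 \<le> (sin (pi * \<delta>))\<^sup>2" using \<delta> by (intro power_mono) auto
  then have "pi\<^sup>2 * \<delta>\<^sup>2 / 2 \<le> \<kappa>" by (simp add: k power_mult_distrib power_divide)
  then have "4 * \<delta>\<^sup>2 \<le> \<kappa>"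
    using mult_right_mono[OF pi2(1), of "\<delta>\<^sup>2"] zero_le_power2[of \<delta>] by linarith
  then have "4 * \<delta>\<^sup>2 * (real M)\<^sup>2 \<le> \<kappa> * (real M)\<^sup>2" by (intro mult_right_mono) auto
  moreover have "9 \<le> (real M * \<delta>)\<^sup>2" using power_mono[OF Md(1), of 2] by simp
  ultimately have kl: "32 \<le> \<kappa> * (real M)\<^sup>2" by (simp add: power_mult_distrib mult_ac)
  have "(sin (pi * \<delta>))\<^sup>2 \<le> (pi * \<delta>)\<^sup>2"
    using \<delta> sin_x_le_x[of "pi * \<delta>"] sin_ge_zero[of "pi * \<delta>"] by (intro power_mono) auto
  then have "\<kappa> \<le> 2 * (pi\<^sup>2 * \<delta>\<^sup>2)" by (simp add: k power_mult_distrib)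
  also have "\<dots> \<le> 20 * \<delta>\<^sup>2" using mult_right_mono[OF pi2(2), of "\<delta>\<^sup>2"] by simp
  finally have "\<kappa> * (real M)\<^sup>2 \<le> 20 * \<delta>\<^sup>2 * (real M)\<^sup>2" by (intro mult_right_mono) auto
  moreover have "(real M * \<delta>)\<^sup>2 \<le> 16" using power_mono[OF Md(2), of 2] \<delta> by simp
  ultimately have ku: "\<kappa> * (real M)\<^sup>2 \<le> 320" by (simp add: power_mult_distrib mult_ac)
  have k0: "\<kappa> \<ge> 0" by (simp add: k)
  define P where "P z = (cos (2 * pi * z) - cos (2 * pi * \<delta>)) * (fejer M z)\<^sup>2" for z
  have P_alt: "P z = \<kappa> * (fejer M z)\<^sup>2 - fejer M z + cos (2 * pi * (real M * z)) * fejer M z" for z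
  proof -
    have "P z = \<kappa> * (fejer M z)\<^sup>2 - ((1 - cos (2 * pi * z)) * fejer M z) * fejer M z"
      by (simp add: P_def \<kappa>_def power2_eq_square algebra_simps)
    then show ?thesis unfolding fejer_identity by (simp add: algebra_simps)
  qed
  have P_near: "P z \<le> \<kappa> * real M ^ 4" for z
  proof -
    have "(cos (2 * pi * z) - cos (2 * pi * \<delta>)) * (fejer M z)\<^sup>2 \<le> \<kappa> * ((real M)\<^sup>2)\<^sup>2"
      using k0 by (intro mult_mono power_mono fejer_le) (auto simp: \<kappa>_def)
    then show ?thesis by (simp add: P_def)
  qed
  have P_far: "P z \<le> 0" if "\<not> near_int z \<delta>" for z
  proof -
    define x where "x = z - of_int (round z)"
    have x: "\<bar>x\<bar> \<le> 1 / 2" using of_int_round_abs_le[of z] by (simp add: x_def abs_minus_commute)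
    have "\<delta> < \<bar>x\<bar>" using that by (auto simp: near_int_def x_def not_le)
    have "cos (2 * pi * z) = Re (ec (x + of_int (round z)))" by (simp add: x_def Re_ec)
    also have "\<dots> = cos \<bar>2 * pi * x\<bar>" unfolding ec_add_of_int by (simp add: Re_ec)
    also have "\<dots> \<le> cos (2 * pi * \<delta>)"
    proof (rule cos_monotone_0_pi_le)
      show "2 * pi * \<delta> \<le> \<bar>2 * pi * x\<bar>" using \<open>\<delta> < \<bar>x\<bar>\<close> by (simp add: abs_mult)
      have "2 * pi * \<bar>x\<bar> \<le> 2 * pi * (1 / 2)" using x by (intro mult_left_mono) auto
      then show "\<bar>2 * pi * x\<bar> \<le> pi" by (simp add: abs_mult)
    qed (use \<delta> in auto)
    finally show ?thesis unfolding P_def by (intro mult_nonpos_nonneg) auto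
  qed
  let ?N = "{v \<in> T. near_int (y v) \<delta>}"
  have "(\<Sum>v\<in>T. P (y v)) \<le> (\<Sum>v\<in>T. if near_int (y v) \<delta> then \<kappa> * real M ^ 4 else 0)"
    using P_near P_far by (intro sum_mono) auto
  also have "\<dots> = \<kappa> * (real M)\<^sup>2 * ((real M)\<^sup>2 * real (card ?N))"
    using T by (simp add: sum.If_cases Int_def power4_eq_xxxx power2_eq_square mult_ac)
  also have "\<dots> \<le> 320 * ((real M)\<^sup>2 * real (card ?N))" by (intro mult_right_mono ku) auto
  finally have up: "(\<Sum>v\<in>T. P (y v)) \<le> 320 * ((real M)\<^sup>2 * real (card ?N))" .
  have mono: "(\<Sum>k=1..M. norm (\<Sum>v\<in>T. ec (real k * y v))) \<le> H"
    unfolding H_def by (intro sum_mono2) auto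
  have "(\<Sum>v\<in>T. P (y v)) = \<kappa> * (\<Sum>v\<in>T. (fejer M (y v))\<^sup>2) - (\<Sum>v\<in>T. fejer M (y v))
     + (\<Sum>v\<in>T. cos (2 * pi * (real M * y v)) * fejer M (y v))"
    by (simp add: P_alt sum.distrib sum_subtractf sum_distrib_left)
  also have "\<dots> \<ge> \<kappa> * (real M ^ 3 / 16 * card T - 2 * real M ^ 3 * H) - (real M * card T + 2 * real M * H)
     + (- 2 * real M * H)"
  proof -
    have "2 * real M * (\<Sum>k=1..M. norm (\<Sum>v\<in>T. ec (real k * y v))) \<le> 2 * real M * H"
      using mono by (intro mult_left_mono) auto
    then show ?thesis
      using mult_left_mono[OF sum_fejer_square_ge[OF T, where M = M and y = y] k0]
        sum_fejer_approx[OF T, where M = M and y = y] sum_fejer_cos_ge[OF T, where M = M and y = y]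
      unfolding H_def by linarith
  qed
  finally have "\<kappa> * (real M ^ 3 / 16 * card T - 2 * real M ^ 3 * H) - real M * card T - 4 * real M * H
      \<le> (\<Sum>v\<in>T. P (y v))" by (simp add: algebra_simps)
  moreover have "\<kappa> * (real M ^ 3 / 16 * card T - 2 * real M ^ 3 * H) - real M * card T - 4 * real M * H
     = real M * ((\<kappa> * (real M)\<^sup>2 / 16 - 1) * card T - (2 * (\<kappa> * (real M)\<^sup>2) + 4) * H)"
    by (simp add: algebra_simps power2_eq_square power3_eq_cube)
  moreover have "(\<kappa> * (real M)\<^sup>2 / 16 - 1) * card T - (2 * (\<kappa> * (real M)\<^sup>2) + 4) * H
     \<ge> 1 * real (card T) - 644 * H"
  proof (intro diff_mono mult_right_mono)
    show "1 \<le> \<kappa> * (real M)\<^sup>2 / 16 - 1" "2 * (\<kappa> * (real M)\<^sup>2) + 4 \<le> 644"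
      using kl ku by simp_all
  qed (use H0 in auto)
  then have "real M * (1 * real (card T) - 644 * H)
      \<le> real M * ((\<kappa> * (real M)\<^sup>2 / 16 - 1) * card T - (2 * (\<kappa> * (real M)\<^sup>2) + 4) * H)"
    by (intro mult_left_mono) auto
  ultimately have "real M * (1 * real (card T) - 644 * H) \<le> 320 * ((real M)\<^sup>2 * real (card ?N))"
    using up by linarith
  then have "real M * (card T - 644 * H) \<le> real M * (320 * real M * real (card ?N))"
    by (simp add: power2_eq_square mult_ac)
  then show ?thesis using \<open>real M > 0\<close> unfolding H_def by (simp only: mult_le_cancel_left_pos)
qed

section \<open>Counting words close to rationals\<close>

lemma near_int_mono: "near_int y \<delta> \<Longrightarrow> \<delta> \<le> \<delta>' \<Longrightarrow> near_int y \<delta>'"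
  unfolding near_int_def by (meson order.trans)

locale flat_digits = digits +
  assumes residue_sum_le: "\<And>x. 0 \<le> x \<Longrightarrow> x < 1 / real p \<Longrightarrow> (\<Sum>i<p. F (x + real i / real p)) \<le> real p powr (1 / 20)"
    and b_large: "real p powr (9 / 10) \<le> real b"
begin

text \<open>The size of the Fourier error terms for words of length \<open>n\<close> below a fixed word of length \<open>m\<close>.\<close>

definition err :: "nat \<Rightarrow> nat \<Rightarrow> real" where
  "err m n = real p powr (real n / 10 + real m)"

lemma err_nonneg [simp]: "err m n \<ge> 0" by (simp add: err_def)

text \<open>The exponent \<open>n / 10\<close> in \<open>err\<close> is the sum of
  \<open>n / 20\<close> from the digit sums and \<open>n / 20\<close> from the divisor bound;
  \<open>p ^ m\<close> appears because only \<open>k\<close> of the \<open>m + k\<close> digits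
  contribute a factor to \<open>G\<close>. The 8 accommodates the lower count, whose frequencies
  \<open>l * q\<close> reach \<open>2 * M * R\<close> with
  \<open>M * R \<le> 4 * p ^ n\<close>.\<close>

lemma sum_G_products:
  obtains C where "C \<ge> 1"
    "\<And>m k Q L. finite Q \<Longrightarrow> (\<forall>q\<in>Q. q > 0 \<and> q * L q \<le> 8 * p ^ (m + k)) \<Longrightarrow>
     (\<Sum>q\<in>Q. \<Sum>l=1..L q. G k (real (l * q) / real p ^ (m + k))) \<le> C * err m (m + k)"
proof -
  obtain C where C: "C > 0" "\<And>n. n > 0 \<Longrightarrow> real (card {d. d dvd n}) \<le> C * real n powr (1 / 20)"
    using divisor_bound[of "1 / 20"] by auto
  define C' where "C' = max 1 (9 * C * 8 powr (1 / 20))"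
  have "(\<Sum>q\<in>Q. \<Sum>l=1..L q. G k (real (l * q) / real p ^ (m + k))) \<le> C' * err m (m + k)"
    if Q: "finite Q" "\<forall>q\<in>Q. q > 0 \<and> q * L q \<le> 8 * p ^ (m + k)" for m k Q and L :: "nat \<Rightarrow> nat"
  proof -
    let ?n = "m + k" and ?g = "\<lambda>\<xi>. G k (real \<xi> / real p ^ (m + k))"
    have "(\<Sum>\<xi>=1..8 * p ^ ?n. ?g \<xi>) \<le> (\<Sum>\<xi><9 * p ^ ?n. ?g \<xi>)"
      by (intro sum_mono2) auto
    also have "\<dots> = 9 * (\<Sum>\<xi><p ^ ?n. ?g \<xi>)" using sum_G_multiple[of k ?n 9] by simp
    also have "\<dots> \<le> 9 * (real p ^ m * (real p powr (1 / 20)) ^ k)"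
      by (intro mult_left_mono sum_G_residues residue_sum_le) auto
    also have "(real p powr (1 / 20)) ^ k = real p powr (real k / 20)"
      by (subst powr_realpow[symmetric]) (auto simp: powr_powr)
    also have "9 * (real p ^ m * real p powr (real k / 20)) \<le> 9 * real p powr (real ?n / 20 + m)"
      using p_ge by (auto simp: powr_realpow[symmetric] powr_add[symmetric] intro!: powr_mono)
    finally have sum: "(\<Sum>\<xi>=1..8 * p ^ ?n. ?g \<xi>) \<le> 9 * real p powr (real ?n / 20 + m)" .
    have "(\<Sum>q\<in>Q. \<Sum>l=1..L q. ?g (l * q)) \<le> C * real (8 * p ^ ?n) powr (1 / 20) * (\<Sum>\<xi>=1..8 * p ^ ?n. ?g \<xi>)"
      by (rule sum_products_le[where X = "8 * p ^ (m + k)" and g = "?g"]) (use C Q in auto)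
    also have "\<dots> \<le> C * real (8 * p ^ ?n) powr (1 / 20) * (9 * real p powr (real ?n / 20 + m))"
      using sum C by (intro mult_left_mono) auto
    also have "real (8 * p ^ ?n) powr (1 / 20) = 8 powr (1 / 20) * real p powr (real ?n / 20)"
      by (simp add: powr_mult powr_realpow[symmetric] powr_powr del: of_nat_add)
    also have "C * (8 powr (1 / 20) * real p powr (real ?n / 20)) * (9 * real p powr (real ?n / 20 + m))
       = (9 * C * 8 powr (1 / 20)) * (real p powr (real ?n / 20) * real p powr (real ?n / 20 + m))"
      by (simp only: mult_ac)
    also have "real p powr (real ?n / 20) * real p powr (real ?n / 20 + m) = err m ?n"
      unfolding err_def powr_add[symmetric] by (rule arg_cong[of _ _ "\<lambda>x. real p powr x"]) simp
    also have "(9 * C * 8 powr (1 / 20)) * err m ?n \<le> C' * err m ?n"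
      by (intro mult_right_mono) (auto simp: C'_def)
    finally show ?thesis .
  qed
  moreover have "C' \<ge> 1" by (simp add: C'_def)
  ultimately show ?thesis by (rule that[rotated])
qed

lemma norm_sum_desc_multiple:
  "norm (\<Sum>v\<in>desc w j. ec (real l * (real q * real v / real p ^ n))) = real b ^ j * G j (real (l * q) / real p ^ n)"
  using norm_sum_desc[of "real (l * q) / real p ^ n" w j] by (simp add: mult_ac)

text \<open>Divided by \<open>r\<close>, the condition says that \<open>v / p ^ n\<close> is within
  \<open>H / p ^ n\<close> of a fraction with denominator \<open>r\<close>. A typical count is
  therefore proportional to \<open>r\<close>, and the weight \<open>1 / r\<close> makes all
  denominators contribute equally.\<close>

lemma count_near_upper:
  obtains C where "C > 0" "\<And>w m j R H. H \<ge> 1 \<Longrightarrow> 6 * H * R \<le> p ^ (m + j) \<Longrightarrow>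
     (\<Sum>r=1..R. real (card {v \<in> desc w j. near_int (real r * real v / real p ^ (m + j)) (real r * real H / real p ^ (m + j))}) / real r)
      \<le> C * real b ^ j * (real H / real p ^ (m + j)) * (real R + err m (m + j))"
proof -
  obtain C where C1: "C \<ge> 1" and C: "\<And>m k Q L. finite Q \<Longrightarrow> (\<forall>q\<in>Q. q > 0 \<and> q * L q \<le> 8 * p ^ (m + k)) \<Longrightarrow>
     (\<Sum>q\<in>Q. \<Sum>l=1..L q. G k (real (l * q) / real p ^ (m + k))) \<le> C * err m (m + k)"
    by (rule sum_G_products) (rule that)
  have "(\<Sum>r=1..R. real (card {v \<in> desc w j. near_int (real r * real v / real p ^ (m + j)) (real r * real H / real p ^ (m + j))}) / real r)
      \<le> (96 * C) * real b ^ j * (real H / real p ^ (m + j)) * (real R + err m (m + j))"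
    if H: "H \<ge> 1" and R: "6 * H * R \<le> p ^ (m + j)" for w m j R H
  proof -
    let ?n = "m + j"
    \<comment> \<open>The largest \<open>M\<close> whose radius \<open>1 / (6 * M)\<close> still
      contains \<open>r * H / p ^ n\<close>. Being maximal, it satisfies
      \<open>p ^ n < 2 * M * (6 * H * r)\<close>, so the loss against the true radius is a
      constant.\<close>
    define M where "M r = p ^ ?n div (6 * H * r)" for r
    define S where "S r = (\<Sum>l=1..M r. G j (real (l * r) / real p ^ ?n))" for r
    have each: "real (card {v \<in> desc w j. near_int (real r * real v / real p ^ ?n) (real r * real H / real p ^ ?n)}) / real r
       \<le> 48 * (real H / real p ^ ?n) * real b ^ j * (1 + 2 * S r)" if r: "r \<in> {1..R}" for r
    proof -
      have r0: "r > 0" using r by simp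
      have "6 * H * r \<le> 6 * H * R" using r by (intro mult_left_mono) auto
      then have le: "6 * H * r \<le> p ^ ?n" using R by (rule le_trans)
      then have M0: "M r > 0" using H r0 unfolding M_def by (subst div_greater_zero_iff) auto
      have "M r * (6 * H * r) \<le> p ^ ?n" unfolding M_def by (rule div_times_less_eq_dividend)
      then have "real (M r * (6 * H * r)) \<le> real (p ^ ?n)" by (simp only: of_nat_le_iff)
      then have near: "real r * real H / real p ^ ?n \<le> 1 / (6 * real (M r))"
        using M0 by (simp add: field_simps)
      have "p ^ ?n < (M r + 1) * (6 * H * r)" unfolding M_def
        using H r0 by (metis Suc_eq_plus1 dividend_less_times_div mult.commute mult_Suc_right nat_0_less_mult_iff zero_less_numeral less_le_trans zero_less_one)
      also have "\<dots> \<le> (2 * M r) * (6 * H * r)" using M0 by (intro mult_right_mono) auto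
      finally have "real (p ^ ?n) \<le> real ((2 * M r) * (6 * H * r))" by (simp only: of_nat_le_iff)
      then have inv: "4 / real (M r) \<le> 48 * (real H / real p ^ ?n) * real r"
        using M0 by (simp add: field_simps)
      have "real (card {v \<in> desc w j. near_int (real r * real v / real p ^ ?n) (real r * real H / real p ^ ?n)})
        \<le> real (card {v \<in> desc w j. near_int (real r * real v / real p ^ ?n) (1 / (6 * real (M r)))})"
        unfolding of_nat_le_iff by (rule card_mono) (auto intro: near_int_mono[OF _ near])
      also have "\<dots> \<le> 4 / real (M r) * (real (card (desc w j))
           + 2 * (\<Sum>l=1..M r. norm (\<Sum>v\<in>desc w j. ec (real l * (real r * real v / real p ^ ?n)))))"
        by (rule card_near_le[OF finite_desc M0])
      also have "(\<Sum>l=1..M r. norm (\<Sum>v\<in>desc w j. ec (real l * (real r * real v / real p ^ ?n)))) = real b ^ j * S r"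
        unfolding norm_sum_desc_multiple S_def by (simp add: sum_distrib_left)
      also have "real (card (desc w j)) + 2 * (real b ^ j * S r) = real b ^ j * (1 + 2 * S r)"
        by (simp add: card_desc ring_distribs)
      also have "4 / real (M r) * (real b ^ j * (1 + 2 * S r))
          \<le> 48 * (real H / real p ^ ?n) * real r * (real b ^ j * (1 + 2 * S r))"
        by (intro mult_right_mono inv mult_nonneg_nonneg) (auto simp: S_def intro!: sum_nonneg add_nonneg_nonneg)
      finally show ?thesis using r0 by (simp add: field_simps)
    qed
    have "(\<Sum>r=1..R. S r) \<le> C * err m ?n"
      unfolding S_def
    proof (rule C)
      show "\<forall>q\<in>{1..R}. 0 < q \<and> q * M q \<le> 8 * p ^ ?n"
      proof
        fix q assume q: "q \<in> {1..R}"
        have "q * M q \<le> (6 * H * q) * M q" using H by (intro mult_right_mono) auto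
        also have "\<dots> \<le> p ^ ?n" unfolding M_def by (rule times_div_less_eq_dividend)
        finally show "0 < q \<and> q * M q \<le> 8 * p ^ ?n" using q by auto
      qed
    qed auto
    then have "(\<Sum>r=1..R. 1 + 2 * S r) \<le> real R + 2 * (C * err m ?n)"
      by (simp add: sum.distrib sum_distrib_left[symmetric])
    also have "\<dots> \<le> 2 * C * (real R + err m ?n)"
    proof -
      have "1 * real R \<le> 2 * C * real R" using C1 by (intro mult_right_mono) auto
      then show ?thesis by (simp add: ring_distribs)
    qed
    finally have sum: "(\<Sum>r=1..R. 1 + 2 * S r) \<le> 2 * C * (real R + err m ?n)" .
    have "(\<Sum>r=1..R. real (card {v \<in> desc w j. near_int (real r * real v / real p ^ ?n) (real r * real H / real p ^ ?n)}) / real r)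
       \<le> (\<Sum>r=1..R. 48 * (real H / real p ^ ?n) * real b ^ j * (1 + 2 * S r))"
      by (intro sum_mono each)
    also have "\<dots> = 48 * (real H / real p ^ ?n) * real b ^ j * (\<Sum>r=1..R. 1 + 2 * S r)"
      by (simp only: sum_distrib_left)
    also have "\<dots> \<le> 48 * (real H / real p ^ ?n) * real b ^ j * (2 * C * (real R + err m ?n))"
      by (intro mult_left_mono sum) auto
    finally show ?thesis by (simp add: mult_ac)
  qed
  moreover have "96 * C > 0" using C1 by simp
  ultimately show ?thesis by (rule that[rotated])
qed

text \<open>Since \<open>R < 2 * q\<close>, a hit by \<open>q\<close> puts \<open>v / p ^ n\<close>
  within \<open>2 / p ^ n\<close> of a fraction with denominator \<open>q\<close>, a radius
  independent of \<open>q\<close>. Fractions need not be reduced, so one rational can cause many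
  hits.\<close>

definition hits :: "nat \<Rightarrow> nat \<Rightarrow> nat \<Rightarrow> nat set" where
  "hits n R v = {q \<in> {R div 2<..R}. near_int (real q * real v / real p ^ n) (real R / real p ^ n)}"

lemma finite_hits [simp]: "finite (hits n R v)" by (simp add: hits_def)

lemma sum_card_hits:
  assumes "finite T"
  shows "(\<Sum>v\<in>T. card (hits n R v))
    = (\<Sum>q\<in>{R div 2<..R}. card {v \<in> T. near_int (real q * real v / real p ^ n) (real R / real p ^ n)})"
proof -
  have "(\<Sum>v\<in>T. card (hits n R v)) = (\<Sum>v\<in>T. \<Sum>q\<in>{R div 2<..R}.
      if near_int (real q * real v / real p ^ n) (real R / real p ^ n) then 1 else 0)"
    by (intro sum.cong refl) (simp add: hits_def sum.If_cases Int_def)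
  also have "\<dots> = (\<Sum>q\<in>{R div 2<..R}. \<Sum>v\<in>T.
      if near_int (real q * real v / real p ^ n) (real R / real p ^ n) then 1 else 0)"
    by (rule sum.swap)
  finally show ?thesis using assms by (simp add: sum.If_cases Int_def)
qed

lemma sum_hits_lower:
  obtains C where "C > 0" "\<And>w m j R. R \<ge> 1 \<Longrightarrow> 4 * R \<le> p ^ (m + j) \<Longrightarrow>
     real b ^ j * (real R / real p ^ (m + j)) * (real R / 2560 - C * err m (m + j))
      \<le> real (\<Sum>v\<in>desc w j. card (hits (m + j) R v))"
proof -
  obtain C where C1: "C \<ge> 1" and C: "\<And>m k Q L. finite Q \<Longrightarrow> (\<forall>q\<in>Q. q > 0 \<and> q * L q \<le> 8 * p ^ (m + k)) \<Longrightarrow>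
     (\<Sum>q\<in>Q. \<Sum>l=1..L q. G k (real (l * q) / real p ^ (m + k))) \<le> C * err m (m + k)"
    by (rule sum_G_products) (rule that)
  have "real b ^ j * (real R / real p ^ (m + j)) * (real R / 2560 - C * err m (m + j))
      \<le> real (\<Sum>v\<in>desc w j. card (hits (m + j) R v))"
    if R1: "R \<ge> 1" and R: "4 * R \<le> p ^ (m + j)" for w m j R
  proof -
    let ?n = "m + j"
    \<comment> \<open>With \<delta> = \<open>R / p ^ n\<close> this is an integer between
      \<open>3 / \<delta>\<close> and \<open>4 / \<delta>\<close>, the window of
      \<open>card_near_ge\<close>; the added 1 fits because \<open>R \<le> p ^ n\<close>.\<close>
    define M where "M = 3 * p ^ ?n div R + 1"
    define \<delta> where "\<delta> = real R / real p ^ ?n"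
    define N where "N q = real (card {v \<in> desc w j. near_int (real q * real v / real p ^ ?n) \<delta>})" for q :: nat
    define S where "S q = (\<Sum>l=1..2 * M. G j (real (l * q) / real p ^ ?n))" for q
    have pn: "real p ^ ?n > 0" by simp
    have "real (4 * R) \<le> real (p ^ ?n)" using R by (simp only: of_nat_le_iff)
    then have \<delta>: "0 < \<delta>" "\<delta> \<le> 1 / 2" using R1 by (simp_all add: \<delta>_def field_simps)
    have "3 * p ^ ?n \<le> R * M" unfolding M_def using dividend_less_times_div[of R "3 * p ^ ?n"] R1 by simp
    then have "real (3 * p ^ ?n) \<le> real (R * M)" by (simp only: of_nat_le_iff)
    then have M1: "3 / \<delta> \<le> real M" using R1 by (simp add: \<delta>_def field_simps)
    have RM: "R * M \<le> 4 * p ^ ?n"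
      unfolding M_def ring_distribs using times_div_less_eq_dividend[of R "3 * p ^ ?n"] R by linarith
    then have "real (R * M) \<le> real (4 * p ^ ?n)" by (simp only: of_nat_le_iff)
    then have M2: "real M \<le> 4 / \<delta>" using R1 by (simp add: \<delta>_def field_simps)
    have each: "320 * real M * N q \<ge> real b ^ j * (1 - 644 * S q)" for q
    proof -
      have "320 * real M * N q \<ge> real (card (desc w j))
          - 644 * (\<Sum>l=1..2 * M. norm (\<Sum>v\<in>desc w j. ec (real l * (real q * real v / real p ^ ?n))))"
        unfolding N_def by (rule card_near_ge[OF finite_desc \<delta> M1 M2])
      then show ?thesis unfolding norm_sum_desc_multiple S_def sum_distrib_left[symmetric]
        by (simp add: card_desc algebra_simps)
    qed
    have "(\<Sum>q\<in>{R div 2<..R}. S q) \<le> C * err m ?n"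
      unfolding S_def
    proof (rule C)
      show "\<forall>q\<in>{R div 2<..R}. 0 < q \<and> q * (2 * M) \<le> 8 * p ^ ?n"
      proof
        fix q assume q: "q \<in> {R div 2<..R}"
        then have "q * (2 * M) \<le> R * (2 * M)" by (intro mult_right_mono) auto
        also have "\<dots> \<le> 8 * p ^ ?n" using RM by (simp add: mult_ac)
        finally show "0 < q \<and> q * (2 * M) \<le> 8 * p ^ ?n" using q by auto
      qed
    qed auto
    then have "644 * (\<Sum>q\<in>{R div 2<..R}. S q) \<le> 644 * (C * err m ?n)" by simp
    moreover have "real R / 2 \<le> real (card {R div 2<..R})" by (simp add: of_nat_diff)
    ultimately have "real R / 2 - 644 * (C * err m ?n) \<le> (\<Sum>q\<in>{R div 2<..R}. 1 - 644 * S q)"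
      by (simp add: sum_subtractf sum_distrib_left[symmetric])
    then have "real b ^ j * (real R / 2 - 644 * (C * err m ?n)) \<le> real b ^ j * (\<Sum>q\<in>{R div 2<..R}. 1 - 644 * S q)"
      by (intro mult_left_mono) auto
    also have "\<dots> \<le> (\<Sum>q\<in>{R div 2<..R}. 320 * real M * N q)"
      unfolding sum_distrib_left by (intro sum_mono each)
    also have "\<dots> = 320 * real M * (\<Sum>q\<in>{R div 2<..R}. N q)" by (simp only: sum_distrib_left)
    finally have main: "real b ^ j * (real R / 2 - 644 * (C * err m ?n)) \<le> 320 * real M * (\<Sum>q\<in>{R div 2<..R}. N q)" .
    have N0: "(\<Sum>q\<in>{R div 2<..R}. N q) \<ge> 0" by (auto simp: N_def intro!: sum_nonneg)
    \<comment> \<open>\<open>M * \<delta> \<le> 4\<close> turns \<open>320 * M * \<delta>\<close>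
      into 1280; the half in the number \<open>R / 2\<close> of denominators makes it 2560.\<close>
    have "real b ^ j * (real R / 2 - 644 * (C * err m ?n)) * \<delta> \<le> 320 * real M * (\<Sum>q\<in>{R div 2<..R}. N q) * \<delta>"
      using main \<delta> by (intro mult_right_mono) auto
    also have "\<dots> = 320 * (real M * \<delta>) * (\<Sum>q\<in>{R div 2<..R}. N q)" by simp
    also have "\<dots> \<le> 320 * 4 * (\<Sum>q\<in>{R div 2<..R}. N q)"
      using M2 \<delta> N0 by (intro mult_right_mono mult_left_mono) (auto simp: field_simps)
    finally have "real b ^ j * \<delta> * (real R / 2560 - (644 / 1280 * C) * err m ?n) \<le> (\<Sum>q\<in>{R div 2<..R}. N q)"
      by (simp add: field_simps)
    moreover have "real b ^ j * \<delta> * (real R / 2560 - C * err m ?n)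
        \<le> real b ^ j * \<delta> * (real R / 2560 - (644 / 1280 * C) * err m ?n)"
      using C1 \<delta> by (intro mult_left_mono diff_mono mult_right_mono) auto
    moreover have "(\<Sum>q\<in>{R div 2<..R}. N q) = real (\<Sum>v\<in>desc w j. card (hits ?n R v))"
      unfolding sum_card_hits[OF finite_desc] by (simp add: N_def \<delta>_def)
    ultimately show ?thesis unfolding \<delta>_def by linarith
  qed
  moreover have "C > 0" using C1 by simp
  ultimately show ?thesis by (rule that[rotated])
qed

text \<open>All denominators in \<open>hits n R v\<close> approximate the same rational, and are therefore
  multiples of its reduced denominator.\<close>

lemma hits_same_fraction:
  assumes R: "4 * R\<^sup>2 \<le> p ^ n" and q: "q \<in> {R div 2<..R}" "q' \<in> {R div 2<..R}"
    and a: "\<bar>real q * y - of_int a\<bar> \<le> real R / real p ^ n"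
    and a': "\<bar>real q' * y' - of_int a'\<bar> \<le> real R / real p ^ n"
    and y: "2 * (real R)\<^sup>2 * \<bar>y - y'\<bar> < 1" "y = y' \<or> 8 * R\<^sup>2 \<le> p ^ n"
  shows "a * int q' = a' * int q"
proof -
  have pos: "real q > 0" "real q' > 0" using q by auto
  have half: "real R < 2 * real q" "real R < 2 * real q'" using q by auto
  \<comment> \<open>An integer of absolute value below 1 vanishes. The two radii contribute
    \<open>2 * R ^ 2 / p ^ n\<close>: at most 1/2 for equal points, at most 1/4 for distinct ones,
    where the distance takes up to another 1/2.\<close>
  have "\<bar>of_int (a * int q' - a' * int q)\<bar>
     = \<bar>real q * (real q' * y' - of_int a') - real q' * (real q * y - of_int a) + real q * real q' * (y - y')\<bar>"
    by (simp add: algebra_simps)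
  also have "\<dots> \<le> real q * (real R / real p ^ n) + real q' * (real R / real p ^ n) + real q * real q' * \<bar>y - y'\<bar>"
  proof -
    have "\<bar>real q * (real q' * y' - of_int a')\<bar> \<le> real q * (real R / real p ^ n)"
      "\<bar>real q' * (real q * y - of_int a)\<bar> \<le> real q' * (real R / real p ^ n)"
      using mult_left_mono[OF a', of "real q"] mult_left_mono[OF a, of "real q'"] by (simp_all add: abs_mult)
    moreover have "\<bar>real q * real q' * (y - y')\<bar> = real q * real q' * \<bar>y - y'\<bar>" using pos by (simp add: abs_mult)
    ultimately show ?thesis by linarith
  qed
  also have "\<dots> \<le> real R * (real R / real p ^ n) + real R * (real R / real p ^ n) + real R * real R * \<bar>y - y'\<bar>"
    using q by (intro add_mono mult_right_mono mult_mono) auto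
  also have "\<dots> = 2 * ((real R)\<^sup>2 / real p ^ n) + (real R)\<^sup>2 * \<bar>y - y'\<bar>" by (simp add: power2_eq_square)
  also have "\<dots> < 1"
  proof (cases "y = y'")
    case True
    have "real (4 * R\<^sup>2) \<le> real (p ^ n)" using R by (simp only: of_nat_le_iff)
    then have "2 * ((real R)\<^sup>2 / real p ^ n) \<le> 1 / 2" by (simp add: field_simps)
    then show ?thesis using True by (simp only: diff_self abs_zero)
  next
    case False
    then have "8 * R\<^sup>2 \<le> p ^ n" using y by blast
    then have "real (8 * R\<^sup>2) \<le> real (p ^ n)" by (simp only: of_nat_le_iff)
    then have "2 * ((real R)\<^sup>2 / real p ^ n) \<le> 1 / 4" by (simp add: field_simps)
    then show ?thesis using y by linarith
  qed
  finally show ?thesis by linarith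
qed

text \<open>Many hits force a small reduced denominator \<open>r\<close>, because all of them are
  multiples of it. Dividing one hit \<open>q0\<close> by \<open>q0 / r\<close> and using
  \<open>R < 2 * q0\<close> gives the last conclusion, which is what \<open>count_near_upper\<close>
  counts for \<open>H = 2\<close>.\<close>

lemma card_hits_reduced:
  assumes R: "4 * R\<^sup>2 \<le> p ^ n" and ne: "hits n R v \<noteq> {}"
  obtains r where "r \<ge> 1" "card (hits n R v) * r \<le> R"
    "near_int (real r * real v / real p ^ n) (real r * 2 / real p ^ n)"
proof -
  define y where "y = real v / real p ^ n"
  obtain q0 where q0: "q0 \<in> hits n R v" using ne by blast
  then obtain a0 where q0R: "q0 \<in> {R div 2<..R}" and a0: "\<bar>real q0 * y - of_int a0\<bar> \<le> real R / real p ^ n"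
    by (auto simp: hits_def near_int_def y_def)
  have q0pos: "q0 > 0" using q0R by auto
  define g where "g = gcd a0 (int q0)"
  have g: "g > 0" using q0pos by (simp add: g_def)
  obtain a1 r1 where ar: "a0 = a1 * g" "int q0 = r1 * g" "coprime a1 r1"
    using gcd_coprime_exists[of a0 "int q0"] g unfolding g_def by auto
  have "0 < r1 * g" using ar(2) q0pos by linarith
  then have r1: "r1 > 0" using g by (simp add: zero_less_mult_iff)
  define r where "r = nat r1"
  have r: "int r = r1" "r \<ge> 1" using r1 by (auto simp: r_def)
  have dvd: "r dvd q" if q: "q \<in> hits n R v" for q
  proof -
    obtain a where qR: "q \<in> {R div 2<..R}" and a: "\<bar>real q * y - of_int a\<bar> \<le> real R / real p ^ n"
      using q by (auto simp: hits_def near_int_def y_def)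
    have "a * int q0 = a0 * int q"
      by (rule hits_same_fraction[OF R qR q0R a a0]) auto
    then have "(a * r1) * g = (a1 * int q) * g" by (simp add: ar mult_ac)
    then have "a * r1 = a1 * int q" using g by simp
    then have "r1 dvd a1 * int q" by (metis dvd_triv_right)
    then have "r1 dvd int q" using ar(3) by (simp add: coprime_commute coprime_dvd_mult_right_iff)
    then show ?thesis using r by (metis int_dvd_int_iff)
  qed
  have "hits n R v \<subseteq> (\<lambda>i. r * i) ` {1..R div r}"
  proof
    fix q assume q: "q \<in> hits n R v"
    then obtain i where i: "q = r * i" using dvd by (metis dvdE)
    have "0 < q" "q \<le> R" using q by (auto simp: hits_def)
    then have "i \<in> {1..R div r}" using r i by (auto simp: less_eq_div_iff_mult_less_eq mult.commute Suc_le_eq)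
    then show "q \<in> (\<lambda>i. r * i) ` {1..R div r}" using i by blast
  qed
  then have "card (hits n R v) \<le> card {1..R div r}" by (rule surj_card_le[rotated]) simp
  then have "card (hits n R v) * r \<le> (R div r) * r" by simp
  also have "\<dots> \<le> R" by (rule div_times_less_eq_dividend)
  finally have c: "card (hits n R v) * r \<le> R" .
  have "real q0 = real r * of_int g" using ar(2) r by (metis of_int_mult of_int_of_nat_eq)
  then have "real q0 * y - of_int a0 = of_int g * (real r * y - of_int a1)" by (simp add: ar(1) algebra_simps)
  then have "of_int g * \<bar>real r * y - of_int a1\<bar> \<le> real R / real p ^ n"
    using a0 g by (simp add: abs_mult)
  then have "real r * of_int g * \<bar>real r * y - of_int a1\<bar> \<le> real r * (real R / real p ^ n)"
    unfolding mult.assoc by (rule mult_left_mono) simp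
  also have "\<dots> \<le> real r * (2 * real q0 / real p ^ n)" using q0R
    by (intro mult_left_mono divide_right_mono) auto
  finally have "real q0 * \<bar>real r * y - of_int a1\<bar> \<le> real q0 * (real r * 2 / real p ^ n)"
    unfolding \<open>real q0 = real r * of_int g\<close>[symmetric] by (simp add: mult_ac)
  then have "\<bar>real r * y - of_int a1\<bar> \<le> real r * 2 / real p ^ n" using q0pos
    by (simp only: mult_le_cancel_left_pos of_nat_0_less_iff)
  then show ?thesis using that[OF r(2) c] by (auto simp: near_int_def y_def)
qed

definition good :: "nat \<Rightarrow> nat \<Rightarrow> nat set" where
  "good n R = {v. hits n R v \<noteq> {}}"

text \<open>A good word has at least one hit, which gives the upper bound. For the lower bound, once
  the words with more than \<open>B\<close> hits are discarded, each good word accounts for at most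
  \<open>B\<close> of the remaining hits.\<close>

lemma count_good:
  obtains c C K where "c > 0" "C > 0" "K > 0"
    "\<And>w m j R. R \<ge> 1 \<Longrightarrow> 12 * R \<le> p ^ (m + j) \<Longrightarrow> 4 * R\<^sup>2 \<le> p ^ (m + j) \<Longrightarrow>
     K * err m (m + j) \<le> real R \<Longrightarrow>
     c * real b ^ j * ((real R)\<^sup>2 / real p ^ (m + j)) \<le> real (card (good (m + j) R \<inter> desc w j)) \<and>
     real (card (good (m + j) R \<inter> desc w j)) \<le> C * real b ^ j * ((real R)\<^sup>2 / real p ^ (m + j))"
proof -
  obtain C1 where C1: "C1 > 0" and low: "\<And>w m j R. R \<ge> 1 \<Longrightarrow> 4 * R \<le> p ^ (m + j) \<Longrightarrow>
     real b ^ j * (real R / real p ^ (m + j)) * (real R / 2560 - C1 * err m (m + j))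
      \<le> real (\<Sum>v\<in>desc w j. card (hits (m + j) R v))" by (rule sum_hits_lower) (rule that)
  obtain C2 where C2: "C2 > 0" and up: "\<And>w m j R H. H \<ge> 1 \<Longrightarrow> 6 * H * R \<le> p ^ (m + j) \<Longrightarrow>
     (\<Sum>r=1..R. real (card {v \<in> desc w j. near_int (real r * real v / real p ^ (m + j)) (real r * real H / real p ^ (m + j))}) / real r)
      \<le> C2 * real b ^ j * (real H / real p ^ (m + j)) * (real R + err m (m + j))"
    by (rule count_near_upper) (rule that)
  \<comment> \<open>Budget: of the main term \<open>R / 2560\<close>, the heavily hit words take at
    most \<open>R / 10240\<close> by the choice of \<open>B\<close>, and the Fourier errors of both
    counts another \<open>R / 10240\<close> by the choice of \<open>K\<close>. This leaves
    \<open>R / 5120\<close>.\<close>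
  define B where "B = nat \<lceil>20480 * C2\<rceil>"
  have B: "20480 * C2 \<le> real B" unfolding B_def by linarith
  then have B0: "B > 0" using C2 by (cases "B = 0") auto
  define K where "K = 10240 * (C1 + 2 * C2) + 1"
  have K: "K > 0" using C1 C2 by (simp add: K_def)
  have "1 / (5120 * real B) * real b ^ j * ((real R)\<^sup>2 / real p ^ (m + j)) \<le> real (card (good (m + j) R \<inter> desc w j))
     \<and> real (card (good (m + j) R \<inter> desc w j)) \<le> (4 * C2) * real b ^ j * ((real R)\<^sup>2 / real p ^ (m + j))"
    if R1: "R \<ge> 1" and R: "12 * R \<le> p ^ (m + j)" "4 * R\<^sup>2 \<le> p ^ (m + j)" and E: "K * err m (m + j) \<le> real R" for w m j R
  proof
    let ?n = "m + j" and ?T = "desc w j"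
    let ?X = "real b ^ j * (real R / real p ^ ?n)"
    let ?near = "\<lambda>r. {v \<in> ?T. near_int (real r * real v / real p ^ ?n) (real r * real 2 / real p ^ ?n)}"
    have X0: "?X \<ge> 0" by simp
    have "1 * err m ?n \<le> K * err m ?n" using C1 C2 by (intro mult_right_mono) (auto simp: K_def)
    then have E1: "err m ?n \<le> real R" using E by linarith
    have "card (good ?n R \<inter> ?T) = (\<Sum>v\<in>good ?n R \<inter> ?T. 1)" by simp
    also have "\<dots> \<le> (\<Sum>v\<in>good ?n R \<inter> ?T. card (hits ?n R v))"
      by (intro sum_mono) (auto simp: good_def Suc_le_eq card_gt_0_iff)
    also have "\<dots> \<le> (\<Sum>v\<in>?T. card (hits ?n R v))" by (intro sum_mono2) auto
    finally have "real (card (good ?n R \<inter> ?T)) \<le> real (\<Sum>v\<in>?T. card (hits ?n R v))" by (simp only: of_nat_le_iff)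
    also have "\<dots> = (\<Sum>q\<in>{R div 2<..R}. real (card {v \<in> ?T. near_int (real q * real v / real p ^ ?n) (real R / real p ^ ?n)}))"
      unfolding sum_card_hits[OF finite_desc] by simp
    also have "\<dots> \<le> (\<Sum>q\<in>{R div 2<..R}. real R * (real (card (?near q)) / real q))"
    proof (rule sum_mono)
      fix q assume q: "q \<in> {R div 2<..R}"
      have "real R \<le> real q * real 2" using q by auto
      then have "real R / real p ^ ?n \<le> real q * real 2 / real p ^ ?n" by (intro divide_right_mono) auto
      then have "card {v \<in> ?T. near_int (real q * real v / real p ^ ?n) (real R / real p ^ ?n)} \<le> card (?near q)"
        by (intro card_mono) (auto intro: near_int_mono)
      then have "real (card {v \<in> ?T. near_int (real q * real v / real p ^ ?n) (real R / real p ^ ?n)})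
          \<le> 1 * real (card (?near q))" by simp
      also have "\<dots> \<le> (real R / real q) * real (card (?near q))"
        using q by (intro mult_right_mono) (auto simp: field_simps)
      finally show "real (card {v \<in> ?T. near_int (real q * real v / real p ^ ?n) (real R / real p ^ ?n)})
          \<le> real R * (real (card (?near q)) / real q)" by simp
    qed
    also have "\<dots> \<le> (\<Sum>q=1..R. real R * (real (card (?near q)) / real q))"
      by (intro sum_mono2) auto
    also have "\<dots> = real R * (\<Sum>q=1..R. real (card (?near q)) / real q)" by (simp only: sum_distrib_left)
    also have "\<dots> \<le> real R * (C2 * real b ^ j * (real 2 / real p ^ ?n) * (real R + err m ?n))"
      using R by (intro mult_left_mono up) auto
    also have "\<dots> \<le> real R * (C2 * real b ^ j * (real 2 / real p ^ ?n) * (real R + real R))"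
      using E1 C2 by (intro mult_left_mono add_left_mono mult_nonneg_nonneg) auto
    finally show "real (card (good ?n R \<inter> ?T)) \<le> (4 * C2) * real b ^ j * ((real R)\<^sup>2 / real p ^ ?n)"
      by (simp add: power2_eq_square mult_ac)

    \<comment> \<open>Words hit by more than \<open>B\<close> denominators are close to a rational with denominator at most \<open>R div B\<close>;
      the upper bound for these denominators shows that they carry only a small part of the hits.\<close>
    define R' where "R' = R div B"
    have R'R: "R' \<le> R" by (simp add: R'_def)
    have "(\<Sum>v\<in>?T. if card (hits ?n R v) > B then real (card (hits ?n R v)) else 0)
       \<le> (\<Sum>v\<in>?T. \<Sum>r=1..R'. if v \<in> ?near r then real R / real r else 0)"
    proof (rule sum_mono)
      fix v assume v: "v \<in> ?T"
      show "(if card (hits ?n R v) > B then real (card (hits ?n R v)) else 0)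
         \<le> (\<Sum>r=1..R'. if v \<in> ?near r then real R / real r else 0)"
      proof (cases "card (hits ?n R v) > B")
        case True
        then have "hits ?n R v \<noteq> {}" by auto
        then obtain r where r: "r \<ge> 1" "card (hits ?n R v) * r \<le> R"
          "near_int (real r * real v / real p ^ ?n) (real r * 2 / real p ^ ?n)"
          using card_hits_reduced[OF R(2)] by blast
        have "r * B \<le> r * card (hits ?n R v)" using True by (intro mult_left_mono) auto
        then have "r * B \<le> R" using r(2) by (metis le_trans mult.commute)
        then have rR: "r \<in> {1..R'}" using r(1) B0 by (simp add: R'_def less_eq_div_iff_mult_less_eq)
        have "real (card (hits ?n R v) * r) \<le> real R" using r(2) by (simp only: of_nat_le_iff)
        then have "real (card (hits ?n R v)) \<le> (if v \<in> ?near r then real R / real r else 0)"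
          using r v by (simp add: field_simps)
        also have "\<dots> \<le> (\<Sum>r=1..R'. if v \<in> ?near r then real R / real r else 0)"
          using rR by (intro member_le_sum) auto
        finally show ?thesis using True by simp
      qed (auto intro!: sum_nonneg)
    qed
    also have "\<dots> = (\<Sum>r=1..R'. \<Sum>v\<in>?T. if v \<in> ?near r then real R / real r else 0)" by (rule sum.swap)
    also have "\<dots> = (\<Sum>r=1..R'. real R * (real (card (?near r)) / real r))"
      by (intro sum.cong refl) (simp add: sum.If_cases Int_def)
    also have "\<dots> = real R * (\<Sum>r=1..R'. real (card (?near r)) / real r)" by (simp only: sum_distrib_left)
    also have "\<dots> \<le> real R * (C2 * real b ^ j * (real 2 / real p ^ ?n) * (real R' + err m ?n))"
      using R R'R by (intro mult_left_mono up) auto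
    also have "\<dots> = ?X * (2 * C2 * real R' + 2 * C2 * err m ?n)"
      by (simp add: algebra_simps add_divide_distrib)
    finally have big: "(\<Sum>v\<in>?T. if card (hits ?n R v) > B then real (card (hits ?n R v)) else 0)
       \<le> ?X * (2 * C2 * real R' + 2 * C2 * err m ?n)" .
    have "real R' * B \<le> real R" unfolding R'_def
      using div_times_less_eq_dividend[of R B] by (metis of_nat_le_iff of_nat_mult)
    moreover have "real R' * (20480 * C2) \<le> real R' * B" using B by (intro mult_left_mono) auto
    ultimately have "real R' * (20480 * C2) \<le> real R" by (rule order.trans[rotated])
    then have RR: "2 * C2 * real R' \<le> real R / 10240" by (simp add: mult_ac)
    have "10240 * (C1 + 2 * C2) * err m ?n \<le> K * err m ?n" by (intro mult_right_mono) (auto simp: K_def)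
    then have EE: "C1 * err m ?n + 2 * C2 * err m ?n \<le> real R / 10240"
      using E by (simp add: ring_distribs)
    have "?X * (real R / 2560 - C1 * err m ?n) \<le> real (\<Sum>v\<in>?T. card (hits ?n R v))"
      using R R1 by (intro low) auto
    also have "\<dots> = (\<Sum>v\<in>?T. if card (hits ?n R v) > B then real (card (hits ?n R v)) else 0)
         + (\<Sum>v\<in>?T. if card (hits ?n R v) > B then 0 else real (card (hits ?n R v)))"
      by (subst sum.distrib[symmetric]) (auto intro!: sum.cong)
    also have "(\<Sum>v\<in>?T. if card (hits ?n R v) > B then 0 else real (card (hits ?n R v)))
       \<le> (\<Sum>v\<in>?T. if v \<in> good ?n R then real B else 0)"
      by (intro sum_mono) (auto simp: good_def)
    also have "\<dots> = real B * real (card (good ?n R \<inter> ?T))" by (simp add: sum.If_cases Int_def conj_commute)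
    finally have "?X * (real R / 2560 - C1 * err m ?n) - ?X * (2 * C2 * real R' + 2 * C2 * err m ?n)
        \<le> real B * real (card (good ?n R \<inter> ?T))"
      using big by linarith
    moreover have "?X * (real R / 5120) \<le> ?X * ((real R / 2560 - C1 * err m ?n) - (2 * C2 * real R' + 2 * C2 * err m ?n))"
      using RR EE by (intro mult_left_mono X0) linarith
    ultimately have "?X * (real R / 5120) \<le> real B * real (card (good ?n R \<inter> ?T))"
      by (simp only: right_diff_distrib)
    then show "1 / (5120 * real B) * real b ^ j * ((real R)\<^sup>2 / real p ^ ?n) \<le> real (card (good ?n R \<inter> ?T))"
      using B0 by (simp add: field_simps power2_eq_square)
  qed
  then show ?thesis using B0 C2 K by (intro that[of "1 / (5120 * real B)" "4 * C2" K]) auto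
qed

end

section \<open>Hausdorff measure of limit sets of cylinders\<close>

context digits
begin

definition cyl :: "nat \<Rightarrow> nat \<Rightarrow> real set" where
  "cyl n u = {real u / real p ^ n .. (real u + 1) / real p ^ n}"

definition cantor :: "real set" where
  "cantor = (\<Inter>n. \<Union>u\<in>desc 0 n. cyl n u)"

lemma cyl_nonempty [simp]: "cyl n u \<noteq> {}"
  by (simp add: cyl_def divide_right_mono)

lemma compact_cyl [simp]: "compact (cyl n u)"
  by (simp add: cyl_def)

lemma diameter_cyl [simp]: "diameter (cyl n u) = 1 / real p ^ n"
  by (auto simp: cyl_def add_divide_distrib)

lemma cyl_desc_subset:
  assumes "v \<in> desc u k"
  shows "cyl (n + k) v \<subseteq> cyl n u"
proof -
  have "real (u * p ^ k) \<le> real v" "real (v + 1) \<le> real ((u + 1) * p ^ k)"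
    unfolding of_nat_le_iff using desc_bounds[OF assms] by linarith+
  then have "real (u * p ^ k) / real p ^ (n + k) \<le> real v / real p ^ (n + k)"
    "real (v + 1) / real p ^ (n + k) \<le> real ((u + 1) * p ^ k) / real p ^ (n + k)"
    by (intro divide_right_mono; simp)+
  moreover have "real (u * p ^ k) / real p ^ (n + k) = real u / real p ^ n"
    "real ((u + 1) * p ^ k) / real p ^ (n + k) = (real u + 1) / real p ^ n"
    by (simp_all add: field_simps power_add)
  ultimately have "real u / real p ^ n \<le> real v / real p ^ (n + k)"
    "(real v + 1) / real p ^ (n + k) \<le> (real u + 1) / real p ^ n"
    by (simp_all only: of_nat_add of_nat_1)
  then show ?thesis unfolding cyl_def by (intro atLeastatMost_subset_iff[THEN iffD2]) simp
qed

text \<open>The convergence half of Borel-Cantelli, for covers: the cylinders of all levels from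
  \<open>N\<close> on cover \<open>E\<close>, and their total \<open>d\<close>-dimensional size is
  the tail of a geometric series with ratio \<open>p powr (a - d)\<close>.\<close>

lemma hausdorff_measure_limsup_cyl:
  fixes d a C :: real
  assumes fin: "\<And>n. finite (A n)" and card: "\<And>n. n \<ge> l \<Longrightarrow> real (card (A n)) \<le> C * real p powr (real n * a)"
    and ad: "a < d" "d > 0" and E: "E \<subseteq> {x. \<exists>\<^sub>\<infinity>n. x \<in> (\<Union>u\<in>A n. cyl n u)}"
  shows "hausdorff_measure d E = 0"
proof -
  define \<rho> where "\<rho> = real p powr (a - d)"
  have \<rho>: "0 < \<rho>" "\<rho> < 1" using p_ge ad by (auto simp: \<rho>_def powr_less_one)
  have C0: "C \<ge> 0"
  proof -
    have "0 \<le> real (card (A l))" by simp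
    also have "\<dots> \<le> C * real p powr (real l * a)" by (rule card) simp
    finally show ?thesis using p_ge by (simp add: zero_le_mult_iff)
  qed
  have "hausdorff_premeasure d \<delta> E \<le> 0" if \<delta>: "\<delta> > 0" for \<delta>
  proof (rule ennreal_le_epsilon)
    fix \<epsilon> :: real assume \<epsilon>: "\<epsilon> > 0"
    have "(\<lambda>n. C * \<rho> ^ n / (1 - \<rho>)) \<longlonglongrightarrow> C * 0 / (1 - \<rho>)"
      using \<rho> by (intro tendsto_intros LIMSEQ_power_zero) auto
    then have "\<forall>\<^sub>F n in sequentially. C * \<rho> ^ n / (1 - \<rho>) < \<epsilon>" using \<epsilon> by (intro order_tendstoD(2)) auto
    moreover have "(\<lambda>n. (1 / real p) ^ n) \<longlonglongrightarrow> 0" using p_ge by (intro LIMSEQ_power_zero) auto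
    then have "\<forall>\<^sub>F n in sequentially. (1 / real p) ^ n < \<delta>" using \<delta> by (intro order_tendstoD(2)) auto
    ultimately have "\<forall>\<^sub>F n in sequentially. C * \<rho> ^ n / (1 - \<rho>) < \<epsilon> \<and> (1 / real p) ^ n < \<delta> \<and> n \<ge> l"
      by (intro eventually_conj eventually_ge_at_top)
    then obtain N where N: "C * \<rho> ^ N / (1 - \<rho>) < \<epsilon>" "(1 / real p) ^ N < \<delta>" "N \<ge> l"
      by (metis (no_types, lifting) eventually_sequentially order_refl)
    \<comment> \<open>A cover is a sequence, so pairs (level, word) are enumerated by
      \<open>prod_decode\<close>. The remaining indices get the empty set, which costs nothing
      because \<open>0 powr d = 0\<close>.\<close>
    define U where "U i = (case prod_decode i of (n, u) \<Rightarrow> if u \<in> A (N + n) then cyl (N + n) u else {})" for i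
    define g where "g i = (case prod_decode i of (n, u) \<Rightarrow> if u \<in> A (N + n) then (1 / real p ^ (N + n)) powr d else 0)" for i
    have gU: "diameter (U i) powr d = g i" for i
      by (auto simp: U_def g_def split: prod.split)
    have pc: "(1 / real p ^ n) powr d = real p powr (- (real n * d))" for n
    proof -
      have "1 / real p ^ n = real p powr (- real n)" by (simp add: powr_minus powr_realpow divide_inverse)
      then show ?thesis by (simp add: powr_powr)
    qed
    have "(\<Sum>i. ennreal (g i)) \<le> ennreal (C * \<rho> ^ N / (1 - \<rho>))"
    proof (rule suminf_le_const)
      fix k :: nat
      let ?S = "SIGMA n:{..<k}. A (N + n)"
      have "(\<Sum>i<k. g i) = (\<Sum>i\<in>{i\<in>{..<k}. prod_decode i \<in> ?S}. (\<lambda>(n, u). (1 / real p ^ (N + n)) powr d) (prod_decode i))"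
      proof (intro sum.mono_neutral_cong_right)
        have "fst (prod_decode i) \<le> i" for i
          by (metis le_prod_encode_1 prod.collapse prod_decode_inverse)
        then have "n < k" if "i < k" "prod_decode i = (n, u)" for i n u
          using that by (metis fst_conv order.strict_trans1)
        then show "\<forall>i\<in>{..<k} - {i \<in> {..<k}. prod_decode i \<in> ?S}. g i = 0"
          by (auto simp: g_def split: prod.splits)
      qed (auto simp: g_def split: prod.splits)
      also have "\<dots> = (\<Sum>(n, u)\<in>prod_decode ` {i\<in>{..<k}. prod_decode i \<in> ?S}. (1 / real p ^ (N + n)) powr d)"
        by (subst sum.reindex) (auto simp: inj_on_def inj_prod_decode inj_eq)
      also have "\<dots> \<le> (\<Sum>(n, u)\<in>?S. (1 / real p ^ (N + n)) powr d)"
        using fin by (intro sum_mono2) auto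
      also have "\<dots> = (\<Sum>n<k. real (card (A (N + n))) * real p powr (- (real (N + n) * d)))"
        using fin by (subst sum.Sigma[symmetric]) (auto simp: pc simp del: of_nat_add)
      also have "\<dots> \<le> (\<Sum>n<k. C * real p powr (real (N + n) * a) * real p powr (- (real (N + n) * d)))"
        using N by (intro sum_mono mult_right_mono card) auto
      also have "\<dots> = (\<Sum>n<k. C * \<rho> ^ N * \<rho> ^ n)"
      proof (intro sum.cong refl)
        fix n
        have "real p powr (real (N + n) * a) * real p powr (- (real (N + n) * d)) = real p powr ((a - d) * real (N + n))"
          unfolding powr_add[symmetric] by (rule arg_cong[of _ _ "\<lambda>x. real p powr x"]) (simp add: algebra_simps)
        also have "\<dots> = \<rho> ^ (N + n)" using p_ge by (subst powr_powr[symmetric]) (simp add: \<rho>_def powr_realpow del: of_nat_add)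
        finally show "C * real p powr (real (N + n) * a) * real p powr (- (real (N + n) * d)) = C * \<rho> ^ N * \<rho> ^ n"
          by (simp add: power_add mult.assoc)
      qed
      also have "\<dots> = C * \<rho> ^ N * (\<Sum>n<k. \<rho> ^ n)" by (simp only: sum_distrib_left)
      also have "\<dots> \<le> C * \<rho> ^ N * (1 / (1 - \<rho>))"
      proof (intro mult_left_mono)
        have "(\<Sum>n<k. \<rho> ^ n) \<le> (\<Sum>n. \<rho> ^ n)" using \<rho> by (intro sum_le_suminf summable_geometric) auto
        then show "(\<Sum>n<k. \<rho> ^ n) \<le> 1 / (1 - \<rho>)" using \<rho> by (simp add: suminf_geometric)
      qed (use \<rho> C0 in auto)
      finally have "(\<Sum>i<k. g i) \<le> C * \<rho> ^ N / (1 - \<rho>)" by simp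
      moreover have "(\<Sum>i<k. ennreal (g i)) = ennreal (\<Sum>i<k. g i)"
        by (rule sum_ennreal) (auto simp: g_def split: prod.split)
      ultimately show "(\<Sum>i<k. ennreal (g i)) \<le> ennreal (C * \<rho> ^ N / (1 - \<rho>))" by (simp add: ennreal_leI)
    qed simp
    also have "\<dots> \<le> ennreal \<epsilon>" using N(1) by (intro ennreal_leI) simp
    finally have sum: "(\<Sum>i. ennreal (diameter (U i) powr d)) \<le> ennreal \<epsilon>" by (simp add: gU)
    have "E \<subseteq> (\<Union>i. U i)"
    proof
      fix x assume "x \<in> E"
      then have "\<exists>\<^sub>\<infinity>n. x \<in> (\<Union>u\<in>A n. cyl n u)" using E by auto
      then obtain n u where n: "n \<ge> N" "u \<in> A n" "x \<in> cyl n u" unfolding INFM_nat_le by blast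
      then have "x \<in> U (prod_encode (n - N, u))" by (simp add: U_def)
      then show "x \<in> (\<Union>i. U i)" by blast
    qed
    moreover have "bounded (U i) \<and> diameter (U i) \<le> \<delta>" for i
    proof -
      have "1 / real p ^ (N + n) \<le> \<delta>" for n
      proof -
        have "(1 / real p) ^ (N + n) \<le> (1 / real p) ^ N" using p_ge by (intro power_decreasing) auto
        then show ?thesis using N(2) by (simp add: power_one_over)
      qed
      then show ?thesis using \<delta> by (auto simp: U_def compact_imp_bounded split: prod.split)
    qed
    ultimately have "hausdorff_premeasure d \<delta> E \<le> (\<Sum>i. ennreal (diameter (U i) powr d))"
      unfolding hausdorff_premeasure_def by (intro INF_lower) auto
    then show "hausdorff_premeasure d \<delta> E \<le> 0 + ennreal \<epsilon>" using sum by simp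
  qed
  then have "hausdorff_measure d E \<le> 0" unfolding hausdorff_measure_def by (intro SUP_least) auto
  then show ?thesis by simp
qed

section \<open>Cheap covers and nested cylinders\<close>

lemma card_cyl_meeting:
  assumes "finite S" "bounded U" "diameter U < 1 / real p ^ n"
  shows "card {u \<in> S. U \<inter> cyl n u \<noteq> {}} \<le> 2"
proof (cases "{u \<in> S. U \<inter> cyl n u \<noteq> {}} = {}")
  case False
  let ?H = "{u \<in> S. U \<inter> cyl n u \<noteq> {}}"
  define u where "u = Min ?H"
  have fin: "finite ?H" using assms by simp
  have uH: "u \<in> ?H" unfolding u_def using fin False by (rule Min_in)
  have "?H \<subseteq> {u, u + 1}"
  proof
    fix u' assume u': "u' \<in> ?H"
    have le: "u \<le> u'" unfolding u_def using fin u' by (rule Min_le)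
    obtain y y' where y: "y \<in> U" "y \<in> cyl n u" and y': "y' \<in> U" "y' \<in> cyl n u'" using uH u' by auto
    have "y' - y \<le> diameter U" using diameter_bounded_bound[OF assms(2) y'(1) y(1)] by (simp add: dist_real_def)
    also have "\<dots> < 1 / real p ^ n" by fact
    finally have "real u' / real p ^ n - (real u + 1) / real p ^ n < 1 / real p ^ n"
      using y(2) y'(2) by (auto simp: cyl_def)
    then have "real u' - (real u + 1) < 1" by (simp add: diff_divide_distrib[symmetric] divide_less_cancel)
    then have "u' \<le> u + 1" by linarith
    then show "u' \<in> {u, u + 1}" using le by auto
  qed
  then have "card ?H \<le> card {u, u + 1}" by (intro card_mono) auto
  then show ?thesis by simp
next
  case True
  then show ?thesis by (simp only: card.empty)
qed

text \<open>A cover set of diameter zero has no scale to compare with cylinders. The sizes \<rho>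
  are positive; their \<open>d\<close>-th powers exceed those of the diameters by a geometric series
  of total \<open>\<epsilon> / 2\<close>.\<close>

lemma hausdorff_measure_zero_cover:
  fixes E :: "real set"
  assumes "hausdorff_measure d E = 0" "\<epsilon> > 0" "d > 0"
  obtains U \<rho> where "E \<subseteq> (\<Union>i. U i)" "\<And>i::nat. bounded (U i)" "\<And>i. 0 < \<rho> i" "\<And>i. diameter (U i) \<le> \<rho> i"
    "(\<Sum>i. ennreal (\<rho> i powr d)) < ennreal \<epsilon>"
proof -
  have "hausdorff_premeasure d 1 E \<le> hausdorff_measure d E"
    unfolding hausdorff_measure_def by (intro SUP_upper) auto
  then have "hausdorff_premeasure d 1 E < ennreal (\<epsilon> / 2)" using assms by simp
  then obtain U where U: "E \<subseteq> (\<Union>i. U i)" "\<And>i. bounded (U i)"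
    and sum: "(\<Sum>i. ennreal (diameter (U i) powr d)) < ennreal (\<epsilon> / 2)"
    unfolding hausdorff_premeasure_def INF_less_iff by auto
  define h where "h i = (\<epsilon> / 2) * (1 / 2) ^ Suc i" for i
  have h0: "h i > 0" for i using assms by (simp add: h_def)
  define \<rho> where "\<rho> i = (diameter (U i) powr d + h i) powr (1 / d)" for i
  have \<rho>: "\<rho> i powr d = diameter (U i) powr d + h i" for i
    using assms h0[of i] by (simp add: \<rho>_def powr_powr add_nonneg_nonneg less_imp_le)
  have "h sums ((\<epsilon> / 2) * 1)" unfolding h_def by (intro sums_mult power_half_series)
  then have "(\<Sum>i. ennreal (h i)) = ennreal (\<epsilon> / 2)"
    using h0 by (subst suminf_ennreal2) (auto simp: sums_iff less_imp_le)
  then have "(\<Sum>i. ennreal (\<rho> i powr d)) = (\<Sum>i. ennreal (diameter (U i) powr d)) + ennreal (\<epsilon> / 2)"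
    unfolding \<rho> using h0 by (subst ennreal_plus) (auto simp: suminf_add[symmetric] less_imp_le)
  also have "\<dots> < ennreal (\<epsilon> / 2) + ennreal (\<epsilon> / 2)"
    using sum by (simp add: ennreal_add_left_cancel_less add.commute)
  also have "\<dots> = ennreal \<epsilon>" using assms by (subst ennreal_plus[symmetric]) auto
  finally have "(\<Sum>i. ennreal (\<rho> i powr d)) < ennreal \<epsilon>" .
  moreover have "0 < \<rho> i" for i
    unfolding \<rho>_def using h0[of i] by (smt (verit) powr_ge_zero powr_gt_zero)
  moreover have "diameter (U i) \<le> \<rho> i" for i
  proof -
    have "diameter (U i) = (diameter (U i) powr d) powr (1 / d)"
      using assms diameter_ge_0[OF U(2)] by (simp add: powr_powr)
    also have "\<dots> \<le> \<rho> i" unfolding \<rho>_def using h0[of i] assms by (intro powr_mono2) auto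
    finally show ?thesis .
  qed
  ultimately show ?thesis using U that by blast
qed

text \<open>A mass distribution argument without a measure: given a cheap cover, one keeps choosing a
  descendant whose cost, i.e. the total size of the cover sets meeting its cylinder relative to
  the size of the cylinder, stays below 1. Averaging over the descendants in \<open>V\<close> shows that this is
  possible.\<close>

lemma hausdorff_measure_tree:
  fixes d :: real
  assumes d: "0 < d" "d \<le> 1" and C: "C \<ge> 1"
    and stage: "\<And>m N. \<exists>n>m. \<exists>V.
      (\<forall>v\<in>V. \<forall>x\<in>cyl n v. P N x) \<and>
      (\<forall>w\<in>desc 0 m. 2 * real p powr (real (n - m) * d) \<le> real (card (V \<inter> desc w (n - m))) \<and>
         (\<forall>l u. m \<le> l \<longrightarrow> l \<le> n \<longrightarrow> u \<in> desc w (l - m) \<longrightarrow>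
            real (card (V \<inter> desc u (n - l))) \<le> C * real p powr (- real (l - m) * d) * real (card (V \<inter> desc w (n - m)))))"
  shows "hausdorff_measure d {x \<in> cantor. \<forall>N::nat. P N x} \<noteq> 0"
proof
  let ?E = "{x \<in> cantor. \<forall>N. P N x}"
  assume zero: "hausdorff_measure d ?E = 0"
  \<comment> \<open>The 2 counts the cylinders of one level that a smaller set can meet,
    \<open>C\<close> comes from the spread hypothesis, and \<open>p\<close> from rounding \<rho> to
    a power of \<open>p\<close>.\<close>
  define C' where "C' = 2 * C * real p"
  have C'1: "C' \<ge> 1"
  proof -
    have "1 * 1 \<le> (2 * C) * real p" using C p_ge by (intro mult_mono) auto
    then show ?thesis by (simp add: C'_def)
  qed
  obtain U \<rho> where U: "?E \<subseteq> (\<Union>i. U i)" "\<And>i::nat. bounded (U i)" and \<rho>: "\<And>i. 0 < \<rho> i" "\<And>i. diameter (U i) \<le> \<rho> i"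
    and sum: "(\<Sum>i. ennreal (\<rho> i powr d)) < ennreal (1 / C')"
  proof (rule hausdorff_measure_zero_cover[OF zero _ d(1)])
    show "1 / C' > 0" using C'1 by simp
  qed (rule that)
  \<comment> \<open>The cap makes a cover set at least as large as the cylinder cost exactly 1. A
    total cost below 1 thus forces every cover set meeting the cylinder to be smaller than it, which
    is \<open>small\<close>.\<close>
  define c where "c n i = min 1 (C' * (real p ^ n * \<rho> i) powr d)" for n i
  define t where "t n v i = (if U i \<inter> cyl n v \<noteq> {} then c n i else 0)" for n v i
  define cost where "cost n v = (\<Sum>i. ennreal (t n v i))" for n v
  have c0: "c n i \<ge> 0" for n i using C'1 by (simp add: c_def)
  have t0: "t n v i \<ge> 0" for n v i using c0 by (simp add: t_def)
  have start: "cost 0 0 < 1"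
  proof -
    have "cost 0 0 \<le> (\<Sum>i. ennreal C' * ennreal (\<rho> i powr d))"
      unfolding cost_def using C'1
      by (intro suminf_le) (auto simp: t_def c_def ennreal_mult[symmetric] intro!: ennreal_leI)
    also have "\<dots> = ennreal C' * (\<Sum>i. ennreal (\<rho> i powr d))" by simp
    also have "\<dots> < ennreal C' * ennreal (1 / C')"
      using sum C'1 by (intro ennreal_mult_strict_left_mono) auto
    also have "\<dots> = 1" using C'1 by (simp add: ennreal_mult[symmetric])
    finally show ?thesis .
  qed
  have small: "real p ^ n * \<rho> i < 1" if "cost n v < 1" "U i \<inter> cyl n v \<noteq> {}" for n v i
  proof (rule ccontr)
    assume "\<not> real p ^ n * \<rho> i < 1"
    then have "1 powr d \<le> (real p ^ n * \<rho> i) powr d" using d by (intro powr_mono2) auto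
    then have "1 * 1 \<le> C' * (real p ^ n * \<rho> i) powr d" using C'1 by (intro mult_mono) auto
    then have "c n i = 1" by (simp add: c_def)
    moreover have "ennreal (t n v i) < 1" using that(1) unfolding cost_def by (rule ennreal_suminf_lessD)
    ultimately show False using that(2) by (simp add: t_def)
  qed
  have step: "\<exists>n v. n > m \<and> v \<in> desc w (n - m) \<and> cost n v < 1 \<and> (\<forall>x\<in>cyl n v. P N x)"
    if w: "w \<in> desc 0 m" "cost m w < 1" for m w N
  proof -
    obtain n V where nm: "n > m" and P: "\<And>v x. v \<in> V \<Longrightarrow> x \<in> cyl n v \<Longrightarrow> P N x"
      and big: "2 * real p powr (real (n - m) * d) \<le> real (card (V \<inter> desc w (n - m)))"
      and spread: "\<And>l u. m \<le> l \<Longrightarrow> l \<le> n \<Longrightarrow> u \<in> desc w (l - m) \<Longrightarrow>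
        real (card (V \<inter> desc u (n - l))) \<le> C * real p powr (- real (l - m) * d) * real (card (V \<inter> desc w (n - m)))"
      using stage[of m N] w(1) by meson
    define W where "W = V \<inter> desc w (n - m)"
    have finW: "finite W" by (simp add: W_def)
    have W0: "real (card W) > 0" using big p_ge unfolding W_def by (smt (verit) powr_gt_zero of_nat_0_less_iff p_pos)
    \<comment> \<open>Averaged over \<open>W\<close>, cover set \<open>i\<close> costs no more than
      at the parent \<open>w\<close>. If it is smaller than level \<open>n\<close>, it meets two
      cylinders and the size of \<open>W\<close> pays for them. Otherwise it is compared with the
      level \<open>k\<close> of its own scale, where \<open>spread\<close> limits how much of
      \<open>W\<close> lies in the two cylinders that it meets.\<close>
    have each: "(\<Sum>v\<in>W. t n v i) \<le> real (card W) * t m w i" for i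
    proof (cases "U i \<inter> cyl m w = {}")
      case True
      have "cyl n v \<subseteq> cyl m w" if "v \<in> W" for v
        using cyl_desc_subset[of v w "n - m" m] that nm by (simp add: W_def)
      then have "(\<Sum>v\<in>W. t n v i) = 0" using True by (intro sum.neutral) (auto simp: t_def)
      then show ?thesis using True by (simp add: t_def)
    next
      case False
      have tm: "t m w i < 1"
        using w(2) ennreal_suminf_lessD[of "\<lambda>i. ennreal (t m w i)" 1 i] by (simp add: cost_def)
      then have tmc: "t m w i = C' * (real p ^ m * \<rho> i) powr d"
        using False by (auto simp: t_def c_def)
      have sm: "real p ^ m * \<rho> i < 1" by (rule small[OF w(2) False])
      let ?H = "{v \<in> W. U i \<inter> cyl n v \<noteq> {}}"
      have "(\<Sum>v\<in>W. t n v i) = real (card ?H) * c n i"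
        using finW by (simp add: t_def sum.If_cases Int_def)
      also have "\<dots> \<le> real (card W) * (C' * (real p ^ m * \<rho> i) powr d)"
      proof (cases "real p ^ n * \<rho> i < 1")
        case True
        have "\<rho> i < 1 / real p ^ n" using True by (simp add: field_simps)
        with \<rho>(2)[of i] have "diameter (U i) < 1 / real p ^ n" by (rule le_less_trans)
        then have "card ?H \<le> 2" by (rule card_cyl_meeting[OF finW U(2)])
        then have "real (card ?H) * c n i \<le> 2 * (C' * (real p ^ n * \<rho> i) powr d)"
          using c0 C'1 by (intro mult_mono) (auto simp: c_def)
        also have "real p ^ n * \<rho> i = real p powr real (n - m) * (real p ^ m * \<rho> i)"
          using nm by (simp add: powr_realpow power_add[symmetric] del: of_nat_diff)
        also have "(real p powr real (n - m) * (real p ^ m * \<rho> i)) powr d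
           = real p powr (real (n - m) * d) * (real p ^ m * \<rho> i) powr d"
          using \<rho>(1)[of i] by (subst powr_mult) (auto simp: powr_powr less_imp_le simp del: of_nat_diff)
        also have "2 * (C' * (real p powr (real (n - m) * d) * (real p ^ m * \<rho> i) powr d))
           = (2 * real p powr (real (n - m) * d)) * (C' * (real p ^ m * \<rho> i) powr d)"
          by (simp only: mult_ac)
        also have "\<dots> \<le> real (card W) * (C' * (real p ^ m * \<rho> i) powr d)"
          using big C'1 unfolding W_def by (intro mult_right_mono) auto
        finally show ?thesis .
      next
        case nsmall: False
        define l where "l = (LEAST l. \<not> real p ^ l * \<rho> i < 1)"
        have l1: "\<not> real p ^ l * \<rho> i < 1" unfolding l_def using nsmall by (rule LeastI)
        have ln: "l \<le> n" unfolding l_def using nsmall by (rule Least_le)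
        have lm: "l > m"
        proof (rule ccontr)
          assume "\<not> l > m"
          then have "real p ^ l * \<rho> i \<le> real p ^ m * \<rho> i"
            using p_ge \<rho>(1)[of i] by (intro mult_right_mono power_increasing) auto
          then show False using sm l1 by linarith
        qed
        define k where "k = l - 1"
        have k: "l = Suc k" "m \<le> k" "k < n" using lm ln by (auto simp: k_def)
        have ks: "real p ^ k * \<rho> i < 1"
          using not_less_Least[of k "\<lambda>l. \<not> real p ^ l * \<rho> i < 1"] k by (auto simp: l_def)
        let ?K = "{u \<in> desc w (k - m). U i \<inter> cyl k u \<noteq> {}}"
        have "\<rho> i < 1 / real p ^ k" using ks by (simp add: field_simps)
        with \<rho>(2)[of i] have "diameter (U i) < 1 / real p ^ k" by (rule le_less_trans)
        then have K2: "card ?K \<le> 2" by (intro card_cyl_meeting U) auto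
        have "?H \<subseteq> (\<Union>u\<in>?K. V \<inter> desc u (n - k))"
        proof
          fix v assume v: "v \<in> ?H"
          have "desc w (n - m) = (\<Union>u\<in>desc w (k - m). desc u (n - k))"
            using desc_add[of w "k - m" "n - k"] k by simp
          then obtain u where u: "u \<in> desc w (k - m)" "v \<in> desc u (n - k)" using v by (auto simp: W_def)
          then have "cyl n v \<subseteq> cyl k u" using cyl_desc_subset[of v u "n - k" k] k by simp
          then show "v \<in> (\<Union>u\<in>?K. V \<inter> desc u (n - k))" using u v by (auto simp: W_def)
        qed
        then have "card ?H \<le> card (\<Union>u\<in>?K. V \<inter> desc u (n - k))" by (intro card_mono) auto
        also have "\<dots> \<le> (\<Sum>u\<in>?K. card (V \<inter> desc u (n - k)))" by (rule card_UN_le) simp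
        finally have "real (card ?H) \<le> real (\<Sum>u\<in>?K. card (V \<inter> desc u (n - k)))"
          by (simp only: of_nat_le_iff)
        also have "\<dots> = (\<Sum>u\<in>?K. real (card (V \<inter> desc u (n - k))))" by (rule of_nat_sum)
        also have "\<dots> \<le> (\<Sum>u\<in>?K. C * real p powr (- real (k - m) * d) * real (card W))"
          using k unfolding W_def by (intro sum_mono spread) auto
        also have "\<dots> \<le> 2 * (C * real p powr (- real (k - m) * d) * real (card W))"
          using K2 C by (simp only: sum_constant) (intro mult_right_mono, auto)
        finally have H: "real (card ?H) \<le> 2 * (C * real p powr (- real (k - m) * d) * real (card W))" .
        have "real p powr (- real (k - m)) \<le> real p * (real p ^ m * \<rho> i)"
        proof -
          have "real p ^ k = real p powr real (k - m) * real p ^ m" using k by (simp add: powr_realpow power_add[symmetric] del: of_nat_diff)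
          then have "1 \<le> real p powr real (k - m) * (real p * (real p ^ m * \<rho> i))" using l1 k by (simp add: mult_ac not_less)
          then have "real p powr (- real (k - m)) * 1 \<le> real p powr (- real (k - m)) * (real p powr real (k - m) * (real p * (real p ^ m * \<rho> i)))"
            by (intro mult_left_mono) auto
          also have "\<dots> = (real p powr (- real (k - m)) * real p powr real (k - m)) * (real p * (real p ^ m * \<rho> i))"
            by (simp only: mult.assoc)
          also have "real p powr (- real (k - m)) * real p powr real (k - m) = 1"
            using p_ge by (simp add: powr_add[symmetric] del: of_nat_diff)
          finally show ?thesis by simp
        qed
        then have "(real p powr (- real (k - m))) powr d \<le> (real p * (real p ^ m * \<rho> i)) powr d"
          using d by (intro powr_mono2) auto
        also have "\<dots> = real p powr d * (real p ^ m * \<rho> i) powr d"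
          using \<rho>(1)[of i] by (subst powr_mult) (auto simp: less_imp_le)
        also have "\<dots> \<le> real p * (real p ^ m * \<rho> i) powr d"
          using d p_ge powr_mono[of d 1 "real p"] by (intro mult_right_mono) auto
        finally have "real p powr (- real (k - m) * d) \<le> real p * (real p ^ m * \<rho> i) powr d"
          by (simp add: powr_powr del: of_nat_diff)
        then have "2 * (C * real p powr (- real (k - m) * d) * real (card W))
            \<le> 2 * (C * (real p * (real p ^ m * \<rho> i) powr d) * real (card W))"
          using C by (intro mult_left_mono mult_right_mono) auto
        then have "real (card ?H) * 1 \<le> real (card W) * (C' * (real p ^ m * \<rho> i) powr d)"
          using H by (simp add: C'_def mult_ac)
        moreover have "real (card ?H) * c n i \<le> real (card ?H) * 1"
          by (intro mult_left_mono) (auto simp: c_def)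
        ultimately show ?thesis by linarith
      qed
      finally show ?thesis by (simp add: tmc)
    qed
    have "\<exists>v\<in>W. cost n v < 1"
    proof (rule ccontr)
      assume "\<not> (\<exists>v\<in>W. cost n v < 1)"
      then have "(\<Sum>v\<in>W. 1) \<le> (\<Sum>v\<in>W. cost n v)" by (intro sum_mono) (auto simp: not_less)
      also have "\<dots> = (\<Sum>i. \<Sum>v\<in>W. ennreal (t n v i))"
        unfolding cost_def by (rule suminf_sum[symmetric]) auto
      also have "\<dots> \<le> (\<Sum>i. ennreal (real (card W)) * ennreal (t m w i))"
        using each t0 by (intro suminf_le) (auto simp: sum_ennreal ennreal_mult[symmetric] intro!: ennreal_leI)
      also have "\<dots> = ennreal (real (card W)) * cost m w" by (simp add: cost_def)
      also have "\<dots> < ennreal (real (card W)) * 1"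
        using w(2) W0 by (intro ennreal_mult_strict_left_mono) auto
      finally show False by (simp add: ennreal_of_nat_eq_real_of_nat)
    qed
    then show ?thesis using nm P by (auto simp: W_def)
  qed
  have "\<exists>f. \<forall>i. (snd (f i) \<in> desc 0 (fst (f i)) \<and> cost (fst (f i)) (snd (f i)) < 1) \<and>
      (fst (f (Suc i)) > fst (f i) \<and> snd (f (Suc i)) \<in> desc (snd (f i)) (fst (f (Suc i)) - fst (f i)) \<and>
       (\<forall>x\<in>cyl (fst (f (Suc i))) (snd (f (Suc i))). P i x))"
  proof (rule dependent_nat_choice)
    show "\<exists>x. snd x \<in> desc 0 (fst x) \<and> cost (fst x) (snd x) < 1"
      using start by (intro exI[of _ "(0, 0)"]) simp
  next
    fix x :: "nat \<times> nat" and i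
    assume x: "snd x \<in> desc 0 (fst x) \<and> cost (fst x) (snd x) < 1"
    then obtain n v where nv: "n > fst x" "v \<in> desc (snd x) (n - fst x)" "cost n v < 1" "\<forall>x\<in>cyl n v. P i x"
      using step[of "snd x" "fst x" i] by blast
    have "v \<in> desc 0 (fst x + (n - fst x))" using x nv by (intro desc_trans) auto
    then show "\<exists>y. (snd y \<in> desc 0 (fst y) \<and> cost (fst y) (snd y) < 1) \<and>
       (fst x < fst y \<and> snd y \<in> desc (snd x) (fst y - fst x) \<and> (\<forall>x\<in>cyl (fst y) (snd y). P i x))"
      using nv by (intro exI[of _ "(n, v)"]) simp
  qed
  then obtain f where f: "\<And>i. (snd (f i) \<in> desc 0 (fst (f i)) \<and> cost (fst (f i)) (snd (f i)) < 1) \<and>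
      (fst (f (Suc i)) > fst (f i) \<and> snd (f (Suc i)) \<in> desc (snd (f i)) (fst (f (Suc i)) - fst (f i)) \<and>
       (\<forall>x\<in>cyl (fst (f (Suc i))) (snd (f (Suc i))). P i x))" by blast
  then obtain M w where M: "\<And>i. M i < M (Suc i)" and w: "\<And>i. w i \<in> desc 0 (M i)" "\<And>i. cost (M i) (w i) < 1"
    "\<And>i. w (Suc i) \<in> desc (w i) (M (Suc i) - M i)" "\<And>i x. x \<in> cyl (M (Suc i)) (w (Suc i)) \<Longrightarrow> P i x"
    using that[of "\<lambda>i. fst (f i)" "\<lambda>i. snd (f i)"] by blast
  define I where "I i = cyl (M i) (w i)" for i
  have "I (Suc i) \<subseteq> I i" for i
    using cyl_desc_subset[OF w(3)[of i], of "M i"] M[of i] by (simp add: I_def)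
  then have "I j \<subseteq> I i" if "i \<le> j" for i j by (rule lift_Suc_antimono_le[OF _ that])
  then have "\<Inter> (range I) \<noteq> {}" by (intro compact_nest) (auto simp: I_def)
  then obtain x where x: "\<And>i. x \<in> I i" by blast
  have Mi: "i \<le> M i" for i
  proof (induction i)
    case (Suc i) then show ?case using M[of i] by linarith
  qed simp
  have "x \<in> cantor"
    unfolding cantor_def
  proof
    fix n
    have "w n \<in> desc 0 (n + (M n - n))" using w(1)[of n] Mi[of n] by simp
    then obtain u where u: "u \<in> desc 0 n" "w n \<in> desc u (M n - n)" unfolding desc_add by blast
    then have "cyl (M n) (w n) \<subseteq> cyl n u" using cyl_desc_subset[of "w n" u "M n - n" n] Mi[of n] by simp
    then show "x \<in> (\<Union>u\<in>desc 0 n. cyl n u)" using u x[of n] by (auto simp: I_def)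
  qed
  moreover have "P N x" for N using w(4)[of x N] x[of "Suc N"] by (simp add: I_def)
  ultimately obtain i where i: "x \<in> U i" using U(1) by auto
  \<comment> \<open>\<open>U i\<close> contains \<open>x\<close> and so meets every cylinder of the
    branch. All their costs are below 1, so \<open>U i\<close> would have size below every scale,
    against \<open>\<rho> i > 0\<close>.\<close>
  have "real p ^ n * \<rho> i < 1" for n
  proof -
    have "real p ^ n * \<rho> i \<le> real p ^ M n * \<rho> i"
      using p_ge \<rho>(1)[of i] Mi by (intro mult_right_mono power_increasing) auto
    also have "\<dots> < 1" using i x[of n] by (intro small[OF w(2)]) (auto simp: I_def)
    finally show ?thesis .
  qed
  moreover obtain n where "1 / \<rho> i < real p ^ n" using real_arch_pow[of "real p" "1 / \<rho> i"] p_ge by auto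
  then have "1 < real p ^ n * \<rho> i" using \<rho>(1)[of i] by (simp add: field_simps)
  ultimately show False by (meson order.asym)
qed

end

section \<open>Well-approximable numbers in the Cantor set\<close>

lemma dist_nearest_int_le_iff: "dist_nearest_int x \<le> \<delta> \<longleftrightarrow> near_int x \<delta>"
proof
  have "closed (\<int> :: real set)" "(\<int> :: real set) \<noteq> {}" by (auto simp: closed_Ints)
  then obtain z where z: "z \<in> \<int>" "infdist x \<int> = dist x z" by (rule infdist_attains_inf)
  assume "dist_nearest_int x \<le> \<delta>"
  then show "near_int x \<delta>" using z by (auto simp: dist_nearest_int_def near_int_def dist_real_def elim!: Ints_cases)
next
  assume "near_int x \<delta>"
  then obtain a :: int where a: "\<bar>x - of_int a\<bar> \<le> \<delta>" by (auto simp: near_int_def)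
  have "infdist x \<int> \<le> dist x (of_int a)" by (rule infdist_le) simp
  then show "dist_nearest_int x \<le> \<delta>" using a by (simp add: dist_nearest_int_def dist_real_def)
qed

lemma hausdorff_dim_le:
  assumes "\<And>d. d > a \<Longrightarrow> d > 0 \<Longrightarrow> hausdorff_measure d A = 0" "a > 0"
  shows "hausdorff_dim A \<le> ereal a"
proof (rule ccontr)
  assume "\<not> hausdorff_dim A \<le> ereal a"
  then obtain d where d: "ereal a < ereal d" "ereal d < hausdorff_dim A"
    using ereal_dense2[of "ereal a" "hausdorff_dim A"] by (auto simp: not_le)
  then have "hausdorff_dim A \<le> ereal d"
    unfolding hausdorff_dim_def using assms by (intro Inf_lower) auto
  then show False using d by simp
qed

lemma hausdorff_dim_ge:
  assumes "\<And>d. 0 < d \<Longrightarrow> d < a \<Longrightarrow> hausdorff_measure d A \<noteq> 0"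
  shows "ereal a \<le> hausdorff_dim A"
  unfolding hausdorff_dim_def using assms by (intro Inf_greatest) (force simp: not_less)

context flat_digits
begin

definition dimn :: real where "dimn = log (real p) (real b)"

lemma b_power: "real b ^ n = real p powr (dimn * real n)"
proof -
  have "real b = real p powr dimn" using p_ge b_ge by (simp add: dimn_def)
  then have "real b ^ n = (real p powr dimn) powr real n" using b_ge by (simp add: powr_realpow)
  then show ?thesis by (simp add: powr_powr)
qed

lemma dimn_le_1: "dimn \<le> 1"
proof -
  have "b \<le> card {0..<p}" unfolding b_def by (intro card_mono D_sub) auto
  then have "log (real p) (real b) \<le> log (real p) (real p)" using p_ge b_ge by (subst log_le_cancel_iff) auto
  then show ?thesis using p_ge by (simp add: dimn_def)
qed

lemma dimn_ge: "9 / 10 \<le> dimn"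
  unfolding dimn_def using b_large p_ge b_ge by (subst le_log_iff) auto

lemma eventually_le_powr:
  assumes "e > 0"
  shows "\<forall>\<^sub>F n in sequentially. A \<le> real p powr (real n * e)"
proof -
  have gt: "1 < real p powr e" using powr_less_mono[OF assms, of "real p"] p_ge by simp
  then obtain N where N: "A < (real p powr e) ^ N" using real_arch_pow by blast
  have "A \<le> real p powr (real n * e)" if "n \<ge> N" for n
  proof -
    have "(real p powr e) ^ N \<le> (real p powr e) ^ n" using that gt by (intro power_increasing) auto
    then show ?thesis using N by (simp add: powr_realpow[symmetric] powr_powr mult.commute)
  qed
  then show ?thesis by (auto simp: eventually_sequentially)
qed

section \<open>Covering the well-approximable points\<close>

lemma hausdorff_measure_well_approximable_zero:
  fixes c d :: real
  assumes c: "0 < c" "c \<le> 1 / 10" and d: "dimn - c / (2 + c) < d" "d > 0"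
  shows "hausdorff_measure d (well_approximable (\<lambda>q. real q powr (- 1 - c)) \<inter> cantor) = 0"
proof -
  define \<tau> where "\<tau> = 1 / (2 + c)"
  have \<tau>: "10 / 21 \<le> \<tau>" "\<tau> \<le> 1 / 2" "\<tau> * (2 + c) = 1" using c by (auto simp: \<tau>_def field_simps)
  have \<tau>\<gamma>: "2 * \<tau> - 1 = - (c / (2 + c))" using c by (simp add: \<tau>_def field_simps)
  obtain C where C: "C > 0" and up: "\<And>w m j R H. H \<ge> 1 \<Longrightarrow> 6 * H * R \<le> p ^ (m + j) \<Longrightarrow>
     (\<Sum>r=1..R. real (card {v \<in> desc w j. near_int (real r * real v / real p ^ (m + j)) (real r * real H / real p ^ (m + j))}) / real r)
      \<le> C * real b ^ j * (real H / real p ^ (m + j)) * (real R + err m (m + j))"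
    by (rule count_near_upper) (rule that)
  let ?near = "\<lambda>n q. {u \<in> desc 0 n. near_int (real q * real u / real p ^ n) (real q * real (2 * p) / real p ^ n)}"
  \<comment> \<open>A denominator \<open>q\<close> is assigned the level at which a cylinder is as
    long as the approximation interval, up to a factor \<open>p\<close>. The radius
    \<open>2 * p\<close> covers that interval and the distance from a point of a cylinder to its
    left end.\<close>
  define A where "A n = (\<Union>q\<in>{q. q \<ge> 1 \<and> real q powr (2 + c) \<le> real p ^ n \<and> real p ^ n < real p * real q powr (2 + c)}. ?near n q)" for n
  have fin: "finite (A n)" for n
    by (rule finite_subset[of _ "desc 0 n"]) (auto simp: A_def)
  \<comment> \<open>Denominators of level \<open>n\<close> are at most \<open>x\<close>, and the
    count is of order \<open>x ^ 2 * b ^ n / p ^ n\<close>, the Fourier error being at most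
    \<open>x\<close>. The bound \<open>n \<ge> 10\<close> gives
    \<open>12 * p * R \<le> p ^ n\<close>, via \<open>12 \<le> p ^ 4\<close> and
    \<open>R \<le> p powr (n / 2)\<close>.\<close>
  have card: "real (card (A n)) \<le> (4 * C * real p) * real p powr (real n * (dimn - c / (2 + c)))" if n: "n \<ge> 10" for n
  proof -
    define x where "x = real p powr (real n * \<tau>)"
    have xc: "x powr (2 + c) = real p ^ n" using \<tau>(3) by (simp add: x_def powr_powr mult.assoc powr_realpow)
    have x1: "x \<ge> 1" using p_ge \<tau> by (auto simp: x_def ge_one_powr_ge_zero)
    define R where "R = nat \<lfloor>x\<rfloor>"
    have R: "real R \<le> x" using x1 by (simp add: R_def)
    have "A n \<subseteq> (\<Union>q\<in>{1..R}. ?near n q)"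
    proof -
      have "q \<le> R" if "real q powr (2 + c) \<le> real p ^ n" for q
      proof -
        have "(real q powr (2 + c)) powr \<tau> \<le> (x powr (2 + c)) powr \<tau>"
          using that \<tau> unfolding xc by (intro powr_mono2) auto
        then have "real q \<le> x" using \<tau>(3) x1 by (simp add: powr_powr mult.commute)
        then show ?thesis unfolding R_def by linarith
      qed
      then show ?thesis by (force simp: A_def)
    qed
    then have "card (A n) \<le> card (\<Union>q\<in>{1..R}. ?near n q)" by (intro card_mono) auto
    also have "\<dots> \<le> (\<Sum>q\<in>{1..R}. card (?near n q))" by (rule card_UN_le) simp
    finally have "real (card (A n)) \<le> real (\<Sum>q\<in>{1..R}. card (?near n q))" by (simp only: of_nat_le_iff)
    also have "\<dots> = (\<Sum>q=1..R. real (card (?near n q)))" by (rule of_nat_sum)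
    also have "\<dots> \<le> (\<Sum>q=1..R. real R * (real (card (?near n q)) / real q))"
    proof (rule sum_mono)
      fix q assume q: "q \<in> {1..R}"
      have "1 * real (card (?near n q)) \<le> (real R / real q) * real (card (?near n q))"
        using q by (intro mult_right_mono) (auto simp: field_simps)
      then show "real (card (?near n q)) \<le> real R * (real (card (?near n q)) / real q)" by simp
    qed
    also have "\<dots> = real R * (\<Sum>q=1..R. real (card (?near n q)) / real q)" by (simp only: sum_distrib_left)
    also have "\<dots> \<le> real R * (C * real b ^ n * (real (2 * p) / real p ^ n) * (real R + err 0 n))"
    proof (rule mult_left_mono)
      have "real (6 * (2 * p) * R) \<le> real (p ^ n)"
      proof -
        have "real (6 * (2 * p) * R) \<le> 12 * real p * x" using R by simp
        also have "\<dots> \<le> 2 ^ 4 * real p * x" using x1 by (intro mult_right_mono) auto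
        also have "\<dots> \<le> real p ^ 4 * real p * x" using x1 p_ge by (intro mult_right_mono power_mono) auto
        also have "\<dots> = real p ^ 5 * x" by (simp add: eval_nat_numeral)
        also have "\<dots> = real p powr (5 + real n * \<tau>)" by (simp add: x_def powr_add)
        also have "\<dots> \<le> real p powr (real n)"
        proof (rule powr_mono)
          have "real n * \<tau> \<le> real n * (1 / 2)" using \<tau> by (intro mult_left_mono) auto
          then show "5 + real n * \<tau> \<le> real n" using n by linarith
        qed (use p_ge in auto)
        finally show ?thesis by (simp add: powr_realpow)
      qed
      then have "6 * (2 * p) * R \<le> p ^ (0 + n)" by (simp only: of_nat_le_iff add_0)
      then show "(\<Sum>q=1..R. real (card (?near n q)) / real q) \<le> C * real b ^ n * (real (2 * p) / real p ^ n) * (real R + err 0 n)"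
        using up[of "2 * p" R 0 n 0] p_ge by simp
    qed simp
    also have "\<dots> \<le> x * (C * real b ^ n * (real (2 * p) / real p ^ n) * (x + x))"
    proof -
      have "err 0 n \<le> x" unfolding err_def x_def
      proof (rule powr_mono)
        have "real n * (1 / 10) \<le> real n * \<tau>" using \<tau> by (intro mult_left_mono) auto
        then show "real n / 10 + real 0 \<le> real n * \<tau>" by simp
      qed (use p_ge in auto)
      then show ?thesis using R C x1 by (intro mult_mono add_mono mult_nonneg_nonneg) auto
    qed
    also have "\<dots> = (4 * C * real p) * (x * x * real b ^ n / real p ^ n)" by simp
    also have "x * x * real b ^ n / real p ^ n = real p powr (real n * \<tau> + real n * \<tau> + dimn * real n - real n)"
      by (simp only: x_def b_power powr_add powr_diff powr_realpow of_nat_0_less_iff p_pos)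
    also have "real n * \<tau> + real n * \<tau> + dimn * real n - real n = real n * (dimn + (2 * \<tau> - 1))"
      by (simp add: algebra_simps)
    finally show ?thesis unfolding \<tau>\<gamma> by simp
  qed
  show ?thesis
  proof (rule hausdorff_measure_limsup_cyl[OF fin card d])
    show "well_approximable (\<lambda>q. real q powr (- 1 - c)) \<inter> cantor \<subseteq> {x. \<exists>\<^sub>\<infinity>n. x \<in> (\<Union>u\<in>A n. cyl n u)}"
    proof
      fix x assume x: "x \<in> well_approximable (\<lambda>q. real q powr (- 1 - c)) \<inter> cantor"
      show "x \<in> {x. \<exists>\<^sub>\<infinity>n. x \<in> (\<Union>u\<in>A n. cyl n u)}"
        unfolding mem_Collect_eq INFM_nat_le
      proof
        fix N
        have "\<exists>\<^sub>\<infinity>q. near_int (real q * x) (real q powr (- 1 - c))"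
          using x by (simp add: well_approximable_def dist_nearest_int_le_iff)
        then obtain q where q: "q \<ge> p ^ N + 1" and "near_int (real q * x) (real q powr (- 1 - c))"
          unfolding INFM_nat_le by blast
        then obtain a :: int where a: "\<bar>real q * x - of_int a\<bar> \<le> real q powr (- 1 - c)" by (auto simp: near_int_def)
        have q1: "q \<ge> 1" using q by simp
        define z where "z = real q powr (2 + c)"
        have qz: "real q \<le> z" using powr_mono[of 1 "2 + c" "real q"] q1 c by (simp add: z_def)
        define n where "n = nat \<lceil>log (real p) z\<rceil>"
        have z1: "z \<ge> 1" using qz q1 by linarith
        have l0: "log (real p) z \<ge> 0" using z1 p_ge by simp
        have nl: "log (real p) z \<le> real n" "real n < log (real p) z + 1" using l0 unfolding n_def by linarith+
        have zp: "real p powr (log (real p) z) = z" using z1 p_ge by simp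
        have zn: "z \<le> real p ^ n" using powr_mono[OF nl(1), of "real p"] p_ge zp by (simp add: powr_realpow)
        have "real p powr (real n) < real p powr (log (real p) z + 1)" using nl(2) p_ge by (intro powr_less_mono) auto
        then have nz: "real p ^ n < real p * z" using p_ge zp by (simp add: powr_realpow powr_add mult.commute)
        have nN: "n \<ge> N"
        proof -
          have "real p ^ N < real q" using q by (metis Suc_eq_plus1 Suc_le_eq of_nat_less_iff of_nat_power)
          also have "\<dots> \<le> real p ^ n" using qz zn by linarith
          finally have "N < n" using p_ge by (subst (asm) power_strict_increasing_iff) auto
          then show ?thesis by simp
        qed
        obtain u where u: "u \<in> desc 0 n" "x \<in> cyl n u" using x by (auto simp: cantor_def)
        have xu: "\<bar>real u / real p ^ n - x\<bar> \<le> 1 / real p ^ n"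
          using u(2) by (auto simp: cyl_def add_divide_distrib)
        have "\<bar>real q * real u / real p ^ n - of_int a\<bar>
           = \<bar>real q * (real u / real p ^ n - x) + (real q * x - of_int a)\<bar>" by (simp add: algebra_simps)
        also have "\<dots> \<le> real q * (1 / real p ^ n) + real q powr (- 1 - c)"
          using mult_left_mono[OF xu, of "real q"] a by (intro order.trans[OF abs_triangle_ineq] add_mono) (auto simp: abs_mult)
        also have "real q powr (- 1 - c) = real q / z"
        proof -
          have "real q powr (- 1 - c) = real q powr (1 - (2 + c))" by simp
          then show ?thesis using q1 unfolding powr_diff z_def by simp
        qed
        also have "real q * (1 / real p ^ n) + real q / z \<le> real q * real (2 * p) / real p ^ n"
        proof -
          have "1 / z \<le> real p / real p ^ n" using nz z1 by (simp add: field_simps)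
          moreover have "1 / real p ^ n \<le> real p / real p ^ n" using p_ge by (simp add: divide_right_mono)
          ultimately have "real q * (1 / real p ^ n + 1 / z) \<le> real q * (real p / real p ^ n + real p / real p ^ n)"
            by (intro mult_left_mono) auto
          then show ?thesis by (simp add: algebra_simps add_divide_distrib[symmetric])
        qed
        finally have "near_int (real q * real u / real p ^ n) (real q * real (2 * p) / real p ^ n)"
          unfolding near_int_def by blast
        then have "u \<in> A n" using u q1 zn nz unfolding A_def z_def by blast
        then show "\<exists>n\<ge>N. x \<in> (\<Union>u\<in>A n. cyl n u)" using nN u by blast
      qed
    qed
  qed
qed

section \<open>Building a large set of well-approximable points\<close>

text \<open>Distinct rationals with denominators at most \<open>R\<close> are further apart than \<open>1 / R\<^sup>2\<close>.\<close>

lemma card_good_fine: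
  assumes R: "R \<ge> 1" "2 * R\<^sup>2 \<le> p ^ l" "8 * R\<^sup>2 \<le> p ^ (l + k)"
  shows "card (good (l + k) R \<inter> desc u k) \<le> 7"
proof (cases "good (l + k) R \<inter> desc u k = {}")
  case False
  let ?n = "l + k"
  have pn: "real p ^ ?n > 0" by simp
  obtain v0 where v0: "v0 \<in> good ?n R" "v0 \<in> desc u k" using False by blast
  then obtain q0 a0 where q0: "q0 \<in> {R div 2<..R}" and a0: "\<bar>real q0 * (real v0 / real p ^ ?n) - of_int a0\<bar> \<le> real R / real p ^ ?n"
    by (auto simp: good_def hits_def near_int_def)
  \<comment> \<open>A hit places \<open>v\<close> within 2 of \<open>p ^ n\<close> times the
    fraction. The good words below \<open>u\<close> share one fraction, so they differ by less than
    4, which leaves seven integers.\<close>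
  have close: "\<bar>real v - of_int a / real q * real p ^ ?n\<bar> < 2"
    if q: "q \<in> {R div 2<..R}" and a: "\<bar>real q * (real v / real p ^ ?n) - of_int a\<bar> \<le> real R / real p ^ ?n" for q v :: nat and a :: int
  proof -
    have q0: "real q > 0" "real R < 2 * real q" using q by auto
    have "real q * \<bar>real v - of_int a / real q * real p ^ ?n\<bar> = real p ^ ?n * \<bar>real q * (real v / real p ^ ?n) - of_int a\<bar>"
    proof -
      have "real q * \<bar>real v - of_int a / real q * real p ^ ?n\<bar> = \<bar>real q * (real v - of_int a / real q * real p ^ ?n)\<bar>"
        using q0 by (simp only: abs_mult abs_of_nat)
      also have "real q * (real v - of_int a / real q * real p ^ ?n) = real p ^ ?n * (real q * (real v / real p ^ ?n) - of_int a)"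
        using q0 pn by (simp add: field_simps)
      finally show ?thesis by (simp add: abs_mult)
    qed
    also have "\<dots> \<le> real p ^ ?n * (real R / real p ^ ?n)" by (intro mult_left_mono a) auto
    also have "\<dots> < real q * 2" using q0 by simp
    finally show ?thesis using q0 by (simp only: mult_less_cancel_left_pos)
  qed
  have "good ?n R \<inter> desc u k \<subseteq> {v0 - 3..v0 + 3}"
  proof
    fix v assume v: "v \<in> good ?n R \<inter> desc u k"
    then obtain q a where q: "q \<in> {R div 2<..R}" and a: "\<bar>real q * (real v / real p ^ ?n) - of_int a\<bar> \<le> real R / real p ^ ?n"
      by (auto simp: good_def hits_def near_int_def)
    have "a * int q0 = a0 * int q"
    proof (rule hits_same_fraction[OF _ q q0 a a0])
      show "4 * R\<^sup>2 \<le> p ^ ?n" using R(3) by simp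
      have "\<bar>int v - int v0\<bar> < int (p ^ k)"
      proof -
        have "u * p ^ k \<le> v" "v < (u + 1) * p ^ k" "u * p ^ k \<le> v0" "v0 < (u + 1) * p ^ k"
          using desc_bounds[of v u k] desc_bounds[OF v0(2)] v by auto
        then show ?thesis unfolding ring_distribs by linarith
      qed
      then have "\<bar>real v - real v0\<bar> < real (p ^ k)" by linarith
      moreover have "\<bar>real v / real p ^ ?n - real v0 / real p ^ ?n\<bar> = \<bar>real v - real v0\<bar> / real p ^ ?n"
        by (simp add: diff_divide_distrib[symmetric])
      ultimately have "\<bar>real v / real p ^ ?n - real v0 / real p ^ ?n\<bar> < real (p ^ k) / real p ^ ?n"
        by (simp add: divide_strict_right_mono)
      then have lt: "\<bar>real v / real p ^ ?n - real v0 / real p ^ ?n\<bar> < 1 / real p ^ l"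
        by (simp add: power_add)
      have "real (2 * R\<^sup>2) \<le> real (p ^ l)" using R(2) by (simp only: of_nat_le_iff)
      then have "2 * (real R)\<^sup>2 * \<bar>real v / real p ^ ?n - real v0 / real p ^ ?n\<bar>
          \<le> real p ^ l * \<bar>real v / real p ^ ?n - real v0 / real p ^ ?n\<bar>" by (intro mult_right_mono) auto
      also have "\<dots> < real p ^ l * (1 / real p ^ l)" using lt by (intro mult_strict_left_mono) auto
      finally show "2 * (real R)\<^sup>2 * \<bar>real v / real p ^ ?n - real v0 / real p ^ ?n\<bar> < 1" by simp
    qed (use R in auto)
    then have "of_int a * real q0 = of_int a0 * real q" by (metis of_int_mult of_int_of_nat_eq)
    then have eq: "of_int a / real q = of_int a0 / real q0" using q q0 by (simp add: field_simps)
    have "\<bar>real v - real v0\<bar> < 4" using close[OF q a] close[OF q0 a0] unfolding eq by linarith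
    then show "v \<in> {v0 - 3..v0 + 3}" by auto
  qed
  then have "card (good ?n R \<inter> desc u k) \<le> card {v0 - 3..v0 + 3}" by (intro card_mono) auto
  then show ?thesis by simp
qed simp

lemma card_good_coarse:
  assumes "R \<ge> 1" "2 * R\<^sup>2 \<le> p ^ (l + i)" "8 * R\<^sup>2 \<le> p ^ (l + i + k)"
  shows "card (good (l + i + k) R \<inter> desc u (i + k)) \<le> 7 * b ^ i"
proof -
  have "good (l + i + k) R \<inter> desc u (i + k) = (\<Union>v\<in>desc u i. good (l + i + k) R \<inter> desc v k)"
    unfolding desc_add by blast
  then have "card (good (l + i + k) R \<inter> desc u (i + k)) \<le> (\<Sum>v\<in>desc u i. card (good (l + i + k) R \<inter> desc v k))"
    by (simp only: card_UN_le finite_desc)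
  also have "\<dots> \<le> (\<Sum>v\<in>desc u i. 7)" by (intro sum_mono card_good_fine assms)
  finally show ?thesis by (simp add: card_desc mult.commute)
qed

text \<open>The tree uses \<open>good n R\<close> with \<open>n\<close> very large compared with
  \<open>m\<close>. Spread is checked in three ranges of \<open>l\<close>: up to
  \<open>n / 5\<close> by two Fourier counts; from there to the level \<open>l1\<close> where
  \<open>p ^ l1\<close> reaches \<open>2 * R ^ 2\<close>, by 7 good words per subcylinder of level
  \<open>l1\<close>; beyond \<open>l1\<close>, by 7 good words altogether.\<close>

lemma hausdorff_measure_well_approximable_nonzero:
  fixes c d :: real
  assumes c: "0 < c" "c \<le> 1 / 10" and d: "0 < d" "d < dimn - c / (2 + c)"
  shows "hausdorff_measure d (well_approximable (\<lambda>q. real q powr (- 1 - c)) \<inter> cantor) \<noteq> 0"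
proof -
  define \<tau> where "\<tau> = 1 / (2 + c)"
  define \<gamma> where "\<gamma> = c / (2 + c)"
  have \<tau>: "10 / 21 \<le> \<tau>" "\<tau> \<le> 1 / 2" "\<tau> * (2 + c) = 1" using c by (auto simp: \<tau>_def field_simps)
  have \<gamma>: "0 < \<gamma>" "2 * \<tau> = 1 - \<gamma>" using c by (auto simp: \<gamma>_def \<tau>_def field_simps)
  have dg: "0 < dimn - \<gamma> - d" using d by (simp add: \<gamma>_def)
  have pp: "real p \<ge> 1" using p_ge by simp
  obtain c1 C2 K where c1: "c1 > 0" and C2: "C2 > 0" and K: "K > 0"
    and count: "\<And>w m j R. R \<ge> 1 \<Longrightarrow> 12 * R \<le> p ^ (m + j) \<Longrightarrow> 4 * R\<^sup>2 \<le> p ^ (m + j) \<Longrightarrow> K * err m (m + j) \<le> real R \<Longrightarrow>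
     c1 * real b ^ j * ((real R)\<^sup>2 / real p ^ (m + j)) \<le> real (card (good (m + j) R \<inter> desc w j)) \<and>
     real (card (good (m + j) R \<inter> desc w j)) \<le> C2 * real b ^ j * ((real R)\<^sup>2 / real p ^ (m + j))"
    by (rule count_good) (rule that)
  define P where "P N x = (\<exists>q\<ge>N. near_int (real q * x) (real q powr (- 1 - c)))" for N :: nat and x :: real
  define C where "C = max 1 (C2 / c1)"
  have "hausdorff_measure d {x \<in> cantor. \<forall>N. P N x} \<noteq> 0"
  proof (rule hausdorff_measure_tree[where C = C])
    show "0 < d" "d \<le> 1" using d dimn_le_1 c \<gamma> unfolding \<gamma>_def[symmetric] by auto
    show "1 \<le> C" by (simp add: C_def)
    fix m N :: nat
    \<comment> \<open>In this order: all denominators exceed \<open>N\<close>;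
      \<open>12 * R \<le> p ^ n\<close>; \<open>8 * R ^ 2 \<le> p ^ n\<close>; the Fourier error
      stays below \<open>R\<close>; constants are absorbed for the growth condition and for levels
      from \<open>l1\<close> on; constants are absorbed at the intermediate levels; level
      \<open>m\<close> lies in the Fourier range.\<close>
    have ev: "\<forall>\<^sub>F n in sequentially. 4 * (2 * real N + 2) \<le> real p powr (real n * \<tau>)
      \<and> 12 \<le> real p powr (real n * (1 / 2)) \<and> 8 \<le> real p powr (real n * \<gamma>)
      \<and> 4 * K \<le> real p powr (real n * (1 / 10))
      \<and> 112 / c1 * real p powr (real m * dimn) \<le> real p powr (real n * (dimn - \<gamma> - d))
      \<and> 224 * real p / c1 * real p powr (real m * dimn) \<le> real p powr (real n * (\<gamma> / 10))
      \<and> 5 * m + 1 \<le> n"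
      using \<tau> \<gamma> dg by (intro eventually_conj eventually_le_powr eventually_ge_at_top) auto
    obtain n where n: "4 * (2 * real N + 2) \<le> real p powr (real n * \<tau>)"
      "12 \<le> real p powr (real n * (1 / 2))" "8 \<le> real p powr (real n * \<gamma>)"
      "4 * K \<le> real p powr (real n * (1 / 10))"
      "112 / c1 * real p powr (real m * dimn) \<le> real p powr (real n * (dimn - \<gamma> - d))"
      "224 * real p / c1 * real p powr (real m * dimn) \<le> real p powr (real n * (\<gamma> / 10))"
      "5 * m + 1 \<le> n"
      using eventually_happens'[OF sequentially_bot ev] by blast
    define x where "x = real p powr (real n * \<tau>)"
    \<comment> \<open>Halving \<open>p ^ n\<close> gives
      \<open>2 / p ^ n \<le> R powr (- (2 + c))\<close>. One \<open>1 / p ^ n\<close> is used by the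
      hit and one by the length of the cylinder, so that the whole cylinder is well
      approximated.\<close>
    define y where "y = (real p ^ n / 2) powr \<tau>"
    define R where "R = nat \<lfloor>y\<rfloor>"
    have pnx: "(real p ^ n) powr \<tau> = x" by (simp add: x_def powr_realpow[symmetric] powr_powr)
    have yx: "y \<le> x" unfolding y_def pnx[symmetric] using \<tau> by (intro powr_mono2) auto
    have xy: "x / 2 \<le> y"
    proof -
      have "2 powr \<tau> \<le> 2 powr 1" using \<tau> by (intro powr_mono) auto
      then have "x / 2 \<le> x / 2 powr \<tau>" by (intro divide_left_mono) (auto simp: x_def)
      then show ?thesis by (simp add: y_def powr_divide pnx)
    qed
    have y1: "y \<ge> 1" using n(1) xy by (simp add: x_def[symmetric])
    have Ry: "real R \<le> y" "y < real R + 1" using y1 by (auto simp: R_def)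
    have "x \<ge> 8" using n(1) by (simp add: x_def)
    then have Rx: "real R \<le> x" "x / 4 \<le> real R" using Ry yx xy by linarith+
    have R1: "R \<ge> 1" using n(1) Rx by (simp add: x_def[symmetric])
    have xx: "x * x = real p powr (real n * (1 - \<gamma>))"
      unfolding x_def powr_add[symmetric] \<gamma>(2)[symmetric] by (simp add: algebra_simps)
    have x2: "x * x * real p powr (real n * \<gamma>) = real p ^ n"
      unfolding xx powr_add[symmetric] by (simp add: algebra_simps powr_realpow)
    have "(real R)\<^sup>2 \<le> x * x" using Rx by (simp add: power2_eq_square mult_mono)
    then have "8 * (real R)\<^sup>2 \<le> real p powr (real n * \<gamma>) * (x * x)" using n(3) by (intro mult_mono) auto
    then have "real (8 * R\<^sup>2) \<le> real (p ^ n)" using x2 by (simp add: mult.commute)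
    then have R8: "8 * R\<^sup>2 \<le> p ^ n" by (simp only: of_nat_le_iff)
    have "12 * real R \<le> real p powr (real n * (1 / 2)) * x" using n(2) Rx by (intro mult_mono) auto
    also have "\<dots> \<le> real p powr (real n)"
      unfolding x_def powr_add[symmetric]
    proof (rule powr_mono[OF _ pp])
      have "real n * \<tau> \<le> real n * (1 / 2)" using \<tau> by (intro mult_left_mono) auto
      then show "real n * (1 / 2) + real n * \<tau> \<le> real n" by simp
    qed
    finally have "real (12 * R) \<le> real (p ^ n)" by (simp add: powr_realpow)
    then have R12: "12 * R \<le> p ^ n" by (simp only: of_nat_le_iff)
    \<comment> \<open>Exponents relative to \<open>n\<close>: 1/10 to absorb \<open>4 * K\<close>,
      1/10 from the error, and 1/5 from \<open>l\<close>. The sum 4/10 is below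
      \<open>10 / 21 \<le> \<tau>\<close>.\<close>
    have KR: "K * err l n \<le> real R" if l: "5 * l \<le> n" for l
    proof -
      have "4 * K * err l n \<le> real p powr (real n * (1 / 10)) * err l n" using n(4) by (intro mult_right_mono) auto
      also have "\<dots> \<le> x" unfolding err_def x_def powr_add[symmetric]
      proof (rule powr_mono[OF _ pp])
        have "real n * (4 / 10) \<le> real n * \<tau>" using \<tau> by (intro mult_left_mono) auto
        moreover have "5 * real l \<le> real n" using l by linarith
        ultimately show "real n * (1 / 10) + (real n / 10 + real l) \<le> real n * \<tau>" by simp
      qed
      finally show ?thesis using Rx by linarith
    qed
    have Rc: "2 / real p ^ n \<le> real R powr (- (2 + c))"
    proof -
      have "real R powr (2 + c) \<le> y powr (2 + c)" using Ry c by (intro powr_mono2) auto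
      also have "\<dots> = real p ^ n / 2" using \<tau>(3) by (simp add: y_def powr_powr)
      finally have "2 * real R powr (2 + c) \<le> real p ^ n" by simp
      moreover have "real R powr (2 + c) > 0" using R1 by simp
      ultimately show ?thesis unfolding powr_minus by (simp add: field_simps)
    qed
    have R2: "real p powr (- (real n * \<gamma>)) / 16 \<le> (real R)\<^sup>2 / real p ^ n"
    proof -
      have "(x / 4)\<^sup>2 \<le> (real R)\<^sup>2" using Rx by (intro power_mono) (auto simp: x_def)
      then have "(x / 4)\<^sup>2 / real p ^ n \<le> (real R)\<^sup>2 / real p ^ n" by (rule divide_right_mono) simp
      moreover have "(x / 4)\<^sup>2 / real p ^ n = real p powr (- (real n * \<gamma>)) / 16"
        unfolding x2[symmetric] using p_ge by (simp add: power2_eq_square powr_minus x_def field_simps)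
      ultimately show ?thesis by simp
    qed
    have nm: "m \<le> n" using n(7) by simp
    define V where "V = good n R"
    define L where "L w = real (card (V \<inter> desc w (n - m)))" for w
    have Llow: "c1 * real b ^ (n - m) * ((real R)\<^sup>2 / real p ^ n) \<le> L w" for w
      using count[of R m "n - m" w] R1 R12 R8 KR[of m] n(7) nm by (simp add: V_def L_def)
    have Llow': "c1 / 16 * real p powr (- (real m * dimn)) * real p powr (real n * (dimn - \<gamma>)) \<le> L w" for w
    proof -
      have le: "c1 * real b ^ (n - m) * (real p powr (- (real n * \<gamma>)) / 16) \<le> c1 * real b ^ (n - m) * ((real R)\<^sup>2 / real p ^ n)"
        using R2 c1 by (intro mult_left_mono) auto
      have eq: "real b ^ (n - m) * real p powr (- (real n * \<gamma>)) = real p powr (- (real m * dimn)) * real p powr (real n * (dimn - \<gamma>))"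
        unfolding b_power powr_add[symmetric] using nm
        by (intro arg_cong[of _ _ "\<lambda>x. real p powr x"]) (simp add: of_nat_diff algebra_simps)
      have "c1 / 16 * real p powr (- (real m * dimn)) * real p powr (real n * (dimn - \<gamma>))
          = c1 * real b ^ (n - m) * (real p powr (- (real n * \<gamma>)) / 16)"
        unfolding mult.assoc eq[symmetric] by simp
      also note le
      also note Llow[of w]
      finally show ?thesis .
    qed
    \<comment> \<open>Reduces a spread bound for a count \<open>7 * p powr e\<close> to a comparison
      of exponents. The constant 112 is 7 times the 16 lost by squaring
      \<open>R \<ge> x / 4\<close>.\<close>
    have key: "7 * real p powr e \<le> real p powr (- real (l - m) * d) * L w"
      if e: "112 / c1 * real p powr (real m * dimn) * real p powr e \<le> real p powr (real n * (dimn - \<gamma>) - real l * d)"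
        and l: "m \<le> l" for e l w
    proof -
      have "7 * real p powr e = c1 / 16 * real p powr (- (real m * dimn)) * (112 / c1 * real p powr (real m * dimn) * real p powr e)"
        using c1 p_ge by (simp add: powr_minus field_simps)
      also have "\<dots> \<le> c1 / 16 * real p powr (- (real m * dimn)) * real p powr (real n * (dimn - \<gamma>) - real l * d)"
        using c1 by (intro mult_left_mono e) auto
      also have "\<dots> \<le> c1 / 16 * real p powr (- (real m * dimn)) * (real p powr (real n * (dimn - \<gamma>)) * real p powr (- real (l - m) * d))"
        unfolding powr_add[symmetric] using c1 pp l d by (intro mult_left_mono powr_mono) (auto simp: of_nat_diff algebra_simps)
      also have "\<dots> = real p powr (- real (l - m) * d) * (c1 / 16 * real p powr (- (real m * dimn)) * real p powr (real n * (dimn - \<gamma>)))"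
        by (simp only: mult_ac)
      also have "\<dots> \<le> real p powr (- real (l - m) * d) * L w" by (intro mult_left_mono Llow') auto
      finally show ?thesis .
    qed
    show "\<exists>n>m. \<exists>V. (\<forall>v\<in>V. \<forall>x\<in>cyl n v. P N x) \<and>
      (\<forall>w\<in>desc 0 m. 2 * real p powr (real (n - m) * d) \<le> real (card (V \<inter> desc w (n - m))) \<and>
         (\<forall>l u. m \<le> l \<longrightarrow> l \<le> n \<longrightarrow> u \<in> desc w (l - m) \<longrightarrow>
            real (card (V \<inter> desc u (n - l))) \<le> C * real p powr (- real (l - m) * d) * real (card (V \<inter> desc w (n - m)))))"
    proof (rule exI[of _ n], rule conjI, goal_cases)
      case 1 show ?case using n(7) by simp
    next
      case 2
      show ?case
      proof (rule exI[of _ V], intro conjI ballI allI impI)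
        fix v x assume v: "v \<in> V" and x: "x \<in> cyl n v"
        obtain q a where q: "q \<in> {R div 2<..R}" and a: "\<bar>real q * (real v / real p ^ n) - of_int a\<bar> \<le> real R / real p ^ n"
          using v by (auto simp: V_def good_def hits_def near_int_def)
        have q0: "real q > 0" "real q \<le> real R" using q by auto
        have xv: "\<bar>x - real v / real p ^ n\<bar> \<le> 1 / real p ^ n"
          using x by (auto simp: cyl_def add_divide_distrib)
        have "\<bar>real q * x - of_int a\<bar> = \<bar>real q * (x - real v / real p ^ n) + (real q * (real v / real p ^ n) - of_int a)\<bar>"
          by (simp add: algebra_simps)
        also have "\<dots> \<le> real q * (1 / real p ^ n) + real R / real p ^ n"
          using mult_left_mono[OF xv, of "real q"] a by (intro order.trans[OF abs_triangle_ineq] add_mono) (auto simp: abs_mult)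
        also have "\<dots> \<le> real R * (1 / real p ^ n) + real R / real p ^ n"
          using q0 by (intro add_right_mono mult_right_mono) auto
        also have "\<dots> = real R * (2 / real p ^ n)" by simp
        also have "\<dots> \<le> real R * real R powr (- (2 + c))" by (intro mult_left_mono Rc) auto
        also have "\<dots> = real R powr (- 1 - c)" using R1 by (simp add: powr_mult_base)
        also have "\<dots> \<le> real q powr (- 1 - c)" using q0 c by (intro powr_mono2') auto
        finally have "near_int (real q * x) (real q powr (- 1 - c))" by (auto simp: near_int_def)
        moreover have "q \<ge> N"
        proof -
          have "2 * real N + 2 \<le> real R" using n(1) Rx by (simp add: x_def)
          then have "2 * N + 2 \<le> R" by linarith
          then show ?thesis using q by auto
        qed
        ultimately show "P N x" unfolding P_def by blast
      next
        fix w assume "w \<in> desc 0 m"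
        have "7 * real p powr 0 \<le> real p powr (- real (n - m) * d) * L w"
          using n(5) nm by (intro key) (auto simp: algebra_simps)
        then have "7 * (real p powr (real (n - m) * d)) \<le> (real p powr (real (n - m) * d)) * (real p powr (- real (n - m) * d) * L w)"
          using p_ge by (subst mult.commute) (intro mult_left_mono, auto)
        also have "\<dots> = L w" using p_ge by (simp add: powr_minus del: of_nat_diff)
        finally show "2 * real p powr (real (n - m) * d) \<le> real (card (V \<inter> desc w (n - m)))"
          unfolding L_def using powr_ge_zero[of "real p" "real (n - m) * d"] by linarith
      next
        fix w l u assume w: "w \<in> desc 0 m" and l: "m \<le> l" "l \<le> n" and u: "u \<in> desc w (l - m)"
        have "real (card (V \<inter> desc u (n - l))) \<le> C * (real p powr (- real (l - m) * d) * L w)"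
        proof (cases "5 * l \<le> n")
          case True
          have bb: "real b ^ (n - l) \<le> real p powr (- real (l - m) * d) * real b ^ (n - m)"
            unfolding b_power powr_add[symmetric]
          proof (rule powr_mono[OF _ pp])
            have "d * (real l - real m) \<le> dimn * (real l - real m)" using l dg \<gamma> by (intro mult_right_mono) auto
            then show "dimn * real (n - l) \<le> - real (l - m) * d + dimn * real (n - m)"
              using l nm by (simp add: of_nat_diff algebra_simps)
          qed
          have "real (card (V \<inter> desc u (n - l))) \<le> C2 * real b ^ (n - l) * ((real R)\<^sup>2 / real p ^ n)"
            using count[of R l "n - l" u] R1 R12 R8 KR[OF True] l by (simp add: V_def)
          also have "\<dots> \<le> C2 * (real p powr (- real (l - m) * d) * real b ^ (n - m)) * ((real R)\<^sup>2 / real p ^ n)"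
            using C2 by (intro mult_right_mono mult_left_mono bb) auto
          also have "C2 * (real p powr (- real (l - m) * d) * real b ^ (n - m)) * ((real R)\<^sup>2 / real p ^ n)
             = (C2 / c1) * (real p powr (- real (l - m) * d) * (c1 * real b ^ (n - m) * ((real R)\<^sup>2 / real p ^ n)))"
            using c1 by simp
          also have "\<dots> \<le> C * (real p powr (- real (l - m) * d) * L w)"
            using C2 c1 by (intro mult_mono Llow) (auto simp: C_def)
          finally show ?thesis .
        next
          case False
          \<comment> \<open>From this level on a cylinder has at most 7 good words. Minimality gives
            \<open>p ^ l1 \<le> 2 * p * R ^ 2\<close> when \<open>l1 > 0\<close>, so
            \<open>l1\<close> is about \<open>n * (1 - \<gamma>)\<close> and the subcylinders down
            to it are not too many.\<close>
          define l1 where "l1 = (LEAST l. 2 * R\<^sup>2 \<le> p ^ l)"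
          have ex: "2 * R\<^sup>2 \<le> p ^ n" using R8 by simp
          have l1: "2 * R\<^sup>2 \<le> p ^ l1" unfolding l1_def using ex by (rule LeastI)
          have l1n: "l1 \<le> n" unfolding l1_def using ex by (rule Least_le)
          have "real (card (V \<inter> desc u (n - l))) \<le> real p powr (- real (l - m) * d) * L w"
          proof (cases "l1 \<le> l")
            case True
            have "2 * R\<^sup>2 \<le> p ^ l" using l1 power_increasing[OF True, of p] p_ge by linarith
            then have "card (good (l + (n - l)) R \<inter> desc u (n - l)) \<le> 7"
              using R1 R8 l by (intro card_good_fine) auto
            then have "real (card (V \<inter> desc u (n - l))) \<le> 7 * real p powr 0" using l p_ge by (simp add: V_def)
            also have "\<dots> \<le> real p powr (- real (l - m) * d) * L w"
            proof (rule key)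
              have "112 / c1 * real p powr (real m * dimn) * real p powr 0 \<le> real p powr (real n * (dimn - \<gamma> - d))"
                using n(5) p_ge by simp
              also have "\<dots> \<le> real p powr (real n * (dimn - \<gamma>) - real l * d)"
                using l d pp by (intro powr_mono) (auto simp: algebra_simps)
              finally show "112 / c1 * real p powr (real m * dimn) * real p powr 0 \<le> real p powr (real n * (dimn - \<gamma>) - real l * d)" .
            qed (rule l)
            finally show ?thesis .
          next
            case l1l: False
            obtain k where k: "l1 = Suc k" using l1l by (cases l1) auto
            have "\<not> 2 * R\<^sup>2 \<le> p ^ k" using not_less_Least[of k "\<lambda>l. 2 * R\<^sup>2 \<le> p ^ l"] k by (auto simp: l1_def)
            then have "p ^ l1 \<le> p * (2 * R\<^sup>2)" unfolding k by simp
            then have "real (p ^ l1) \<le> real (p * (2 * R\<^sup>2))" by (simp only: of_nat_le_iff)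
            also have "\<dots> \<le> 2 * real p * (x * x)" using Rx by (simp add: power2_eq_square mult_mono)
            finally have pl1: "real p ^ l1 \<le> (2 * real p) * real p powr (real n * (1 - \<gamma>))" by (simp add: xx)
            have "real b ^ l1 = (real p ^ l1) powr dimn"
              by (simp add: b_power powr_realpow[symmetric] powr_powr mult.commute)
            also have "\<dots> \<le> ((2 * real p) * real p powr (real n * (1 - \<gamma>))) powr dimn"
              using pl1 dimn_ge by (intro powr_mono2) auto
            also have "\<dots> = (2 * real p) powr dimn * real p powr (real n * (1 - \<gamma>) * dimn)"
              by (simp add: powr_mult powr_powr)
            also have "\<dots> \<le> (2 * real p) powr 1 * real p powr (real n * (1 - \<gamma>) * dimn)"
              using dimn_le_1 p_ge by (intro mult_right_mono powr_mono) auto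
            finally have bl1: "real b ^ l1 \<le> 2 * real p * real p powr (real n * (1 - \<gamma>) * dimn)" using p_ge by simp
            define e where "e = log (real p) (2 * real p) + real n * (1 - \<gamma>) * dimn - dimn * real l"
            have pe: "real p powr e = 2 * real p * real p powr (real n * (1 - \<gamma>) * dimn) * real p powr (- (dimn * real l))"
              using p_ge by (simp add: e_def powr_diff powr_add powr_minus divide_inverse)
            have "card (good (l + (l1 - l) + (n - l1)) R \<inter> desc u ((l1 - l) + (n - l1))) \<le> 7 * b ^ (l1 - l)"
              using R1 R8 l1 l1n l1l by (intro card_good_coarse) auto
            then have "real (card (V \<inter> desc u (n - l))) \<le> real (7 * b ^ (l1 - l))"
              using l1l l1n unfolding V_def of_nat_le_iff by simp
            also have "\<dots> = 7 * (real b ^ l1 * real p powr (- (dimn * real l)))"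
            proof -
              have "real b ^ (l1 - l) = real b ^ l1 * real p powr (- (dimn * real l))"
                unfolding b_power powr_add[symmetric] using l1l by (intro arg_cong[of _ _ "\<lambda>x. real p powr x"]) (simp add: of_nat_diff algebra_simps)
              then show ?thesis by simp
            qed
            also have "\<dots> \<le> 7 * real p powr e"
              unfolding pe by (intro mult_left_mono mult_right_mono bl1) auto
            also have "\<dots> \<le> real p powr (- real (l - m) * d) * L w"
            proof (rule key)
              let ?f = "real n * (1 - \<gamma>) * dimn - dimn * real l"
              have "112 / c1 * real p powr (real m * dimn) * real p powr e
                 = (224 * real p / c1 * real p powr (real m * dimn)) * real p powr ?f"
                unfolding pe by (simp add: powr_diff powr_minus divide_inverse)
              also have "\<dots> \<le> real p powr (real n * (\<gamma> / 10)) * real p powr ?f"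
                by (intro mult_right_mono n(6)) auto
              also have "\<dots> \<le> real p powr (real n * (dimn - \<gamma>) - real l * d)"
                unfolding powr_add[symmetric]
              proof (rule powr_mono[OF _ pp])
                \<comment> \<open>After cancellation the goal is \<open>n * \<gamma> / 10 + (1 -
                  dimn) * n * \<gamma> \<le> l * (dimn - d)\<close>. The right side is at least
                  \<open>n * \<gamma> / 5\<close> as \<open>l > n / 5\<close> and
                  \<open>dimn - d > \<gamma>\<close>; the two terms on the left are at most
                  \<open>n * \<gamma> / 10\<close> each.\<close>
                have "real n / 5 * \<gamma> \<le> real l * (dimn - d)"
                  using False dg \<gamma> by (intro mult_mono) auto
                moreover have "(1 - dimn) * (real n * \<gamma>) \<le> 1 / 10 * (real n * \<gamma>)"
                  using dimn_ge \<gamma> by (intro mult_right_mono) auto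
                ultimately show "real n * (\<gamma> / 10) + ?f \<le> real n * (dimn - \<gamma>) - real l * d"
                  by (simp add: algebra_simps)
              qed
              finally show "112 / c1 * real p powr (real m * dimn) * real p powr e \<le> real p powr (real n * (dimn - \<gamma>) - real l * d)" .
            qed (rule l)
            finally show ?thesis .
          qed
          also have "\<dots> \<le> C * (real p powr (- real (l - m) * d) * L w)"
          proof -
            have "1 * (real p powr (- real (l - m) * d) * L w) \<le> C * (real p powr (- real (l - m) * d) * L w)"
              by (intro mult_right_mono) (auto simp: C_def L_def)
            then show ?thesis by simp
          qed
          finally show ?thesis .
        qed
        then show "real (card (V \<inter> desc u (n - l))) \<le> C * real p powr (- real (l - m) * d) * real (card (V \<inter> desc w (n - m)))"
          by (simp add: L_def mult.assoc)
      qed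
    qed
  qed
  moreover have "{x \<in> cantor. \<forall>N. P N x} = well_approximable (\<lambda>q. real q powr (- 1 - c)) \<inter> cantor"
    by (auto simp: P_def well_approximable_def INFM_nat_le dist_nearest_int_le_iff)
  ultimately show ?thesis by simp
qed

lemma hausdorff_dim_well_approximable:
  assumes c: "0 < c" "c \<le> 1 / 10"
  shows "hausdorff_dim (well_approximable (\<lambda>q. real q powr (- 1 - c)) \<inter> cantor) = ereal (dimn - c / (2 + c))"
proof (rule antisym)
  have "c / (2 + c) \<le> 1 / 2" using c by (simp add: field_simps)
  then have "dimn - c / (2 + c) > 0" using dimn_ge by linarith
  then show "hausdorff_dim (well_approximable (\<lambda>q. real q powr (- 1 - c)) \<inter> cantor) \<le> ereal (dimn - c / (2 + c))"
    using hausdorff_measure_well_approximable_zero[OF c] by (intro hausdorff_dim_le) auto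
qed (intro hausdorff_dim_ge hausdorff_measure_well_approximable_nonzero c)

lemma hausdorff_dim_cantor_le: "hausdorff_dim cantor \<le> ereal dimn"
proof (rule hausdorff_dim_le)
  fix d :: real assume d: "d > dimn" "d > 0"
  show "hausdorff_measure d cantor = 0"
  proof (rule hausdorff_measure_limsup_cyl[where A = "desc 0" and C = 1 and l = 0, OF _ _ d])
    show "real (card (desc 0 n)) \<le> 1 * real p powr (real n * dimn)" for n
      by (simp add: card_desc b_power mult.commute)
    show "cantor \<subseteq> {x. \<exists>\<^sub>\<infinity>n. x \<in> (\<Union>u\<in>desc 0 n. cyl n u)}"
      unfolding cantor_def INFM_nat_le by blast
  qed simp
qed (use dimn_ge in auto)

end

section \<open>The missing digits measure\<close>

context digits
begin

abbreviation dpmf :: "nat \<Rightarrow> nat measure" where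
  "dpmf \<equiv> \<lambda>_. measure_pmf (pmf_of_set D)"

definition seqs :: "(nat \<Rightarrow> nat) measure" where
  "seqs = PiM UNIV dpmf"

definition expansion :: "(nat \<Rightarrow> nat) \<Rightarrow> real" where
  "expansion a = (\<Sum>j. real (a j) / real p ^ Suc j)"

primrec word :: "nat \<Rightarrow> (nat \<Rightarrow> nat) \<Rightarrow> nat" where
  "word 0 a = 0"
| "word (Suc n) a = p * word n a + a n"

definition law :: "real measure" where
  "law = distr seqs borel expansion"

lemma law_eq: "law = missing_digits_law p D"
  by (simp add: law_def missing_digits_law_def seqs_def expansion_def[abs_def])

lemma prob_space_seqs: "prob_space seqs"
  unfolding seqs_def by (intro prob_space_PiM measure_pmf.prob_space_axioms)

lemma space_seqs [simp]: "space seqs = UNIV"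
  by (simp add: seqs_def space_PiM)

lemma measurable_digit [measurable]: "(\<lambda>a. a j) \<in> measurable seqs (count_space UNIV)"
proof -
  have "(\<lambda>a. a j) \<in> measurable seqs (measure_pmf (pmf_of_set D))"
    unfolding seqs_def by (rule measurable_component_singleton) simp
  then show ?thesis by simp
qed

lemma measurable_expansion [measurable]: "expansion \<in> borel_measurable seqs"
  unfolding expansion_def[abs_def] by (intro borel_measurable_suminf) measurable

lemma measurable_word [measurable]: "word n \<in> measurable seqs (count_space UNIV)"
  by (induction n) auto

lemma sets_law [simp]: "sets law = sets borel" by (simp add: law_def)

lemma space_law [simp]: "space law = UNIV" by (simp add: law_def)

lemma prob_space_law: "prob_space law"
  unfolding law_def by (rule prob_space.prob_space_distr[OF prob_space_seqs]) simp

lemma D_nonempty: "D \<noteq> {}" using card_D by auto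

lemma AE_digits: "AE a in seqs. \<forall>j. a j \<in> D"
  unfolding AE_all_countable
proof
  fix j
  have "AE d in measure_pmf (pmf_of_set D). d \<in> D"
    using D_nonempty by (simp add: AE_measure_pmf_iff)
  then show "AE a in seqs. a j \<in> D"
    unfolding seqs_def by (intro AE_PiM_component measure_pmf.prob_space_axioms) auto
qed

lemma word_in_desc: "(\<And>j. j < n \<Longrightarrow> a j \<in> D) \<Longrightarrow> word n a \<in> desc 0 n"
  by (induction n) auto

lemma word_eq_iff:
  "(\<And>j. j < n \<Longrightarrow> a j \<in> D) \<Longrightarrow> (\<And>j. j < n \<Longrightarrow> x j \<in> D) \<Longrightarrow> word n a = word n x \<longleftrightarrow> (\<forall>j<n. a j = x j)"
proof (induction n)
  case (Suc n)
  have "word (Suc n) a = word (Suc n) x \<longleftrightarrow> word n a = word n x \<and> a n = x n"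
    using inj_onD[OF inj_digit[of UNIV], of "(word n a, a n)" "(word n x, x n)"] Suc.prems by auto
  then show ?case using Suc by (auto simp: less_Suc_eq)
qed simp

lemma ex_word: "u \<in> desc 0 n \<Longrightarrow> \<exists>x. (\<forall>j. x j \<in> D) \<and> word n x = u"
proof (induction n arbitrary: u)
  case 0
  then show ?case using D_nonempty by auto
next
  case (Suc n)
  then obtain w d where w: "w \<in> desc 0 n" "d \<in> D" "u = p * w + d" by auto
  then obtain x where x: "\<forall>j. x j \<in> D" "word n x = w" using Suc.IH by blast
  define y where "y j = (if j = n then d else x j)" for j
  have "word n y = word n x" using x w by (subst word_eq_iff) (auto simp: y_def)
  moreover have "y j \<in> D" for j using x w by (simp add: y_def)
  moreover have "y n = d" by (simp add: y_def)
  ultimately show ?case using x w by (intro exI[of _ y]) simp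
qed

text \<open>A word determines its digits only for sequences with values in \<open>D\<close>, so the
  event is compared with a product cylinder almost everywhere.\<close>

lemma emeasure_word:
  assumes "u \<in> desc 0 n"
  shows "emeasure seqs {a. word n a = u} = ennreal ((1 / real b) ^ n)"
proof -
  interpret P: product_prob_space dpmf "UNIV :: nat set"
    by unfold_locales
  obtain x where x: "\<forall>j. x j \<in> D" "word n x = u" using ex_word[OF assms] by blast
  have "emeasure seqs {a. word n a = u} = emeasure seqs {a. \<forall>j<n. a j = x j}"
  proof (rule emeasure_eq_AE)
    show "AE a in seqs. a \<in> {a. word n a = u} \<longleftrightarrow> a \<in> {a. \<forall>j<n. a j = x j}"
      using AE_digits by eventually_elim (use x word_eq_iff in auto)
    have "{a. word n a = u} = word n -` {u} \<inter> space seqs" by auto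
    then show "{a. word n a = u} \<in> sets seqs" using measurable_sets[OF measurable_word] by simp
    have "{a \<in> space seqs. a j = x j} \<in> sets seqs" for j
      using measurable_sets[OF measurable_digit, of "{x j}" j] by (simp add: vimage_def)
    then have "{a \<in> space seqs. \<forall>j\<in>{..<n}. a j = x j} \<in> sets seqs"
      by (intro sets.sets_Collect_finite_All) auto
    then show "{a. \<forall>j<n. a j = x j} \<in> sets seqs" by (simp add: Ball_def)
  qed
  also have "{a. \<forall>j<n. a j = x j} = prod_emb UNIV dpmf {..<n} (PiE {..<n} (\<lambda>j. {x j}))"
    by (auto simp: prod_emb_PiE PiE_iff split: if_splits)
  also have "emeasure seqs \<dots> = (\<Prod>j<n. emeasure (dpmf j) {x j})"
    unfolding seqs_def by (rule P.emeasure_PiM_emb) auto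
  also have "\<dots> = (\<Prod>j<n. ennreal (1 / real b))"
    using x D_nonempty by (intro prod.cong refl) (simp add: emeasure_pmf_single b_def)
  finally show ?thesis by (simp add: ennreal_power)
qed

lemma expansion_in_cyl:
  assumes "\<And>j. a j \<in> D"
  shows "expansion a \<in> cyl n (word n a)"
proof -
  have le: "real (a j) \<le> real p - 1" for j using D_less[OF assms[of j]] by linarith
  have geo: "(\<lambda>j. (real p - 1) / real p ^ Suc n * (1 / real p) ^ j) sums ((real p - 1) / real p ^ Suc n * (1 / (1 - 1 / real p)))" for n
    using p_ge by (intro sums_mult geometric_sums) auto
  have geo': "(real p - 1) / real p ^ Suc n * (1 / (1 - 1 / real p)) = 1 / real p ^ n" for n
    using p_ge by (simp add: field_simps)
  have bound: "real (a (j + n)) / real p ^ Suc (j + n) \<le> (real p - 1) / real p ^ Suc n * (1 / real p) ^ j" for j n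
  proof -
    have "real (a (j + n)) / real p ^ Suc (j + n) \<le> (real p - 1) / real p ^ Suc (j + n)"
      by (intro divide_right_mono le) auto
    then show ?thesis by (simp add: power_add power_one_over field_simps)
  qed
  have sm: "summable (\<lambda>j. real (a (j + n)) / real p ^ Suc (j + n))" for n
  proof (rule summable_comparison_test'[OF sums_summable[OF geo[of n]]])
    fix j :: nat assume "0 \<le> j"
    have "0 \<le> real (a (j + n)) / real p ^ Suc (j + n)" by simp
    then show "norm (real (a (j + n)) / real p ^ Suc (j + n)) \<le> (real p - 1) / real p ^ Suc n * (1 / real p) ^ j"
      using bound[of j n] by (simp only: real_norm_def abs_of_nonneg)
  qed
  have part: "(\<Sum>j<n. real (a j) / real p ^ Suc j) = real (word n a) / real p ^ n" for n
    by (induction n) (simp_all add: field_simps)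
  have "expansion a = (\<Sum>j. real (a (j + n)) / real p ^ Suc (j + n)) + real (word n a) / real p ^ n"
    unfolding expansion_def part[symmetric] using sm[of 0] by (intro suminf_split_initial_segment) simp
  moreover have "0 \<le> (\<Sum>j. real (a (j + n)) / real p ^ Suc (j + n))" by (intro suminf_nonneg sm) auto
  moreover have "(\<Sum>j. real (a (j + n)) / real p ^ Suc (j + n)) \<le> (\<Sum>j. (real p - 1) / real p ^ Suc n * (1 / real p) ^ j)"
    by (intro suminf_le bound sm sums_summable[OF geo])
  then have "(\<Sum>j. real (a (j + n)) / real p ^ Suc (j + n)) \<le> 1 / real p ^ n"
    using sums_unique[OF geo[of n]] geo'[of n] by simp
  ultimately show ?thesis by (simp add: cyl_def add_divide_distrib)
qed

lemma closed_cyl: "closed (cyl n u)" by (simp add: cyl_def)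

lemma closed_cantor: "closed cantor"
  unfolding cantor_def by (intro closed_INT ballI closed_UN finite_desc closed_cyl)

lemma emeasure_law: "A \<in> sets borel \<Longrightarrow> emeasure law A = emeasure seqs {a. expansion a \<in> A}"
  unfolding law_def by (subst emeasure_distr) (auto intro!: arg_cong[of _ _ "emeasure seqs"])

lemma emeasure_law_cantor: "emeasure law cantor = 1"
proof -
  interpret prob_space seqs by (rule prob_space_seqs)
  have "AE a in seqs. expansion a \<in> cantor"
    using AE_digits
  proof eventually_elim
    case (elim a)
    have "word n a \<in> desc 0 n" "expansion a \<in> cyl n (word n a)" for n
      using elim by (auto intro: word_in_desc expansion_in_cyl)
    then show ?case unfolding cantor_def by (intro INT_I UN_I)
  qed
  then have "emeasure seqs {a. expansion a \<in> cantor} = emeasure seqs UNIV"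
    using measurable_sets[OF measurable_expansion borel_closed[OF closed_cantor]] sets.top[of seqs]
    by (intro emeasure_eq_AE) (auto simp: vimage_def)
  then show ?thesis using emeasure_space_1 borel_closed[OF closed_cantor] by (simp add: emeasure_law)
qed

lemma emeasure_law_cyl_ge:
  assumes "u \<in> desc 0 n"
  shows "ennreal ((1 / real b) ^ n) \<le> emeasure law (cyl n u)"
proof -
  have m: "{a. expansion a \<in> cyl n u} \<in> sets seqs"
    using measurable_sets[OF measurable_expansion borel_closed[OF closed_cyl[of n u]]] by (simp add: vimage_def)
  have "emeasure seqs {a. word n a = u} \<le> emeasure seqs {a. expansion a \<in> cyl n u}"
    by (rule emeasure_mono_AE[OF _ m]) (use AE_digits in eventually_elim, use expansion_in_cyl in auto)
  then show ?thesis using borel_closed[OF closed_cyl[of n u]] by (simp add: emeasure_law emeasure_word[OF assms])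
qed

text \<open>A Frostman bound: almost surely, a point of \<open>A\<close> has its first
  \<open>n\<close> digits among at most two words, each of probability
  \<open>(1 / b) ^ n\<close>.\<close>

lemma emeasure_law_small:
  assumes "A \<in> sets borel" "bounded A" "diameter A < 1 / real p ^ n"
  shows "emeasure law A \<le> ennreal (2 * (1 / real b) ^ n)"
proof -
  define H where "H = {u \<in> desc 0 n. A \<inter> cyl n u \<noteq> {}}"
  have H: "finite H" "card H \<le> 2" using card_cyl_meeting[OF finite_desc assms(2,3)] by (auto simp: H_def)
  have m: "{a. word n a = u} \<in> sets seqs" for u
    using measurable_sets[OF measurable_word, of "{u}" n] by (simp add: vimage_def)
  have "emeasure seqs {a. expansion a \<in> A} \<le> emeasure seqs (\<Union>u\<in>H. {a. word n a = u})"
  proof (rule emeasure_mono_AE)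
    show "AE a in seqs. a \<in> {a. expansion a \<in> A} \<longrightarrow> a \<in> (\<Union>u\<in>H. {a. word n a = u})"
      using AE_digits
    proof eventually_elim
      case (elim a)
      then show ?case using expansion_in_cyl[of a n] word_in_desc[of n a] by (auto simp: H_def)
    qed
  qed (use H m in auto)
  also have "\<dots> \<le> (\<Sum>u\<in>H. emeasure seqs {a. word n a = u})"
    using H m by (intro emeasure_subadditive_finite) auto
  also have "\<dots> = (\<Sum>u\<in>H. ennreal ((1 / real b) ^ n))"
    by (intro sum.cong refl emeasure_word) (auto simp: H_def)
  also have "\<dots> = ennreal (real (card H) * (1 / real b) ^ n)"
    by (subst sum_ennreal) auto
  also have "\<dots> \<le> ennreal (2 * (1 / real b) ^ n)"
    using H by (intro ennreal_leI mult_right_mono) auto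
  finally show ?thesis by (simp add: emeasure_law assms)
qed

text \<open>The Cantor set is closed and carries all the mass; conversely, each of its points lies
  in arbitrarily short cylinders of positive mass.\<close>

lemma support_law: "measure_support law = cantor"
proof (intro equalityI subsetI)
  fix x assume x: "x \<in> measure_support law"
  show "x \<in> cantor"
  proof (rule ccontr)
    interpret prob_space law by (rule prob_space_law)
    assume "x \<notin> cantor"
    then have "emeasure law (- cantor) > 0"
      using x closed_cantor by (auto simp: measure_support_def open_closed)
    moreover have "emeasure law (space law - cantor) = 0"
      using emeasure_compl[of cantor law] borel_closed[OF closed_cantor] emeasure_law_cantor emeasure_space_1 by simp
    ultimately show False by (simp add: Compl_eq_Diff_UNIV)
  qed
next
  fix x assume x: "x \<in> cantor"
  show "x \<in> measure_support law"
    unfolding measure_support_def mem_Collect_eq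
  proof (intro allI impI)
    fix U assume "open U" "x \<in> U"
    then obtain e where e: "e > 0" "ball x e \<subseteq> U" by (auto simp: open_contains_ball)
    obtain n where n: "(1 / real p) ^ n < e" using real_arch_pow_inv[of e "1 / real p"] e p_ge by auto
    obtain u where u: "u \<in> desc 0 n" "x \<in> cyl n u" using x by (auto simp: cantor_def)
    have "cyl n u \<subseteq> ball x e"
    proof
      fix y assume y: "y \<in> cyl n u"
      have "dist x y \<le> diameter (cyl n u)"
        using u(2) y by (intro diameter_bounded_bound compact_imp_bounded) auto
      then show "y \<in> ball x e" using n by (simp add: power_one_over)
    qed
    then have "emeasure law (cyl n u) \<le> emeasure law U"
      using e \<open>open U\<close> by (intro emeasure_mono) auto
    moreover have "ennreal ((1 / real b) ^ n) > 0" by simp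
    ultimately show "emeasure law U > 0" using emeasure_law_cyl_ge[OF u(1)] by (meson less_le_trans)
  qed
qed

section \<open>Fourier coefficients of the measure\<close>

lemma G_decreasing: "i \<le> j \<Longrightarrow> G j (x / real p ^ j) \<le> G i (x / real p ^ i)"
proof (induction j)
  case (Suc j)
  have "G (Suc j) (x / real p ^ Suc j) \<le> 1 * G j (x / real p ^ j)"
    unfolding G_Suc by (intro mult_mono F_le_1) auto
  then show ?case using Suc by (cases "i = Suc j") auto
qed simp

lemma integral_word:
  fixes f :: "nat \<Rightarrow> complex"
  shows "(CLINT a|seqs. f (word n a)) = (\<Sum>u\<in>desc 0 n. f u) / of_nat b ^ n"
proof -
  interpret prob_space seqs by (rule prob_space_seqs)
  have m: "{a. word n a = u} \<in> sets seqs" for u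
    using measurable_sets[OF measurable_word, of "{u}" n] by (simp add: vimage_def)
  have "(CLINT a|seqs. f (word n a)) = (CLINT a|seqs. (\<Sum>u\<in>desc 0 n. indicator {a. word n a = u} a *\<^sub>R f u))"
  proof (rule integral_cong_AE)
    show "AE a in seqs. f (word n a) = (\<Sum>u\<in>desc 0 n. indicator {a. word n a = u} a *\<^sub>R f u)"
      using AE_digits
    proof eventually_elim
      case (elim a)
      then have "word n a \<in> desc 0 n" by (intro word_in_desc) auto
      then show ?case by (simp add: indicator_def of_bool_def if_distrib[of "\<lambda>x. x *\<^sub>R _"] cong: if_cong)
    qed
    show "(\<lambda>a. f (word n a)) \<in> borel_measurable seqs" by measurable
    show "(\<lambda>a. \<Sum>u\<in>desc 0 n. indicator {a. word n a = u} a *\<^sub>R f u) \<in> borel_measurable seqs"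
      using m by measurable
  qed
  also have "\<dots> = (\<Sum>u\<in>desc 0 n. measure seqs {a. word n a = u} *\<^sub>R f u)"
    using m by (subst Bochner_Integration.integral_sum) (auto simp: emeasure_eq_measure)
  also have "\<dots> = (\<Sum>u\<in>desc 0 n. f u / of_nat b ^ n)"
  proof (intro sum.cong refl)
    fix u assume "u \<in> desc 0 n"
    then have "measure seqs {a. word n a = u} = (1 / real b) ^ n"
      unfolding measure_def by (simp add: emeasure_word)
    then show "measure seqs {a. word n a = u} *\<^sub>R f u = f u / of_nat b ^ n"
      unfolding scaleR_conv_of_real power_one_over by simp
  qed
  finally show ?thesis by (simp add: sum_divide_distrib)
qed

text \<open>By dominated convergence the truncated transforms tend to the Fourier coefficient, and
  their moduli are the finite products \<open>G n\<close>. These decrease in \<open>n\<close>, since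
  each new factor is at most 1, so every one of them is an upper bound.\<close>

lemma norm_fourier_coeff_le: "norm (fourier_coeff law \<xi>) \<le> G n (of_int \<xi> / real p ^ n)"
proof -
  interpret prob_space seqs by (rule prob_space_seqs)
  define y where "y = real_of_int (- \<xi>)"
  have e: "exp (- 2 * complex_of_real pi * \<i> * complex_of_real x * of_int \<xi>) = ec (y * x)" for x
    unfolding ec_def cis_conv_exp y_def by (rule arg_cong[of _ _ exp]) simp
  have cont: "continuous_on UNIV ec" unfolding ec_def[abs_def] by (intro continuous_intros)
  have meas_ec: "ec \<in> borel_measurable borel" by (intro borel_measurable_continuous_onI cont)
  have four: "fourier_coeff law \<xi> = (CLINT a|seqs. ec (y * expansion a))"
    unfolding fourier_coeff_def e law_def by (rule integral_distr) (use meas_ec in measurable)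
  have lim: "(\<lambda>n. CLINT a|seqs. ec (y * (real (word n a) / real p ^ n))) \<longlonglongrightarrow> (CLINT a|seqs. ec (y * expansion a))"
  proof (rule integral_dominated_convergence[where w = "\<lambda>_. 1"])
    show "AE a in seqs. (\<lambda>n. ec (y * (real (word n a) / real p ^ n))) \<longlonglongrightarrow> ec (y * expansion a)"
      using AE_digits
    proof eventually_elim
      case (elim a)
      have "(\<lambda>n. real (word n a) / real p ^ n) \<longlonglongrightarrow> expansion a"
      proof (rule LIM_zero_cancel, rule Lim_null_comparison)
        have "\<bar>real (word n a) / real p ^ n - expansion a\<bar> \<le> (1 / real p) ^ n" for n
          using expansion_in_cyl[of a n] elim by (auto simp: cyl_def add_divide_distrib power_one_over)
        then show "\<forall>\<^sub>F n in sequentially. norm (real (word n a) / real p ^ n - expansion a) \<le> (1 / real p) ^ n"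
          by (intro always_eventually allI) simp
        show "(\<lambda>n. (1 / real p) ^ n) \<longlonglongrightarrow> 0" using p_ge by (intro LIMSEQ_power_zero) auto
      qed
      moreover have "isCont ec z" for z using cont by (simp add: continuous_on_eq_continuous_at)
      ultimately show ?case by (intro isCont_tendsto_compose[where g = ec] tendsto_intros)
    qed
  qed (use meas_ec in \<open>auto\<close>)
  have val: "norm (CLINT a|seqs. ec (y * (real (word n a) / real p ^ n))) = G n (of_int \<xi> / real p ^ n)" for n
  proof -
    have "(CLINT a|seqs. ec (y * (real (word n a) / real p ^ n))) = (\<Sum>u\<in>desc 0 n. ec (y * (real u / real p ^ n))) / of_nat b ^ n"
      by (rule integral_word)
    also have "norm \<dots> = norm (\<Sum>u\<in>desc 0 n. ec (y / real p ^ n * real u)) / real b ^ n"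
      by (simp add: norm_divide norm_power)
    also have "\<dots> = G n (y / real p ^ n)" unfolding norm_sum_desc by simp
    finally show ?thesis using G_minus[of n "of_int \<xi> / real p ^ n"] by (simp add: y_def)
  qed
  have "(\<lambda>k. G k (of_int \<xi> / real p ^ k)) \<longlonglongrightarrow> norm (fourier_coeff law \<xi>)"
    unfolding four val[symmetric] by (intro tendsto_norm lim)
  then show ?thesis
    by (rule LIMSEQ_le_const2) (auto intro!: exI[of _ n] G_decreasing)
qed

end

section \<open>Hausdorff dimension, Fourier dimension in the mean and spectrality of the
  measure\<close>

context flat_digits
begin

text \<open>The mass distribution principle: a cover set of size \<rho> has mass at most
  \<open>2 * p * \<rho> powr d\<close>, so a cover of total size below
  \<open>measure law A / (2 * p)\<close> cannot exist. Passing to closures makes the cover sets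
  Borel without changing their diameters.\<close>

lemma hausdorff_dim_pos_measure:
  assumes A: "A \<in> sets borel" "emeasure law A > 0"
  shows "ereal dimn \<le> hausdorff_dim A"
proof (rule hausdorff_dim_ge)
  fix d assume d: "0 < d" "d < dimn"
  interpret prob_space law by (rule prob_space_law)
  show "hausdorff_measure d A \<noteq> 0"
  proof
    assume zero: "hausdorff_measure d A = 0"
    define \<epsilon> where "\<epsilon> = measure law A / (2 * real p)"
    have \<epsilon>: "\<epsilon> > 0" using A p_ge by (simp add: \<epsilon>_def emeasure_eq_measure)
    obtain U \<rho> where U: "A \<subseteq> (\<Union>i. U i)" "\<And>i::nat. bounded (U i)" and \<rho>: "\<And>i. 0 < \<rho> i" "\<And>i. diameter (U i) \<le> \<rho> i"
      and sum: "(\<Sum>i. ennreal (\<rho> i powr d)) < ennreal \<epsilon>"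
      by (rule hausdorff_measure_zero_cover[OF zero \<epsilon> d(1)]) (rule that)
    have each: "emeasure law (closure (U i)) \<le> ennreal (2 * real p) * ennreal (\<rho> i powr d)" for i
    proof (cases "\<rho> i < 1")
      case False
      have "1 powr d \<le> \<rho> i powr d" using False d by (intro powr_mono2) auto
      then have "1 * 1 \<le> (2 * real p) * \<rho> i powr d" using p_ge by (intro mult_mono) auto
      then have "ennreal 1 \<le> ennreal (2 * real p * \<rho> i powr d)" by (intro ennreal_leI) simp
      then show ?thesis using measure_le_1 order.trans
        by (simp add: ennreal_mult[symmetric] emeasure_le_1 order_trans[OF emeasure_le_1])
    next
      case True
      have "\<exists>l. \<not> real p ^ l * \<rho> i < 1"
      proof -
        obtain n where "1 / \<rho> i < real p ^ n" using real_arch_pow[of "real p" "1 / \<rho> i"] p_ge by auto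
        then have "\<not> real p ^ n * \<rho> i < 1" using \<rho>(1)[of i] by (simp add: field_simps)
        then show ?thesis ..
      qed
      define l where "l = (LEAST l. \<not> real p ^ l * \<rho> i < 1)"
      have l: "\<not> real p ^ l * \<rho> i < 1" unfolding l_def by (rule LeastI_ex) fact
      then obtain n where n: "l = Suc n" using True by (cases l) auto
      have ns: "real p ^ n * \<rho> i < 1"
        using not_less_Least[of n "\<lambda>l. \<not> real p ^ l * \<rho> i < 1"] n by (auto simp: l_def)
      then have "\<rho> i < 1 / real p ^ n" by (simp add: field_simps)
      with \<rho>(2)[of i] have "diameter (U i) < 1 / real p ^ n" by (rule le_less_trans)
      then have "emeasure law (closure (U i)) \<le> ennreal (2 * (1 / real b) ^ n)"
        using U(2) by (intro emeasure_law_small) (auto simp: diameter_closure)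
      also have "\<dots> \<le> ennreal (2 * real p * \<rho> i powr d)"
      proof (rule ennreal_leI)
        have "(1 / real b) ^ n = real p powr (- (dimn * real n))"
          unfolding power_one_over b_power powr_minus by (rule inverse_eq_divide[symmetric])
        also have "\<dots> \<le> real p powr (- (d * real n))"
          using d p_ge by (intro powr_mono) (auto intro!: mult_right_mono)
        also have "\<dots> = (real p powr (- real n)) powr d" by (simp add: powr_powr mult.commute)
        also have "real p powr (- real n) = 1 / real p ^ n" by (simp add: powr_minus powr_realpow divide_inverse)
        also have "(1 / real p ^ n) powr d \<le> (real p * \<rho> i) powr d"
          using l n d \<rho>(1)[of i] by (intro powr_mono2) (auto simp: field_simps)
        also have "\<dots> = real p powr d * \<rho> i powr d" using \<rho>(1)[of i] by (simp add: powr_mult)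
        also have "\<dots> \<le> real p * \<rho> i powr d"
          using d dimn_le_1 p_ge powr_mono[of d 1 "real p"] by (intro mult_right_mono) auto
        finally show "2 * (1 / real b) ^ n \<le> 2 * real p * \<rho> i powr d" by simp
      qed
      finally show ?thesis by (simp add: ennreal_mult[symmetric])
    qed
    have "(\<Union>i. U i) \<subseteq> (\<Union>i. closure (U i))" by (intro UN_mono closure_subset subset_refl)
    then have "emeasure law A \<le> emeasure law (\<Union>i. closure (U i))"
      using U(1) by (intro emeasure_mono) auto
    also have "\<dots> \<le> (\<Sum>i. emeasure law (closure (U i)))"
      by (intro emeasure_subadditive_countably) auto
    also have "\<dots> \<le> (\<Sum>i. ennreal (2 * real p) * ennreal (\<rho> i powr d))" by (intro suminf_le each) auto
    also have "\<dots> = ennreal (2 * real p) * (\<Sum>i. ennreal (\<rho> i powr d))" by simp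
    also have "\<dots> < ennreal (2 * real p) * ennreal \<epsilon>"
      using sum p_ge by (intro ennreal_mult_strict_left_mono) auto
    also have "\<dots> = emeasure law A"
      using \<epsilon> p_ge by (simp add: ennreal_mult[symmetric] \<epsilon>_def emeasure_eq_measure)
    finally show False by simp
  qed
qed

lemma measure_hausdorff_dim_law: "measure_hausdorff_dim law = ereal dimn"
proof (rule antisym)
  have "measure_hausdorff_dim law \<le> hausdorff_dim cantor"
    unfolding measure_hausdorff_dim_def using emeasure_law_cantor closed_cantor by (intro INF_lower) auto
  also note hausdorff_dim_cantor_le
  finally show "measure_hausdorff_dim law \<le> ereal dimn" .
  show "ereal dimn \<le> measure_hausdorff_dim law"
    unfolding measure_hausdorff_dim_def by (intro INF_greatest hausdorff_dim_pos_measure) auto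
qed

text \<open>The range is enclosed in one full period \<open>p ^ k\<close> with
  \<open>p ^ (k - 1) \<le> R\<close>. The residue sum with empty prefix is
  \<open>p powr (k / 20)\<close>, and overshooting by one digit costs less than the factor
  \<open>p\<close>.\<close>

lemma sum_fourier_coeff_le:
  assumes "R \<ge> 1"
  shows "(\<Sum>\<xi>=0..R. norm (fourier_coeff law (int \<xi>))) \<le> real p * real R powr (1 / 20)"
    and "(\<Sum>\<xi>\<in>{- int R..int R}. norm (fourier_coeff law \<xi>)) \<le> 2 * real p * real R powr (1 / 20)"
proof -
  define k where "k = (LEAST k. R < p ^ k)"
  have "\<exists>k. R < p ^ k" using p_ge by (intro exI[of _ R] less_le_trans[OF less_exp power_mono]) auto
  then have k: "R < p ^ k" unfolding k_def by (rule LeastI_ex)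
  then obtain n where n: "k = Suc n" using assms by (cases k) auto
  have pn: "p ^ n \<le> R" using not_less_Least[of n "\<lambda>k. R < p ^ k"] n by (auto simp: k_def)
  define S where "S = (\<Sum>\<xi>=0..R. G k (real \<xi> / real p ^ k))"
  have "S \<le> (\<Sum>\<xi><p ^ (0 + k). G k (real \<xi> / real p ^ (0 + k)))"
    unfolding S_def add_0 using k by (intro sum_mono2) auto
  also have "\<dots> \<le> real p ^ 0 * (real p powr (1 / 20)) ^ k" by (intro sum_G_residues residue_sum_le)
  also have "\<dots> = real p powr (1 / 20) * (real p ^ n) powr (1 / 20)"
    by (simp add: n powr_realpow[symmetric] powr_powr mult.commute)
  also have "\<dots> \<le> real p powr 1 * real R powr (1 / 20)"
  proof (intro mult_mono powr_mono powr_mono2)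
    show "real p ^ n \<le> real R" using pn by (metis of_nat_le_iff of_nat_power)
  qed (use p_ge in auto)
  finally have S: "S \<le> real p * real R powr (1 / 20)" using p_ge by simp
  show "(\<Sum>\<xi>=0..R. norm (fourier_coeff law (int \<xi>))) \<le> real p * real R powr (1 / 20)"
  proof (rule order.trans[OF _ S], unfold S_def, rule sum_mono)
    fix \<xi> show "norm (fourier_coeff law (int \<xi>)) \<le> G k (real \<xi> / real p ^ k)"
      using norm_fourier_coeff_le[of "int \<xi>" k] by simp
  qed
  have "{- int R..int R} \<subseteq> int ` {0..R} \<union> (\<lambda>n. - int n) ` {0..R}"
  proof
    fix z assume "z \<in> {- int R..int R}"
    then have "nat \<bar>z\<bar> \<in> {0..R}" "z = int (nat \<bar>z\<bar>) \<or> z = - int (nat \<bar>z\<bar>)" by auto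
    then show "z \<in> int ` {0..R} \<union> (\<lambda>n. - int n) ` {0..R}" by blast
  qed
  then have "(\<Sum>\<xi>\<in>{- int R..int R}. norm (fourier_coeff law \<xi>))
     \<le> (\<Sum>\<xi>\<in>int ` {0..R} \<union> (\<lambda>n. - int n) ` {0..R}. norm (fourier_coeff law \<xi>))"
    by (intro sum_mono2) auto
  also have "\<dots> \<le> (\<Sum>\<xi>\<in>int ` {0..R}. norm (fourier_coeff law \<xi>)) + (\<Sum>\<xi>\<in>(\<lambda>n. - int n) ` {0..R}. norm (fourier_coeff law \<xi>))"
    by (subst sum_Un) (auto intro!: sum_nonneg)
  also have "\<dots> = (\<Sum>\<xi>=0..R. norm (fourier_coeff law (int \<xi>))) + (\<Sum>\<xi>=0..R. norm (fourier_coeff law (- int \<xi>)))"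
    by (simp add: sum.reindex inj_on_def)
  also have "\<dots> \<le> S + S"
    unfolding S_def
  proof (intro add_mono sum_mono)
    fix \<xi> show "norm (fourier_coeff law (int \<xi>)) \<le> G k (real \<xi> / real p ^ k)"
      using norm_fourier_coeff_le[of "int \<xi>" k] by simp
    show "norm (fourier_coeff law (- int \<xi>)) \<le> G k (real \<xi> / real p ^ k)"
      using norm_fourier_coeff_le[of "- int \<xi>" k] by simp
  qed
  finally show "(\<Sum>\<xi>\<in>{- int R..int R}. norm (fourier_coeff law \<xi>)) \<le> 2 * real p * real R powr (1 / 20)"
    using S by simp
qed

lemma l1_dim_law_ge: "ereal (19 / 20) \<le> l1_dim law"
proof -
  have "(\<lambda>R::nat. \<Sum>\<xi>\<in>{- int R..int R}. norm (fourier_coeff law \<xi>)) \<in> O(\<lambda>R. real R powr (1 - 19 / 20))"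
  proof (rule bigoI[where c = "2 * real p"])
    have "\<forall>\<^sub>F R in sequentially. R \<ge> (1::nat)" by (rule eventually_ge_at_top)
    then show "\<forall>\<^sub>F R in sequentially. norm (\<Sum>\<xi>\<in>{- int R..int R}. norm (fourier_coeff law \<xi>))
        \<le> 2 * real p * norm (real R powr (1 - 19 / 20))"
    proof eventually_elim
      case (elim R)
      then show ?case using sum_fourier_coeff_le(2)[OF elim] by (simp add: sum_nonneg)
    qed
  qed
  then show ?thesis unfolding l1_dim_def by (intro Sup_upper imageI) simp
qed

lemma spectral_law: "spectral_measure law"
  unfolding spectral_measure_def
proof (intro exI conjI)
  \<comment> \<open>By Chebyshev's inequality the count is of order \<open>N powr (6 / 10)\<close>
    times the sum bound \<open>N powr (1 / 20)\<close>; the resulting exponent 13/20 is below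
    \<open>1 - 3 / 10\<close>.\<close>
  show "(6 / 10 :: real) > 1 / 2" "(3 / 10 :: real) > 0" by simp_all
  let ?A = "\<lambda>N. {\<xi> \<in> {0..int N}. norm (fourier_coeff law \<xi>) \<ge> \<bar>real_of_int \<xi>\<bar> powr (- (6 / 10))}"
  show "(\<lambda>N::nat. real (card (?A N))) \<in> O(\<lambda>N. real N powr (1 - 3 / 10))"
  proof (rule bigoI[where c = "1 + real p"])
    have "\<forall>\<^sub>F N in sequentially. N \<ge> (1::nat)" by (rule eventually_ge_at_top)
    then show "\<forall>\<^sub>F N in sequentially. norm (real (card (?A N))) \<le> (1 + real p) * norm (real N powr (1 - 3 / 10))"
    proof eventually_elim
      case (elim N)
      let ?B = "?A N - {0}"
      have "real (card ?B) * real N powr (- (6 / 10)) = (\<Sum>\<xi>\<in>?B. real N powr (- (6 / 10)))" by simp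
      also have "\<dots> \<le> (\<Sum>\<xi>\<in>?B. norm (fourier_coeff law \<xi>))"
      proof (rule sum_mono)
        fix \<xi> assume \<xi>: "\<xi> \<in> ?B"
        have "real N powr (- (6 / 10)) \<le> \<bar>real_of_int \<xi>\<bar> powr (- (6 / 10))"
          using \<xi> by (intro powr_mono2') auto
        then show "real N powr (- (6 / 10)) \<le> norm (fourier_coeff law \<xi>)" using \<xi> by auto
      qed
      also have "\<dots> \<le> (\<Sum>\<xi>\<in>int ` {0..N}. norm (fourier_coeff law \<xi>))"
      proof (rule sum_mono2)
        show "?B \<subseteq> int ` {0..N}" by (auto simp: image_int_atLeastAtMost)
      qed auto
      also have "\<dots> = (\<Sum>\<xi>=0..N. norm (fourier_coeff law (int \<xi>)))" by (simp add: sum.reindex)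
      also have "\<dots> \<le> real p * real N powr (1 / 20)" by (rule sum_fourier_coeff_le[OF elim])
      finally have "real (card ?B) * real N powr (- (6 / 10)) * real N powr (6 / 10)
          \<le> real p * real N powr (1 / 20) * real N powr (6 / 10)" by (intro mult_right_mono) auto
      then have "real (card ?B) \<le> real p * real N powr (13 / 20)"
        using elim by (simp add: mult.assoc powr_add[symmetric])
      also have "\<dots> \<le> real p * real N powr (1 - 3 / 10)"
        using elim by (intro mult_left_mono powr_mono) auto
      finally have B: "real (card ?B) \<le> real p * real N powr (1 - 3 / 10)" .
      have fin: "finite (?A N)" by (rule finite_subset[of _ "{0..int N}"]) auto
      have "card (?A N) \<le> card (insert 0 ?B)" using fin by (intro card_mono finite.insertI finite_Diff) auto
      also have "\<dots> = Suc (card ?B)" using fin by (intro card_insert_disjoint finite_Diff) auto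
      finally have "real (card (?A N)) \<le> 1 + real (card ?B)" by simp
      moreover have "1 \<le> real N powr (1 - 3 / 10)" using elim by (intro ge_one_powr_ge_zero) auto
      ultimately show ?case using B by (simp add: ring_distribs)
    qed
  qed
qed

end

section \<open>Large bases\<close>

lemma sum_inverse_le_ln: "n \<ge> 1 \<Longrightarrow> (\<Sum>i=1..n. 1 / real i) \<le> 1 + ln (real n)"
proof (induction n rule: nat_induct_at_least)
  case (Suc n)
  have "ln (real n / real (Suc n)) \<le> real n / real (Suc n) - 1" using Suc by (intro ln_le_minus_one) auto
  also have "\<dots> = - (1 / real (Suc n))" by (simp add: field_simps)
  finally have "ln (real n) + 1 / real (Suc n) \<le> ln (real (Suc n))" using Suc by (simp add: ln_div)
  then show ?case using Suc by simp
qed simp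

text \<open>The geometric sum has denominator of modulus \<open>2 * sin (pi * y)\<close>, at least
  twice the distance \<open>z\<close> to the nearest integer. Bounding \<open>1 / z\<close> by two
  reciprocals avoids a case distinction when summing over many points.\<close>

lemma norm_dirichlet_kernel_le_inverse:
  assumes "0 < y" "y < 1"
  shows "norm (dirichlet_kernel M y) \<le> 1 / y + 1 / (1 - y)"
proof -
  define z where "z = min y (1 - y)"
  have z: "0 < z" "z \<le> 1 / 2" using assms by (auto simp: z_def min_def)
  have "sin (pi * y) = sin (pi * z)"
    unfolding z_def min_def by (simp add: sin_diff algebra_simps)
  moreover have "pi * z / 2 \<le> sin (pi * z)" using z by (intro sin_ge_half) auto
  moreover have "z \<le> pi * z / 2" using z pi_gt3 by simp
  ultimately have sin: "z \<le> sin (pi * y)" by linarith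
  have "(norm (1 - ec y))\<^sup>2 = (2 * sin (pi * y))\<^sup>2"
    using cos_double_sin[of "pi * y"] unfolding norm_one_minus_ec by (simp add: power_mult_distrib mult_ac)
  then have "norm (1 - ec y) = 2 * sin (pi * y)"
    by (rule power2_eq_imp_eq) (use sin z in auto)
  then have n1: "2 * z \<le> norm (1 - ec y)" using sin by simp
  have "2 * z * norm (dirichlet_kernel M y) \<le> norm (1 - ec y) * norm (dirichlet_kernel M y)"
    by (intro mult_right_mono n1) simp
  also have "\<dots> = norm (1 - ec (real M * y))" unfolding dirichlet_kernel_mult[symmetric] by (rule norm_mult[symmetric])
  also have "\<dots> \<le> 2" by (rule order.trans[OF norm_triangle_ineq4]) simp
  finally have "norm (dirichlet_kernel M y) \<le> 1 / z" using z by (simp add: field_simps)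
  also have "\<dots> \<le> 1 / y + 1 / (1 - y)" using assms by (auto simp: z_def min_def)
  finally show ?thesis .
qed

text \<open>Only the first and the last point can come arbitrarily close to an integer; they get the
  trivial bound \<open>p\<close>. The others are at least \<open>i / p\<close> from 0 and
  \<open>(p - 1 - i) / p\<close> from 1, which leaves two harmonic sums.\<close>

lemma sum_norm_dirichlet_kernel_le:
  assumes p: "p \<ge> 3" and x: "0 \<le> x" "x < 1 / real p"
  shows "(\<Sum>i<p. norm (dirichlet_kernel p (x + real i / real p))) \<le> real p * (4 + 2 * ln (real p))"
proof -
  let ?f = "\<lambda>i. norm (dirichlet_kernel p (x + real i / real p))"
  have set: "{..<p} = insert 0 (insert (p - 1) {1..p - 2})" using p by auto
  have "(\<Sum>i<p. ?f i) = ?f 0 + (?f (p - 1) + (\<Sum>i=1..p - 2. ?f i))"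
    unfolding set using p by (subst sum.insert, auto)+
  also have "\<dots> \<le> real p + (real p + (\<Sum>i=1..p - 2. real p * (1 / real i) + real p * (1 / real (p - 1 - i))))"
  proof (intro add_mono sum_mono norm_dirichlet_kernel_le)
    fix i assume i: "i \<in> {1..p - 2}"
    let ?y = "x + real i / real p"
    have pos: "real (p - 1 - i) > 0" "real i > 0" using i p by auto
    have y: "real i / real p \<le> ?y" using x by simp
    have "real i / real p + x < real i / real p + 1 / real p" using x by simp
    then have "?y < (real i + 1) / real p" by (simp add: add_divide_distrib add.commute)
    moreover have "(real i + 1) / real p = 1 - real (p - 1 - i) / real p"
    proof -
      have "1 + i + (p - 1 - i) = p" using i p by auto
      then have eq: "real i + 1 = real p - real (p - 1 - i)" by linarith
      show ?thesis unfolding eq diff_divide_distrib using p by simp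
    qed
    ultimately have y': "real (p - 1 - i) / real p \<le> 1 - ?y" by simp
    have ypos: "0 < real i / real p" "0 < real (p - 1 - i) / real p" using pos p by auto
    have "?f i \<le> 1 / ?y + 1 / (1 - ?y)"
      using ypos y y' by (intro norm_dirichlet_kernel_le_inverse) linarith+
    also have "\<dots> \<le> 1 / (real i / real p) + 1 / (real (p - 1 - i) / real p)"
      using ypos y y' by (intro add_mono divide_left_mono mult_pos_pos) linarith+
    finally show "?f i \<le> real p * (1 / real i) + real p * (1 / real (p - 1 - i))" by simp
  qed
  also have "(\<Sum>i=1..p - 2. real p * (1 / real i) + real p * (1 / real (p - 1 - i)))
     = real p * (\<Sum>i=1..p - 2. 1 / real i) + real p * (\<Sum>i=1..p - 2. 1 / real (p - 1 - i))"
    by (simp only: sum.distrib sum_distrib_left)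
  also have "(\<Sum>i=1..p - 2. 1 / real (p - 1 - i)) = (\<Sum>i=1..p - 2. 1 / real i)"
    by (rule sum.reindex_bij_witness[of _ "\<lambda>i. p - 1 - i" "\<lambda>i. p - 1 - i"]) auto
  also have "real p + (real p + (real p * (\<Sum>i=1..p - 2. 1 / real i) + real p * (\<Sum>i=1..p - 2. 1 / real i)))
     = real p * (2 + 2 * (\<Sum>i=1..p - 2. 1 / real i))" by (simp add: algebra_simps)
  also have "\<dots> \<le> real p * (2 + 2 * (1 + ln (real p)))"
  proof (intro mult_left_mono add_left_mono)
    have "(\<Sum>i=1..p - 2. 1 / real i) \<le> 1 + ln (real (p - 2))" using p by (intro sum_inverse_le_ln) auto
    also have "\<dots> \<le> 1 + ln (real p)" using p by simp
    finally show "(\<Sum>i=1..p - 2. 1 / real i) \<le> 1 + ln (real p)" .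
  qed auto
  finally show ?thesis by simp
qed

text \<open>The sum over \<open>D\<close> is the Dirichlet kernel minus the terms of the missing
  digits, and each of these has modulus 1.\<close>

lemma (in digits) residue_sum_F_le:
  assumes p: "p \<ge> 3" and x: "0 \<le> x" "x < 1 / real p"
  shows "(\<Sum>i<p. F (x + real i / real p)) \<le> real p / real b * (4 + 2 * ln (real p) + (real p - real b))"
proof -
  have F: "F y \<le> (norm (dirichlet_kernel p y) + (real p - real b)) / real b" for y
  proof -
    have "dirichlet_kernel p y = (\<Sum>d\<in>D. ec (real d * y)) + (\<Sum>d\<in>{0..<p} - D. ec (real d * y))"
      unfolding dirichlet_kernel_def using sum.subset_diff[OF D_sub, of "\<lambda>d. ec (real d * y)"]
      by (simp add: lessThan_atLeast0 add.commute)
    then have "norm (\<Sum>d\<in>D. ec (real d * y)) \<le> norm (dirichlet_kernel p y) + norm (\<Sum>d\<in>{0..<p} - D. ec (real d * y))"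
      using norm_triangle_ineq4[of "dirichlet_kernel p y" "\<Sum>d\<in>{0..<p} - D. ec (real d * y)"] by simp
    also have "norm (\<Sum>d\<in>{0..<p} - D. ec (real d * y)) \<le> (\<Sum>d\<in>{0..<p} - D. norm (ec (real d * y)))" by (rule norm_sum)
    also have "\<dots> = real p - real b"
      using card_mono[OF _ D_sub] D_sub by (simp add: card_Diff_subset of_nat_diff b_def)
    finally show ?thesis unfolding F_def by (intro divide_right_mono) auto
  qed
  have "(\<Sum>i<p. F (x + real i / real p)) \<le> (\<Sum>i<p. (norm (dirichlet_kernel p (x + real i / real p)) + (real p - real b)) / real b)"
    by (intro sum_mono F)
  also have "\<dots> = ((\<Sum>i<p. norm (dirichlet_kernel p (x + real i / real p))) + real p * (real p - real b)) / real b"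
    by (simp add: sum_divide_distrib[symmetric] sum.distrib)
  also have "\<dots> \<le> (real p * (4 + 2 * ln (real p)) + real p * (real p - real b)) / real b"
    by (intro divide_right_mono add_right_mono sum_norm_dirichlet_kernel_le assms) auto
  finally show ?thesis by (simp add: field_simps)
qed

text \<open>For fixed \<open>t\<close> the residue sum is \<open>O(ln p)\<close> and
  \<open>p - t\<close> is asymptotic to \<open>p\<close>. Only the number of missing digits enters,
  so one threshold works for all sets \<open>D\<close>.\<close>

lemma eventually_flat_digits:
  "\<forall>\<^sub>F p in sequentially. \<forall>D. p \<ge> 3 \<longrightarrow> D \<subseteq> {0..<p} \<longrightarrow> card D + t = p \<longrightarrow> card D \<ge> 2 \<longrightarrow> flat_digits p D"
proof -
  have "\<forall>\<^sub>F p in sequentially. real p / (real p - real t) * (4 + 2 * ln (real p) + real t) \<le> real p powr (1 / 20)"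
    by real_asymp
  moreover have "\<forall>\<^sub>F p in sequentially. real p powr (9 / 10) \<le> real p - real t"
    by real_asymp
  ultimately show ?thesis
  proof eventually_elim
    case (elim p)
    show ?case
    proof (intro allI impI)
      fix D assume D: "p \<ge> 3" "D \<subseteq> {0..<p}" "card D + t = p" "card D \<ge> 2"
      interpret digits p D using D by unfold_locales auto
      have b: "real b = real p - real t" using D(3) by (simp add: b_def)
      show "flat_digits p D"
      proof unfold_locales
        fix x :: real assume x: "0 \<le> x" "x < 1 / real p"
        show "(\<Sum>i<p. F (x + real i / real p)) \<le> real p powr (1 / 20)"
          using residue_sum_F_le[OF D(1) x] elim(1) by (simp add: b)
      qed (use elim(2) b in simp)
    qed
  qed
qed

theorem theorem9p5:
  fixes t :: nat
  assumes "t \<ge> 1"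
  shows "\<exists>p\<^sub>0::nat. \<forall>p::nat. p \<ge> p\<^sub>0 \<longrightarrow> p \<ge> 3 \<longrightarrow>
    (\<exists>c::real. c > 0 \<and>
      (\<forall>\<mu>. missing_digits_measure p t \<mu> \<longrightarrow>
        spectral_measure \<mu> \<and>
        l1_dim \<mu> * measure_hausdorff_dim \<mu> > 1/2 \<and>
        (\<forall>c'::real. 0 < c' \<and> c' \<le> c \<longrightarrow>
          hausdorff_dim (well_approximable (\<lambda>q. real q powr (- 1 - c')) \<inter> measure_support \<mu>)
            = measure_hausdorff_dim \<mu> - ereal (c' / (2 + c')))))"
proof -
  obtain p0 where p0: "\<And>p D. p \<ge> p0 \<Longrightarrow> p \<ge> 3 \<Longrightarrow> D \<subseteq> {0..<p} \<Longrightarrow> card D + t = p \<Longrightarrow> card D \<ge> 2 \<Longrightarrow> flat_digits p D"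
    using eventually_flat_digits[of t] unfolding eventually_sequentially by blast
  show ?thesis
  \<comment> \<open>The value 1/10 comes from the exponent condition
    \<open>1 / (2 + c') \<ge> 10 / 21\<close>; it is the same for all large
    \<open>p\<close>.\<close>
  proof (rule exI[of _ p0], intro allI impI, rule exI[of _ "1 / 10"], intro conjI allI impI)
    fix p :: nat and \<mu> assume p: "p0 \<le> p" "3 \<le> p" and "missing_digits_measure p t \<mu>"
    then obtain D where D: "D \<subseteq> {0..<p}" "card D + t = p" "card D \<ge> 2" and \<mu>: "\<mu> = missing_digits_law p D"
      by (auto simp: missing_digits_measure_def)
    interpret flat_digits p D by (rule p0[OF p D])
    have law: "\<mu> = law" by (simp add: \<mu> law_eq)
    show "spectral_measure \<mu>" unfolding law by (rule spectral_law)
    \<comment> \<open>The mean Fourier exponent \<open>1 / 20\<close> gives dimension at least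
      19/20, and \<open>b \<ge> p powr (9 / 10)\<close> gives 9/10; the product is 171/200.\<close>
    have "(1 / 2 :: ereal) < ereal (19 / 20) * ereal (9 / 10)" by (simp add: one_ereal_def divide_ereal_def)
    also have "\<dots> \<le> l1_dim \<mu> * measure_hausdorff_dim \<mu>"
      unfolding law measure_hausdorff_dim_law using dimn_ge l1_dim_law_ge
      by (intro ereal_mult_mono) (auto intro: order.trans[of _ "ereal (19 / 20)"])
    finally show "1 / 2 < l1_dim \<mu> * measure_hausdorff_dim \<mu>" .
    fix c' :: real assume c': "0 < c' \<and> c' \<le> 1 / 10"
    then show "hausdorff_dim (well_approximable (\<lambda>q. real q powr (- 1 - c')) \<inter> measure_support \<mu>)
            = measure_hausdorff_dim \<mu> - ereal (c' / (2 + c'))"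
      unfolding law support_law measure_hausdorff_dim_law by (simp add: hausdorff_dim_well_approximable)
  qed simp
qed

end
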